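(* Let $\delta>0$ and $k\geq 0$ (real) be fixed. Suppose that $X,q\to\infty$ with $X\ll(\log q)^{2-\delta}$. Then $$\frac{1}{\varphi^*(q)}\sum_{\chi\ (\mathrm{mod}\ q)}^{*}|P_X(\chi)|^{2k}\sim a_k\prod_{\substack{p\leq X\\ p\mid q}}\Bigl(\sum_{m\geq0}\frac{d_k(p^m)^2}{p^m}\Bigr)^{-1}(e^{\gamma}\log X)^{k^2}.$$ If in addition $w(q)\ll X^{1+\epsilon}$ for every $\epsilon>0$, then $$\frac{1}{\varphi^*(q)}\sum_{\chi\ (\mathrm{mod}\ q)}^{*}|P_X(\chi)|^{2k}\sim a_k\prod_{p\mid q}\Bigl(\sum_{m\geq0}\frac{d_k(p^m)^2}{p^m}\Bigr)^{-1}(e^{\gamma}\log X)^{k^2}.$$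
   Context: $\sum^*$ denotes summation over the primitive Dirichlet characters $\chi$ modulo $q$, and $\varphi^*(q)$ is the number of them; $q$ runs over positive integers with $\varphi^*(q)>0$ (i.e. $q\not\equiv2\pmod 4$). The asymptotics are along any family of pairs $(X,q)$ with $X$ real, $X\to\infty$, $q\to\infty$ satisfying the stated constraints. $w(q)$ is the number of distinct prime factors of $q$; $\gamma$ is Euler's constant; $p$ denotes a prime. For a real number $X\ge2$, $$P_X(\chi)=\exp\Bigl(\sum_{2\le n\leq X}\frac{\Lambda(n)\chi(n)}{n^{1/2}\log n}\Bigr),$$ with $\Lambda$ von Mangoldt's function. For real $k$, $d_k(p^m)=\Gamma(m+k)/(m!\,\Gamma(k))=k(k+1)\cdots(k+m-1)/m!$ (with $d_k(1)=1$). Finally $$a_k=\prod_p\Bigl(\Bigl(1-\frac1p\Bigr)^{k^2}\sum_{m\geq0}\frac{d_k(p^m)^2}{p^m}\Bigr).$$ *)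

theory Defs
  imports
    "HOL-Analysis.Analysis"
    "HOL-Library.Landau_Symbols"
    "HOL-Number_Theory.Number_Theory"
    "HOL-Number_Theory.Prime_Powers"
begin

section \<open>Dirichlet characters\<close>

text \<open>
  A Dirichlet character modulo \<open>q\<close> is regarded as a function on the integers, equal to \<open>0\<close>
  precisely at the integers that are not coprime to \<open>q\<close>.  The normalisation \<open>chi 1 = 1\<close> follows.
\<close>

definition dirichlet_character :: "nat \<Rightarrow> (int \<Rightarrow> complex) \<Rightarrow> bool" where
  "dirichlet_character q chi \<longleftrightarrow> q > 0 \<and>
     (\<forall>m n. chi (m * n) = chi m * chi n) \<and>
     (\<forall>n. chi (n + int q) = chi n) \<and>
     (\<forall>n. chi n = 0 \<longleftrightarrow> \<not> coprime n (int q))"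

text \<open>
  A character is primitive if it is not induced by a character of a proper divisor of the
  modulus.  The trivial character modulo \<open>1\<close> is primitive.
\<close>

definition primitive_character :: "nat \<Rightarrow> (int \<Rightarrow> complex) \<Rightarrow> bool" where
  "primitive_character q chi \<longleftrightarrow> dirichlet_character q chi \<and>
     \<not> (\<exists>d \<psi>. d dvd q \<and> d < q \<and> dirichlet_character d \<psi> \<and>
              (\<forall>n. coprime n (int q) \<longrightarrow> chi n = \<psi> n))"

definition phi_star :: "nat \<Rightarrow> nat" where
  "phi_star q = card {chi. primitive_character q chi}"

lemma dirichlet_character_1:
  assumes "dirichlet_character q chi"
  shows "chi 1 = 1"
proof -
  have "chi (1 * 1) = chi 1 * chi 1" and "chi 1 \<noteq> 0"
    using assms unfolding dirichlet_character_def by (blast, simp)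
  thus ?thesis by simp
qed

lemma dirichlet_character_power:
  assumes "dirichlet_character q chi"
  shows "chi (a ^ n) = chi a ^ n"
proof (induction n)
  case 0
  show ?case using dirichlet_character_1[OF assms] by simp
next
  case (Suc n)
  thus ?case using assms by (simp add: dirichlet_character_def)
qed

lemma dirichlet_character_mod:
  assumes "dirichlet_character q chi"
  shows "chi (n mod int q) = chi n"
proof -
  have step: "chi (m + int q) = chi m" for m
    using assms by (simp add: dirichlet_character_def)
  have nat_step: "chi (m + int j * int q) = chi m" for m j
  proof (induction j)
    case (Suc j)
    have "m + int (Suc j) * int q = (m + int j * int q) + int q"
      by (simp add: algebra_simps)
    thus ?case using Suc step by metis
  qed simp
  have int_step: "chi (m + j * int q) = chi m" for m j
  proof (cases "j \<ge> 0")
    case True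
    thus ?thesis using nat_step[of m "nat j"] by simp
  next
    case False
    thus ?thesis using nat_step[of "m + j * int q" "nat (-j)"] by simp
  qed
  show ?thesis
    using int_step[of "n mod int q" "n div int q"] by simp
qed

text \<open>There are only finitely many characters of a given modulus, so \<open>phi_star\<close> and sums over
  the primitive characters have their intended meaning.\<close>

lemma finite_dirichlet_characters: "finite {chi. dirichlet_character q chi}"
proof (cases "q = 0")
  case True
  thus ?thesis by (simp add: dirichlet_character_def)
next
  case False
  hence q: "q > 0" by simp
  define S where "S = insert 0 {z::complex. z ^ totient q = 1}"
  have fin_S: "finite S"
    unfolding S_def using q by (simp add: finite_roots_unity Suc_le_eq)
  let ?r = "\<lambda>chi. restrict chi {0..<int q}"
  have val: "chi n \<in> S" if chi: "dirichlet_character q chi" for chi n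
  proof (cases "coprime n (int q)")
    case False
    thus ?thesis using chi by (simp add: dirichlet_character_def S_def)
  next
    case True
    define m where "m = nat (n mod int q)"
    have m: "int m = n mod int q" using q by (simp add: m_def)
    have "coprime (int m) (int q)" using True m by (simp add: coprime_mod_left_iff q)
    hence "[m ^ totient q = 1] (mod q)"
      by (intro euler_theorem) (simp add: coprime_int_iff)
    hence "[int m ^ totient q = 1] (mod int q)"
      by (metis cong_int_iff of_nat_1 of_nat_power)
    hence "chi (int m ^ totient q) = chi 1"
      by (metis chi cong_def dirichlet_character_mod)
    hence "chi (int m) ^ totient q = 1"
      by (simp add: dirichlet_character_power[OF chi] dirichlet_character_1[OF chi])
    thus ?thesis
      using dirichlet_character_mod[OF chi, of n] by (simp add: m S_def)
  qed
  have "?r ` {chi. dirichlet_character q chi} \<subseteq> ({0..<int q} \<rightarrow>\<^sub>E S)"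
    using val by auto
  hence "finite (?r ` {chi. dirichlet_character q chi})"
    by (rule finite_subset) (intro finite_PiE fin_S; simp)
  moreover have "inj_on ?r {chi. dirichlet_character q chi}"
  proof (rule inj_onI, rule ext)
    fix chi \<psi> :: "int \<Rightarrow> complex" and n :: int
    assume *: "chi \<in> {chi. dirichlet_character q chi}" "\<psi> \<in> {chi. dirichlet_character q chi}"
      and eq: "?r chi = ?r \<psi>"
    have "n mod int q \<in> {0..<int q}" using q by simp
    hence "chi (n mod int q) = \<psi> (n mod int q)"
      using fun_cong[OF eq, of "n mod int q"] by simp
    thus "chi n = \<psi> n" using * by (simp add: dirichlet_character_mod)
  qed
  ultimately show ?thesis by (rule finite_imageD)
qed

lemma finite_primitive_characters: "finite {chi. primitive_character q chi}"
  by (rule finite_subset[OF _ finite_dirichlet_characters[of q]])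
     (auto simp: primitive_character_def)


section \<open>The prime-power Euler product and its moments\<close>

definition P_X :: "real \<Rightarrow> (int \<Rightarrow> complex) \<Rightarrow> complex" where
  "P_X X chi = exp (\<Sum>n | 2 \<le> n \<and> real n \<le> X.
     mangoldt n * chi (int n) / of_real (real n powr (1/2) * ln (real n)))"

definition primitive_moment :: "real \<Rightarrow> real \<Rightarrow> nat \<Rightarrow> real" where
  "primitive_moment k X q =
     1 / real (phi_star q) * (\<Sum>chi | primitive_character q chi. cmod (P_X X chi) powr (2 * k))"

text \<open>
  The value of the generalised divisor function \<open>d\<^sub>k\<close> at \<open>p ^ m\<close>, which does not depend on the
  prime \<open>p\<close>.  The rising factorial, rather than a quotient of Gamma values, also covers \<open>k = 0\<close>.
\<close>

definition d_primepow :: "real \<Rightarrow> nat \<Rightarrow> real" where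
  "d_primepow k m = pochhammer k m / fact m"

definition local_factor :: "real \<Rightarrow> nat \<Rightarrow> real" where
  "local_factor k p = (\<Sum>m. (d_primepow k m)\<^sup>2 / real p ^ m)"

definition a_const :: "real \<Rightarrow> real" where
  "a_const k = prodinf (\<lambda>p. if prime p
     then (1 - 1 / real p) powr (k\<^sup>2) * local_factor k p else 1)"

end

theory Submission
  imports Defs "HOL-Real_Asymp.Real_Asymp"
begin

text \<open>
  As \<open>chi\<close> is completely multiplicative, \<open>P_X X chi\<close> raised to the power \<open>k\<close> is a finite Euler product
  over the primes \<open>p \<le> X\<close> with \<open>\<not> p dvd q\<close>, hence a Dirichlet series \<open>\<Sum>n. w n * chi n\<close> with \<open>w \<ge> 0\<close>
  supported on \<open>X\<close>-smooth numbers coprime to \<open>q\<close>.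
  Averaging its squared modulus over the primitive characters leaves the diagonal \<open>\<Sum>n. (w n)\<^sup>2\<close>.
  The average of \<open>chi m * cnj (chi n)\<close> with \<open>m \<noteq> n\<close> is at most
  \<open>min 1 (\<bar>m - n\<bar> / \<phi>) \<le> (m * n / \<phi>) powr \<eta>\<close>, where \<open>\<phi> = phi_star q\<close> is at least \<open>sqrt q / 4\<close>.
  No truncation of the series is therefore needed: the off-diagonal terms contribute at most
  \<open>\<phi> powr (-\<eta>) * (\<Sum>n. w n * n powr \<eta>)\<^sup>2 \<le> \<phi> powr (-\<eta>) * exp (4 * k * X powr (1/2 + \<eta>))\<close>,
  which tends to \<open>0\<close> for small \<open>\<eta>\<close> because \<open>X\<close> is at most of order \<open>ln q powr (2 - \<delta>)\<close>.
  The diagonal is an Euler product whose factors agree with \<open>local_factor k p\<close> up to terms \<open>p ^ m\<close>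
  exceeding \<open>X\<close>, and Mertens' third theorem evaluates the product of the local factors.

  In Mertens' theorem, partial summation shows that the sum of \<open>mangoldt n / (n * ln n)\<close> over \<open>n \<le> x\<close> is
  \<open>ln (ln x) + c + o(1)\<close>. The constant \<open>c\<close> is Euler's by an Abelian comparison of the logarithm of the
  zeta function at \<open>1 + \<sigma>\<close> with \<open>- ln (1 - exp (-\<sigma>)) = (\<Sum>m. exp (-\<sigma> * m) / m)\<close> as \<open>\<sigma>\<close> tends to \<open>0\<close>.

  For the second claim, the primes dividing \<open>q\<close> and exceeding \<open>X\<close> have reciprocals summing to \<open>o(1)\<close>:
  those up to \<open>X powr (1 + 2 * \<epsilon>)\<close> contribute at most \<open>ln (1 + 2 * \<epsilon>) + o(1)\<close> by Mertens, and there are too few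
  of the others.
\<close>

section \<open>Sums over prime powers\<close>

text \<open>Raising the bound for the average to a power \<open>\<eta>\<close> makes it a product of
  a function of \<open>m\<close> and a function of \<open>n\<close>, so the double sum is the square
  of a single Euler product. That product costs \<open>exp (4 * k * X powr (1/2 + \<eta>))\<close>,
  while \<open>phi_star q powr (-\<eta>)\<close> saves about \<open>exp (\<eta> * ln q / 2)\<close>.
  The saving wins as soon as \<open>(2 - \<delta>) * (1/2 + \<eta>) < 1\<close>, which is where the
  exponent 2 of \<open>ln q\<close> comes from. The sum in \<open>P_X\<close> stops at
  \<open>p ^ j \<le> X\<close>, so its local factors are not \<open>(1 - z) powr (-k)\<close> but
  exponentials of truncated logarithm series. Their coefficients are nonnegative, at most
  \<open>d_primepow k m\<close>, and equal to it for \<open>m\<close> up to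
  \<open>max_exponent\<close>; these three facts carry the whole comparison with
  \<open>local_factor\<close>. In Mertens' theorem, blocks between consecutive powers of e take the
  place of integrals: \<open>ln n\<close> is known up to 1 on each block, the main term becomes a
  harmonic number, and Euler's constant enters as the limit of \<open>harm m - ln m\<close>.\<close>

text \<open>For \<open>p \<ge> 2\<close> and \<open>N \<ge> 1\<close> this is the integer part of
  \<open>log p N\<close>, so a prime \<open>p\<close> contributes exactly
  \<open>max_exponent N p\<close> of its powers to \<open>{2..N}\<close>.\<close>

definition max_exponent :: "nat \<Rightarrow> nat \<Rightarrow> nat" where
  "max_exponent N p = Max {j. p ^ j \<le> N}"

lemma power_le_iff_max_exponent:
  assumes "p \<ge> 2" "N \<ge> 1"
  shows "p ^ j \<le> N \<longleftrightarrow> j \<le> max_exponent N p"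
proof -
  have "{j. p ^ j \<le> N} \<subseteq> {..N}"
  proof safe
    fix j assume "p ^ j \<le> N"
    moreover have "j < 2 ^ j" by (rule less_exp)
    moreover have "(2::nat) ^ j \<le> p ^ j" using assms(1) by (rule power_mono) simp
    ultimately show "j \<le> N" by linarith
  qed
  hence fin: "finite {j. p ^ j \<le> N}" using finite_subset by blast
  moreover have "p ^ 0 \<le> N" using assms by simp
  ultimately have max: "p ^ max_exponent N p \<le> N"
    unfolding max_exponent_def using Max_in[of "{j. p ^ j \<le> N}"] by blast
  show ?thesis
  proof
    assume "p ^ j \<le> N"
    thus "j \<le> max_exponent N p" unfolding max_exponent_def using fin by (intro Max_ge) auto
  next
    assume "j \<le> max_exponent N p"
    hence "p ^ j \<le> p ^ max_exponent N p" using assms by (intro power_increasing) auto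
    thus "p ^ j \<le> N" using max by simp
  qed
qed

lemma max_exponent_ge_1:
  assumes "prime p" "p \<le> N"
  shows "max_exponent N p \<ge> 1"
  using power_le_iff_max_exponent[of p N 1] assms prime_ge_2_nat[of p] by simp

abbreviation primes_upto :: "nat \<Rightarrow> nat set" where
  "primes_upto N \<equiv> {p. prime p \<and> p \<le> N}"

lemma finite_primes_le [simp]: "finite (primes_upto N)"
  by (rule finite_subset[of _ "{..N}"]) auto

text \<open>Because \<open>mangoldt (p ^ j) / ln (p ^ j) = 1 / j\<close>, such a sum splits into
  truncated logarithm series, one for each prime. The weight \<open>f\<close> is
  \<open>1 / n\<close> or \<open>n powr (-(1+\<sigma>))\<close> for Mertens' theorem and
  \<open>chi n * n powr (-1/2)\<close> for \<open>P_X\<close>.\<close>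

lemma sum_mangoldt_eq_sum_primes:
  fixes f :: "nat \<Rightarrow> 'a :: {real_normed_field}"
  shows "(\<Sum>n\<in>{2..N}. mangoldt n / of_real (ln (real n)) * f n) =
         (\<Sum>p\<in>primes_upto N. \<Sum>j\<in>{1..max_exponent N p}. f (p ^ j) / of_nat j)"
proof -
  define T where "T = (SIGMA p:primes_upto N. {1..max_exponent N p})"
  have T: "prime p" "j \<ge> 1" "p ^ j \<le> N" "p ^ j \<ge> 2" if "(p, j) \<in> T" for p j
  proof -
    show p: "prime p" and j: "j \<ge> 1" using that by (auto simp: T_def)
    show "p ^ j \<le> N"
      using that prime_ge_2_nat[of p] power_le_iff_max_exponent[of p N j] by (auto simp: T_def)
    have "p ^ 1 \<le> p ^ j" using p j prime_gt_0_nat by (intro power_increasing) (auto simp: Suc_le_eq)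
    thus "p ^ j \<ge> 2" using prime_ge_2_nat[OF p] by simp
  qed
  have inj: "inj_on (\<lambda>(p, j). p ^ j) T"
  proof (rule inj_onI, clarify)
    fix p i q j assume *: "(p, i) \<in> T" "(q, j) \<in> T" "p ^ i = q ^ j"
    show "p = q \<and> i = j"
      using T[OF *(1)] T[OF *(2)] *(3) prime_power_inj''[of p q i j] by auto
  qed
  have img: "(\<lambda>(p, j). p ^ j) ` T = {n \<in> {2..N}. primepow n}"
  proof (intro equalityI subsetI)
    fix n assume "n \<in> (\<lambda>(p, j). p ^ j) ` T"
    then obtain p j where n: "n = p ^ j" "(p, j) \<in> T" by auto
    show "n \<in> {n \<in> {2..N}. primepow n}"
      using T[OF n(2)] n(1) by auto
  next
    fix n assume n: "n \<in> {n \<in> {2..N}. primepow n}"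
    then obtain p j where pj: "prime p" "j > 0" "n = p ^ j" by (auto simp: primepow_def)
    have "p ^ 1 \<le> p ^ j" using pj prime_gt_0_nat by (intro power_increasing) (auto simp: Suc_le_eq)
    hence "(p, j) \<in> T"
      using n pj prime_ge_2_nat[of p] power_le_iff_max_exponent[of p N j] by (auto simp: T_def)
    thus "n \<in> (\<lambda>(p, j). p ^ j) ` T" using pj(3) by force
  qed
  have "(\<Sum>n\<in>{2..N}. mangoldt n / of_real (ln (real n)) * f n) =
        (\<Sum>n\<in>(\<lambda>(p, j). p ^ j) ` T. mangoldt n / of_real (ln (real n)) * f n)"
    unfolding img by (rule sum.mono_neutral_right) (auto simp: mangoldt_def)
  also have "\<dots> = (\<Sum>(p, j)\<in>T. mangoldt (p ^ j) / of_real (ln (real (p ^ j))) * f (p ^ j))"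
    by (subst sum.reindex[OF inj]) (simp add: case_prod_unfold)
  also have "\<dots> = (\<Sum>(p, j)\<in>T. f (p ^ j) / of_nat j)"
  proof (intro sum.cong refl, clarify)
    fix p j assume pj: "(p, j) \<in> T"
    have p: "ln (real p) \<noteq> 0" "real p > 0" using prime_gt_1_nat[OF T(1)[OF pj]] by auto
    have "ln (real (p ^ j)) = real j * ln (real p)" using p by (simp add: ln_realpow)
    thus "mangoldt (p ^ j) / of_real (ln (real (p ^ j))) * f (p ^ j) = f (p ^ j) / of_nat j"
      using T[OF pj] p by (simp add: mangoldt_primepow)
  qed
  also have "\<dots> = (\<Sum>p\<in>primes_upto N. \<Sum>j\<in>{1..max_exponent N p}. f (p ^ j) / of_nat j)"
    unfolding T_def by (subst sum.Sigma) auto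
  finally show ?thesis .
qed

text \<open>Numbers composed of primes in \<open>P\<close> correspond to extensional exponent
  vectors in \<open>PiE P (\<lambda>_. UNIV)\<close>; with this indexing a product of power series
  over \<open>P\<close> is multiplied out by \<open>infsum_prod_PiE_abs\<close>.\<close>

definition prime_power_prod :: "nat set \<Rightarrow> (nat \<Rightarrow> nat) \<Rightarrow> nat" where
  "prime_power_prod P e = (\<Prod>p\<in>P. p ^ e p)"

lemma powr_nat_power: "real (p ^ j) powr s = (real p powr s) ^ j"
  by (induction j) (auto simp: powr_mult)

lemma prime_power_prod_powr:
  "real (prime_power_prod P e) powr s = (\<Prod>p\<in>P. (real p powr s) ^ e p)"
  by (simp add: prime_power_prod_def prod_powr_distrib powr_nat_power del: of_nat_power)

lemma inj_on_prime_power_prod: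
  assumes "finite P" "\<And>p. p \<in> P \<Longrightarrow> prime p"
  shows "inj_on (prime_power_prod P) (PiE P (\<lambda>_. UNIV))"
proof (rule inj_onI)
  fix e f assume ef: "e \<in> PiE P (\<lambda>_. UNIV)" "f \<in> PiE P (\<lambda>_. UNIV)"
    "prime_power_prod P e = prime_power_prod P f"
  show "e = f"
  proof
    fix p
    show "e p = f p"
    proof (cases "p \<in> P")
      case True
      thus ?thesis
        using multiplicity_prod_prime_powers[of P p e] multiplicity_prod_prime_powers[of P p f] ef(3) assms
        by (simp add: prime_power_prod_def)
    qed (use ef in \<open>auto simp: PiE_def extensional_def\<close>)
  qed
qed

lemma prime_power_prod_pos:
  assumes "\<And>p. p \<in> P \<Longrightarrow> prime p"
  shows "prime_power_prod P e > 0"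
  unfolding prime_power_prod_def using assms by (intro prod_pos) (simp add: prime_gt_0_nat)

text \<open>All prime factors of a number up to \<open>N\<close> are at most \<open>N\<close>; hence
  the Euler product over \<open>primes_upto N\<close> dominates the partial sum of zeta up to
  \<open>N\<close>.\<close>

lemma prime_power_prod_surj:
  assumes "n \<ge> 1" "n \<le> N"
  shows "n \<in> prime_power_prod (primes_upto N) ` PiE (primes_upto N) (\<lambda>_. UNIV)"
proof
  let ?P = "primes_upto N"
  define e where "e = restrict (\<lambda>p. multiplicity p n) ?P"
  show "e \<in> PiE ?P (\<lambda>_. UNIV)" by (simp add: e_def)
  have "n = (\<Prod>p\<in>prime_factors n. p ^ multiplicity p n)"
    using assms by (intro prime_factorization_nat) simp
  also have "\<dots> = (\<Prod>p\<in>?P. p ^ multiplicity p n)"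
  proof (rule prod.mono_neutral_left)
    show "prime_factors n \<subseteq> ?P"
      using assms by (auto simp: prime_factors_dvd dest!: dvd_imp_le)
    show "\<forall>p\<in>?P - prime_factors n. p ^ multiplicity p n = 1"
      using assms by (auto simp: prime_factors_multiplicity)
  qed auto
  also have "\<dots> = prime_power_prod ?P e"
    unfolding prime_power_prod_def e_def by (intro prod.cong) auto
  finally show "n = prime_power_prod ?P e" .
qed

text \<open>\<open>infsum_prod_PiE_abs\<close> yields only the value of the infinite sum. Since
  \<open>infsum\<close> is 0 for a family that is not summable, a positive value certifies
  summability.\<close>

lemma prod_PiE_has_sum:
  fixes f :: "'a \<Rightarrow> 'b \<Rightarrow> real"
  assumes fin: "finite A" and sm: "\<And>x. x \<in> A \<Longrightarrow> f x summable_on B x"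
    and nn: "\<And>x y. f x y \<ge> 0" and pos: "\<And>x. x \<in> A \<Longrightarrow> infsum (f x) (B x) > 0"
  shows "((\<lambda>g. \<Prod>x\<in>A. f x (g x)) has_sum (\<Prod>x\<in>A. infsum (f x) (B x))) (PiE A B)"
proof -
  have "infsum (\<lambda>g. \<Prod>x\<in>A. f x (g x)) (PiE A B) = (\<Prod>x\<in>A. infsum (f x) (B x))"
    using sm nn by (intro infsum_prod_PiE_abs fin) auto
  moreover have "(\<Prod>x\<in>A. infsum (f x) (B x)) > 0"
    using pos by (intro prod_pos) auto
  ultimately show ?thesis
    by (metis has_sum_infsum infsum_not_exists less_irrefl)
qed

abbreviation prime_power_tail :: "(nat \<Rightarrow> real) \<Rightarrow> nat \<Rightarrow> nat \<Rightarrow> real" where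
  "prime_power_tail c N p \<equiv> (\<Sum>m. c (m + Suc (max_exponent N p)) / real p ^ (m + Suc (max_exponent N p)))"

text \<open>The exponents \<open>m\<close> in the tail satisfy \<open>m \<ge> 2\<close> and \<open>p ^ m > N\<close>, so
  \<open>p powr (-m) \<le> N powr (-1/4) * p powr (-3/4 * m)\<close>, which is summable over \<open>p\<close> and \<open>m\<close>.\<close>

lemma prime_power_tail_bound:
  fixes c :: "nat \<Rightarrow> real"
  assumes nn: "\<And>m. c m \<ge> 0" and sm: "summable (\<lambda>m. c m * (2 powr (-3/4)) ^ m)"
  obtains K where "K \<ge> 0"
    "\<And>N p. prime p \<Longrightarrow> p \<le> N \<Longrightarrow>
       summable (\<lambda>m. c (m + Suc (max_exponent N p)) / real p ^ (m + Suc (max_exponent N p)))"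
    "\<And>N. (\<Sum>p\<in>primes_upto N. prime_power_tail c N p)
       \<le> K * real N powr (-1/4)"
proof -
  define y :: real where "y = 2 powr (-3/4)"
  have y: "y > 0" by (simp add: y_def)
  define S where "S = (\<Sum>m. c m * y ^ m) / y\<^sup>2"
  have sm': "summable (\<lambda>m. c m * y ^ m)" using sm by (simp add: y_def)
  have S0: "S \<ge> 0" unfolding S_def using sm' nn y by (intro divide_nonneg_pos suminf_nonneg) auto
  define Z where "Z = (\<Sum>p. real p powr (-3/2))"
  have smZ: "summable (\<lambda>p. real p powr (-3/2))" using summable_real_powr_iff[of "-3/2"] by simp
  have Z0: "Z \<ge> 0" unfolding Z_def by (intro suminf_nonneg smZ) auto
  have term_le: "c m / real p ^ m \<le> real N powr (-1/4) * real p powr (-3/2) * (c m * y ^ m / y\<^sup>2)"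
    if p: "prime p" "p \<le> N" and m: "m > max_exponent N p" for p N m
  proof -
    have p2: "real p \<ge> 2" using prime_ge_2_nat[OF p(1)] by simp
    have N1: "N \<ge> 1" using prime_gt_0_nat[OF p(1)] p(2) by linarith
    have "m \<ge> 2" using max_exponent_ge_1[OF p] m by simp
    have "p ^ m > N"
      using power_le_iff_max_exponent[of p N m] m N1 prime_ge_2_nat[OF p(1)] by simp
    hence big: "real p ^ m \<ge> real N" by (metis less_imp_le of_nat_le_iff of_nat_power)
    have pw: "real p ^ m = real p powr (real m)" using p2 by (simp add: powr_realpow)
    have "1 / real p ^ m = (real p ^ m) powr (-1/4) * real p powr (- 3/4 * real m)"
    proof -
      have "(real p ^ m) powr (-1/4) * real p powr (- 3/4 * real m) =
            real p powr (real m * (-1/4) + (- 3/4 * real m))"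
        by (simp only: pw powr_powr powr_add)
      also have "real m * (-1/4) + (- 3/4 * real m) = - real m" by simp
      finally show ?thesis by (simp only: pw powr_minus_divide)
    qed
    also have "\<dots> \<le> real N powr (-1/4) * real p powr (-3/4 * real m)"
      using big N1 by (intro mult_right_mono powr_mono2') auto
    \<comment> \<open>Two of the \<open>m\<close> factors \<open>p powr (-3/4)\<close> are kept for
      convergence over \<open>p\<close>; the other \<open>m - 2\<close> are largest at
      \<open>p = 2\<close>, hence the hypothesis on \<open>2 powr (-3/4)\<close>.\<close>
    also have "real p powr (-3/4 * real m) = real p powr (-3/2) * real p powr (-3/4 * (real m - 2))"
    proof -
      have "-3/4 * real m = -3/2 + -3/4 * (real m - 2)" by (simp add: field_simps)
      thus ?thesis by (simp only: powr_add)
    qed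
    also have "real p powr (-3/4 * (real m - 2)) \<le> 2 powr (-3/4 * (real m - 2))"
      using p2 \<open>m \<ge> 2\<close> by (intro powr_mono2') (auto simp: mult_nonneg_nonneg)
    also have "2 powr (-3/4 * (real m - 2)) = y ^ m / y\<^sup>2"
    proof -
      have "y ^ m / y\<^sup>2 = y ^ (m - 2)" using \<open>m \<ge> 2\<close> y by (simp add: power_diff)
      also have "\<dots> = 2 powr (-3/4 * real (m - 2))"
        by (simp add: y_def powr_powr flip: powr_realpow)
      finally show ?thesis using \<open>m \<ge> 2\<close> by (simp add: of_nat_diff)
    qed
    finally have "1 / real p ^ m \<le> real N powr (-1/4) * (real p powr (-3/2) * (y ^ m / y\<^sup>2))"
      by (simp add: mult_left_mono)
    from mult_left_mono[OF this nn[of m]] show ?thesis by (simp add: mult_ac)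
  qed
  have smy: "summable (\<lambda>m. c (m + k) * y ^ (m + k) / y\<^sup>2)" for k
    using sm' by (intro summable_divide) (simp add: summable_iff_shift[of "\<lambda>m. c m * y ^ m"])
  have smt: "summable (\<lambda>m. c (m + Suc (max_exponent N p)) / real p ^ (m + Suc (max_exponent N p)))"
    if p: "prime p" "p \<le> N" for p N
  proof (rule summable_comparison_test')
    show "summable (\<lambda>m. real N powr (-1/4) * real p powr (-3/2) *
       (c (m + Suc (max_exponent N p)) * y ^ (m + Suc (max_exponent N p)) / y\<^sup>2))"
      by (intro summable_mult smy)
    show "norm (c (m + Suc (max_exponent N p)) / real p ^ (m + Suc (max_exponent N p)))
       \<le> real N powr (-1/4) * real p powr (-3/2) *
       (c (m + Suc (max_exponent N p)) * y ^ (m + Suc (max_exponent N p)) / y\<^sup>2)" for m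
      using term_le[OF p, of "m + Suc (max_exponent N p)"] nn by simp
  qed
  have "(\<Sum>p\<in>primes_upto N. prime_power_tail c N p)
       \<le> (S * Z) * real N powr (-1/4)" for N
  proof -
    have "(\<Sum>p\<in>primes_upto N. prime_power_tail c N p)
      \<le> (\<Sum>p\<in>primes_upto N. real N powr (-1/4) * real p powr (-3/2) * S)"
    proof (intro sum_mono)
      fix p assume "p \<in> primes_upto N"
      hence p: "prime p" "p \<le> N" by auto
      let ?k = "Suc (max_exponent N p)"
      have "(\<Sum>m. c (m + ?k) / real p ^ (m + ?k)) \<le>
        (\<Sum>m. real N powr (-1/4) * real p powr (-3/2) * (c (m + ?k) * y ^ (m + ?k) / y\<^sup>2))"
        by (intro suminf_le smt[OF p] summable_mult smy allI term_le[OF p]) simp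
      also have "\<dots> = real N powr (-1/4) * real p powr (-3/2) * (\<Sum>m. c (m + ?k) * y ^ (m + ?k) / y\<^sup>2)"
        by (intro suminf_mult smy)
      also have "(\<Sum>m. c (m + ?k) * y ^ (m + ?k) / y\<^sup>2) \<le> S"
      proof -
        have "(\<Sum>m. c (m + ?k) * y ^ (m + ?k) / y\<^sup>2) = (\<Sum>m. c (m + ?k) * y ^ (m + ?k)) / y\<^sup>2"
          using summable_iff_shift[of "\<lambda>m. c m * y ^ m" ?k] sm' by (intro suminf_divide) blast
        also have "(\<Sum>m. c (m + ?k) * y ^ (m + ?k)) \<le> (\<Sum>m. c m * y ^ m)"
          using suminf_split_initial_segment[OF sm', of ?k] nn y
            sum_nonneg[of "{..<?k}" "\<lambda>m. c m * y ^ m"] by simp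
        finally show ?thesis unfolding S_def using y by (simp add: divide_right_mono)
      qed
      finally show "(\<Sum>m. c (m + ?k) / real p ^ (m + ?k)) \<le> real N powr (-1/4) * real p powr (-3/2) * S"
        by (simp add: mult_left_mono)
    qed
    also have "\<dots> = S * real N powr (-1/4) * (\<Sum>p\<in>primes_upto N. real p powr (-3/2))"
      by (simp add: sum_distrib_left sum_distrib_right mult_ac)
    also have "\<dots> \<le> S * real N powr (-1/4) * Z"
      unfolding Z_def using S0 by (intro mult_left_mono sum_le_suminf smZ) auto
    finally show ?thesis by (simp add: mult_ac)
  qed
  moreover have "S * Z \<ge> 0" using S0 Z0 by simp
  ultimately show ?thesis using that smt by blast
qed


section \<open>Dirichlet characters and primitive characters\<close>

lemma prod_one_minus_eq_sum_Pow:
  fixes x :: "'a \<Rightarrow> 'b :: comm_ring_1"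
  assumes "finite A"
  shows "(\<Prod>a\<in>A. 1 - x a) = (\<Sum>S\<in>Pow A. (-1) ^ card S * (\<Prod>a\<in>S. x a))"
  using assms
proof (induction A)
  case (insert a A)
  have inj: "inj_on (insert a) (Pow A)"
    using insert.hyps by (auto simp: inj_on_def)
  have disj: "Pow A \<inter> insert a ` Pow A = {}"
    using insert.hyps by auto
  have "(\<Sum>S\<in>Pow (insert a A). (-1) ^ card S * (\<Prod>a\<in>S. x a)) =
        (\<Sum>S\<in>Pow A. (-1) ^ card S * (\<Prod>a\<in>S. x a)) +
        (\<Sum>S\<in>Pow A. (-1) ^ card (insert a S) * (\<Prod>a\<in>insert a S. x a))"
    using insert.hyps disj by (simp add: Pow_insert sum.union_disjoint sum.reindex[OF inj])
  also have "(\<Sum>S\<in>Pow A. (-1) ^ card (insert a S) * (\<Prod>a\<in>insert a S. x a)) =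
             (\<Sum>S\<in>Pow A. - x a * ((-1) ^ card S * (\<Prod>a\<in>S. x a)))"
  proof (intro sum.cong refl)
    fix S assume S: "S \<in> Pow A"
    hence "finite S" "a \<notin> S" using insert.hyps finite_subset by auto
    thus "(-1) ^ card (insert a S) * (\<Prod>a\<in>insert a S. x a) = - x a * ((-1) ^ card S * (\<Prod>a\<in>S. x a))"
      by (simp add: algebra_simps)
  qed
  finally show ?case
    using insert by (simp add: sum_distrib_left [symmetric] algebra_simps sum_negf)
qed auto

section \<open>Extending characters from subgroups of the unit group\<close>

text \<open>A character of a subgroup of the units modulo \<open>d\<close>. The subgroup is given as
  a union of residue classes of integers, and \<open>chi\<close> is unspecified outside it. Closure
  under inverses comes from finiteness, see \<open>partial_character_cancel\<close>.\<close>

definition partial_character :: "nat \<Rightarrow> int set \<Rightarrow> (int \<Rightarrow> complex) \<Rightarrow> bool" where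
  "partial_character d H chi \<longleftrightarrow> 1 \<in> H \<and> (\<forall>a\<in>H. coprime a (int d)) \<and>
     (\<forall>a\<in>H. \<forall>b\<in>H. a * b \<in> H \<and> chi (a * b) = chi a * chi b) \<and>
     (\<forall>a\<in>H. \<forall>b. [b = a] (mod int d) \<longrightarrow> b \<in> H \<and> chi b = chi a) \<and>
     (\<forall>a\<in>H. chi a \<noteq> 0)"

lemma partial_characterD:
  assumes "partial_character d H chi"
  shows "1 \<in> H" "a \<in> H \<Longrightarrow> coprime a (int d)"
    "a \<in> H \<Longrightarrow> b \<in> H \<Longrightarrow> a * b \<in> H" "a \<in> H \<Longrightarrow> b \<in> H \<Longrightarrow> chi (a * b) = chi a * chi b"
    "a \<in> H \<Longrightarrow> [b = a] (mod int d) \<Longrightarrow> b \<in> H" "a \<in> H \<Longrightarrow> [b = a] (mod int d) \<Longrightarrow> chi b = chi a"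
    "a \<in> H \<Longrightarrow> chi a \<noteq> 0"
  using assms unfolding partial_character_def by blast+

lemma partial_character_one:
  assumes "partial_character d H chi"
  shows "chi 1 = 1"
  using partial_characterD(4)[OF assms, of 1 1] partial_characterD(1,7)[OF assms] by auto

lemma partial_character_power:
  assumes "partial_character d H chi" "a \<in> H"
  shows "a ^ n \<in> H" "chi (a ^ n) = chi a ^ n"
proof -
  have "a ^ n \<in> H \<and> chi (a ^ n) = chi a ^ n"
  proof (induction n)
    case 0
    show ?case using partial_characterD(1)[OF assms(1)] partial_character_one[OF assms(1)] by simp
  next
    case (Suc n)
    thus ?case using partial_characterD(3,4)[OF assms(1), of a "a ^ n"] assms(2) by simp
  qed
  thus "a ^ n \<in> H" "chi (a ^ n) = chi a ^ n" by auto
qed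

lemma int_euler_theorem:
  assumes "coprime a (int d)" "d > 0"
  shows "[a ^ totient d = 1] (mod int d)"
proof -
  define m where "m = nat (a mod int d)"
  have m: "int m = a mod int d" using assms by (simp add: m_def)
  have "coprime (int m) (int d)" using assms m by (simp add: coprime_mod_left_iff)
  hence "[m ^ totient d = 1] (mod d)"
    by (intro euler_theorem) (simp add: coprime_int_iff)
  hence "[int m ^ totient d = 1] (mod int d)"
    by (metis cong_int_iff of_nat_1 of_nat_power)
  thus ?thesis by (simp add: m cong_def power_mod)
qed

text \<open>By Euler's theorem \<open>a ^ (totient d - 1)\<close> inverts \<open>a\<close> modulo
  \<open>d\<close>, and as a power of \<open>a\<close> it lies in \<open>H\<close>.\<close>

lemma partial_character_cancel:
  assumes pc: "partial_character d H chi" and d: "d > 0" and a: "a \<in> H" and ab: "a * b \<in> H"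
  shows "b \<in> H"
proof -
  have cop: "coprime a (int d)" using partial_characterD(2)[OF pc a] .
  obtain t where t: "totient d = Suc t"
    using d by (metis gr0_implies_Suc totient_gt_0_iff)
  have "a ^ t * (a * b) \<in> H"
    using partial_characterD(3)[OF pc] partial_character_power(1)[OF pc a] ab by blast
  moreover have "[a ^ totient d * b = 1 * b] (mod int d)"
    by (intro cong_mult int_euler_theorem cop d cong_refl)
  hence "[b = a ^ t * (a * b)] (mod int d)"
    by (simp add: t mult_ac cong_sym_eq)
  ultimately show ?thesis using partial_characterD(5)[OF pc] by blast
qed

lemma exists_root_ne_1:
  fixes c :: complex
  assumes n: "n \<ge> 2" and c: "c \<noteq> 0"
  obtains z where "z ^ n = c" "z \<noteq> 1"
proof -
  have "card {z. z ^ n = c} = n" using n c by (intro card_nth_roots) auto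
  hence "\<not> {z. z ^ n = c} \<subseteq> {1}" using n card_mono[of "{1::complex}" "{z. z ^ n = c}"] by auto
  thus ?thesis using that by auto
qed

text \<open>If \<open>n\<close> is the order of \<open>x\<close> modulo \<open>H\<close>, a character of \<open>H\<close> extends to the group generated by
  \<open>H\<close> and \<open>x\<close> by sending \<open>x\<close> to any \<open>n\<close>-th root of its value at \<open>x ^ n\<close>; as \<open>n \<ge> 2\<close>, one of these
  roots is different from \<open>1\<close>.\<close>

lemma partial_character_extend:
  assumes pc: "partial_character d H chi" and d: "d > 0"
    and x: "coprime x (int d)" "x \<notin> H"
  obtains H' chi' where "partial_character d H' chi'" "H \<subseteq> H'" "x \<in> H'" "\<forall>a\<in>H. chi' a = chi a"
    "chi' x \<noteq> 1"
proof -
  note pcD = partial_characterD[OF pc]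
  define n where "n = (LEAST j. j > 0 \<and> x ^ j \<in> H)"
  have "x ^ totient d \<in> H"
    using pcD(5)[OF pcD(1)] int_euler_theorem[OF x(1) d] by blast
  hence ex: "totient d > 0 \<and> x ^ totient d \<in> H" using d by simp
  have n: "n > 0" "x ^ n \<in> H"
    using LeastI[of "\<lambda>j. j > 0 \<and> x ^ j \<in> H", OF ex] unfolding n_def by auto
  have nmin: "j = 0" if "j < n" "x ^ j \<in> H" for j
    using not_less_Least[of j "\<lambda>j. j > 0 \<and> x ^ j \<in> H"] that unfolding n_def by auto
  have "n \<noteq> 1" using n x(2) by auto
  with n have n2: "n \<ge> 2" by simp
  obtain z where z: "z ^ n = chi (x ^ n)" "z \<noteq> 1"
    using exists_root_ne_1[OF n2 pcD(7)[OF n(2)]] by metis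
  have z0: "z \<noteq> 0" using z(1) pcD(7)[OF n(2)] n by (auto simp: power_0_left)
  \<comment> \<open>Divide \<open>j\<close> by \<open>n\<close>: the remainder is again an exponent
    that puts \<open>x\<close> into \<open>H\<close>, so it is 0 by the minimality of
    \<open>n\<close>.\<close>
  have xpow: "chi (x ^ j) = z ^ j" if j: "x ^ j \<in> H" for j
  proof -
    have split: "x ^ j = (x ^ n) ^ (j div n) * x ^ (j mod n)"
      by (simp flip: power_mult power_add)
    have "x ^ (j mod n) \<in> H"
      using partial_character_cancel[OF pc d partial_character_power(1)[OF pc n(2)]] j split by metis
    hence "j mod n = 0" using nmin n by simp
    hence "j = n * (j div n)" by auto
    thus ?thesis
      by (metis partial_character_power(2)[OF pc n(2)] power_mult z(1))
  qed
  \<comment> \<open>Independence of the representation \<open>h * x ^ j\<close>: after cancelling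
    \<open>x ^ i\<close>, the power \<open>x ^ (j - i)\<close> lies in \<open>H\<close>, where
    \<open>xpow\<close> fixes its value.\<close>
  have wd_aux: "chi h * z ^ j = chi h' * z ^ i"
    if h: "h \<in> H" "h' \<in> H" "[h * x ^ j = h' * x ^ i] (mod int d)" "i \<le> j" for h h' i j
  proof -
    have "coprime (x ^ i) (int d)" using x by simp
    moreover have "[x ^ i * (h * x ^ (j - i)) = x ^ i * h'] (mod int d)"
      using h(3,4) by (simp add: mult_ac flip: power_add)
    ultimately have c: "[h * x ^ (j - i) = h'] (mod int d)"
      using cong_mult_lcancel by blast
    hence hx: "h * x ^ (j - i) \<in> H" using pcD(5)[OF h(2)] by blast
    hence xH: "x ^ (j - i) \<in> H" using partial_character_cancel[OF pc d h(1)] by blast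
    have "chi h' = chi h * z ^ (j - i)"
      using pcD(6)[OF h(2) c] pcD(4)[OF h(1) xH] xpow[OF xH] by simp
    thus ?thesis using h(4) by (simp flip: power_add)
  qed
  have wd: "chi h * z ^ j = chi h' * z ^ i"
    if "h \<in> H" "h' \<in> H" "[h * x ^ j = h' * x ^ i] (mod int d)" for h h' i j
    using wd_aux[of h h' j i] wd_aux[of h' h i j] that by (metis cong_sym nle_le)
  \<comment> \<open>\<open>R\<close> is the graph of the extension to the group generated by
    \<open>H\<close> and \<open>x\<close>.\<close>
  define R where "R y w \<longleftrightarrow> (\<exists>h\<in>H. \<exists>j. [y = h * x ^ j] (mod int d) \<and> w = chi h * z ^ j)" for y w
  define H' where "H' = {y. \<exists>w. R y w}"
  define chi' where "chi' y = (THE w. R y w)" for y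
  have uniq: "w = w'" if "R y w" "R y w'" for y w w'
    using that wd unfolding R_def by (metis cong_sym cong_trans)
  have chi'_eq: "chi' y = w" if "R y w" for y w
    unfolding chi'_def using that uniq by blast
  have R_H: "R h (chi h)" if "h \<in> H" for h
    unfolding R_def using that by (intro bexI[of _ h] exI[of _ 0]) auto
  have R_x: "R x z"
    unfolding R_def using pcD(1) partial_character_one[OF pc]
    by (intro bexI[of _ 1] exI[of _ 1]) auto
  have R_mult: "R (a * b) (v * w)" if ab: "R a v" "R b w" for a b v w
  proof -
    obtain h j h' j' where *: "h \<in> H" "[a = h * x ^ j] (mod int d)" "v = chi h * z ^ j"
        "h' \<in> H" "[b = h' * x ^ j'] (mod int d)" "w = chi h' * z ^ j'"
      using ab unfolding R_def by blast
    have "[a * b = (h * x ^ j) * (h' * x ^ j')] (mod int d)"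
      by (intro cong_mult *)
    hence "[a * b = (h * h') * x ^ (j + j')] (mod int d)"
      by (simp add: power_add mult_ac)
    moreover have "v * w = chi (h * h') * z ^ (j + j')"
      using * pcD(4) by (simp add: power_add mult_ac)
    ultimately show ?thesis unfolding R_def using pcD(3) * by blast
  qed
  have R_cong: "R b w" if "R a w" "[b = a] (mod int d)" for a b w
    using that cong_trans unfolding R_def by blast
  have R_cop: "coprime a (int d)" "w \<noteq> 0" if aw: "R a w" for a w
  proof -
    obtain h j where *: "h \<in> H" "[a = h * x ^ j] (mod int d)" "w = chi h * z ^ j"
      using aw unfolding R_def by blast
    have "coprime (h * x ^ j) (int d)" using pcD(2) * x by auto
    thus "coprime a (int d)" using *(2) cong_sym cong_imp_coprime by blast
    show "w \<noteq> 0" using * pcD(7) z0 by simp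
  qed
  have "partial_character d H' chi'"
    unfolding partial_character_def
  proof (intro conjI ballI allI impI)
    show "1 \<in> H'" using R_H pcD(1) unfolding H'_def by blast
  next
    fix a assume "a \<in> H'"
    then obtain v where v: "R a v" unfolding H'_def by blast
    thus "coprime a (int d)" "chi' a \<noteq> 0" using R_cop v chi'_eq by auto
    show "b \<in> H'" "chi' b = chi' a" if "[b = a] (mod int d)" for b
      using R_cong[OF v that] chi'_eq v unfolding H'_def by auto
    fix b assume "b \<in> H'"
    then obtain w where w: "R b w" unfolding H'_def by blast
    show "a * b \<in> H'" "chi' (a * b) = chi' a * chi' b"
      using R_mult[OF v w] v w chi'_eq unfolding H'_def by auto
  qed
  moreover have "H \<subseteq> H'" using R_H unfolding H'_def by blast
  moreover have "x \<in> H'" using R_x unfolding H'_def by blast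
  moreover have "\<forall>a\<in>H. chi' a = chi a" using R_H chi'_eq by blast
  moreover have "chi' x \<noteq> 1" using chi'_eq[OF R_x] z(2) by simp
  ultimately show ?thesis using that by blast
qed

lemma dirichlet_character_of_partial:
  assumes pc: "partial_character d H chi" and d: "d > 0" and H: "H = {a. coprime a (int d)}"
  shows "dirichlet_character d (\<lambda>n. if n \<in> H then chi n else 0)"
  unfolding dirichlet_character_def
proof (intro conjI allI d)
  note pcD = partial_characterD[OF pc]
  fix m n :: int
  show "(if m * n \<in> H then chi (m * n) else 0) =
        (if m \<in> H then chi m else 0) * (if n \<in> H then chi n else 0)"
    using pcD(4)[of m n] by (auto simp: H)
  have "[n + int d = n] (mod int d)" by (simp add: cong_def)
  moreover from this have "n + int d \<in> H \<longleftrightarrow> n \<in> H"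
    unfolding H by (metis cong_imp_coprime cong_sym mem_Collect_eq)
  ultimately show "(if n + int d \<in> H then chi (n + int d) else 0) = (if n \<in> H then chi n else 0)"
    using pcD(6)[of n "n + int d"] by auto
  show "(if n \<in> H then chi n else 0) = 0 \<longleftrightarrow> \<not> coprime n (int d)"
    using pcD(7)[of n] by (auto simp: H)
qed

text \<open>Extend the trivial character of the class of 1 so that \<open>a\<close> gets a value
  other than 1. Among all partial characters with such a value, one whose domain has the most
  residue classes is defined on all units, since otherwise \<open>partial_character_extend\<close>
  would enlarge it without changing the value at \<open>a\<close>.\<close>

lemma dirichlet_character_separating:
  assumes d: "d > 0" and a: "coprime a (int d)" "\<not> [a = 1] (mod int d)"
  obtains chi where "dirichlet_character d chi" "chi a \<noteq> 1"
proof -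
  define H0 where "H0 = {n. [n = 1] (mod int d)}"
  have pc0: "partial_character d H0 (\<lambda>_. 1)"
    unfolding partial_character_def H0_def
  proof (safe, goal_cases)
    case (2 n) thus ?case by (metis cong_imp_coprime cong_sym coprime_1_left)
  next
    case (3 m n) thus ?case using cong_mult[of m 1 "int d" n 1] by simp
  qed (auto intro: cong_trans)
  have "a \<notin> H0" using a(2) by (simp add: H0_def)
  from partial_character_extend[OF pc0 d a(1) this]
  obtain H1 chi1 where pc1: "partial_character d H1 chi1" "a \<in> H1" "chi1 a \<noteq> 1" by metis
  define Q where "Q H \<longleftrightarrow> (\<exists>chi. partial_character d H chi \<and> a \<in> H \<and> chi a \<noteq> 1)" for H
  define f where "f H = card (H \<inter> {0..<int d})" for H
  have "\<exists>H. Q H \<and> (\<forall>H'. Q H' \<longrightarrow> f H' \<le> f H)"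
  proof (rule ex_has_greatest_nat[of Q H1 f "Suc d"])
    show "Q H1" unfolding Q_def using pc1 by blast
    show "\<forall>H. Q H \<longrightarrow> f H < Suc d"
    proof (intro allI impI)
      fix H
      have "f H \<le> card {0..<int d}" unfolding f_def by (intro card_mono) auto
      thus "f H < Suc d" by simp
    qed
  qed
  then obtain H where H: "Q H" "\<And>H'. Q H' \<Longrightarrow> f H' \<le> f H" by blast
  then obtain chi where chi: "partial_character d H chi" "a \<in> H" "chi a \<noteq> 1"
    unfolding Q_def by blast
  have "H = {a. coprime a (int d)}"
  proof (rule ccontr)
    assume "H \<noteq> {a. coprime a (int d)}"
    then obtain x where x: "coprime x (int d)" "x \<notin> H"
      using partial_characterD(2)[OF chi(1)] by blast
    from partial_character_extend[OF chi(1) d x]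
    obtain H' chi' where *: "partial_character d H' chi'" "H \<subseteq> H'" "x \<in> H'" "\<forall>a\<in>H. chi' a = chi a"
      by metis
    have "Q H'" unfolding Q_def using * chi by auto
    moreover have "f H < f H'" unfolding f_def
    proof (intro psubset_card_mono psubsetI)
      have "x mod int d \<in> H'"
        using partial_characterD(5)[OF *(1,3)] by (simp add: cong_def)
      moreover have "x mod int d \<notin> H"
        using partial_characterD(5)[OF chi(1), of "x mod int d" x] x by (auto simp: cong_def)
      moreover have "x mod int d \<in> {0..<int d}" using d by simp
      ultimately show "H \<inter> {0..<int d} \<noteq> H' \<inter> {0..<int d}"
        by blast
    qed (use *(2) in auto)
    ultimately show False using H(2) by force
  qed
  from dirichlet_character_of_partial[OF chi(1) d this] chi(2,3) show ?thesis
    using that by auto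
qed

section \<open>Orthogonality of Dirichlet characters\<close>

lemma dirichlet_character_mult:
  "dirichlet_character d chi \<Longrightarrow> chi (m * n) = chi m * chi n"
  by (simp add: dirichlet_character_def)

lemma dirichlet_character_eq_0_iff:
  "dirichlet_character d chi \<Longrightarrow> chi n = 0 \<longleftrightarrow> \<not> coprime n (int d)"
  by (simp add: dirichlet_character_def)

lemma dirichlet_character_cong:
  assumes "dirichlet_character d chi" "[m = n] (mod int d)"
  shows "chi m = chi n"
  by (metis assms cong_def dirichlet_character_mod)

lemma dirichlet_character_pow_totient:
  assumes "dirichlet_character d chi" "coprime a (int d)"
  shows "chi a ^ totient d = 1"
proof -
  have "d > 0" using assms(1) by (simp add: dirichlet_character_def)
  hence "chi (a ^ totient d) = chi 1"
    using dirichlet_character_cong[OF assms(1) int_euler_theorem] assms(2) by blast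
  thus ?thesis
    by (simp add: dirichlet_character_power[OF assms(1)] dirichlet_character_1[OF assms(1)])
qed

lemma norm_dirichlet_character:
  assumes "dirichlet_character d chi"
  shows "norm (chi a) = (if coprime a (int d) then 1 else 0)"
proof (cases "coprime a (int d)")
  case True
  have "d > 0" using assms by (simp add: dirichlet_character_def)
  have "norm (chi a) ^ totient d = 1"
    using dirichlet_character_pow_totient[OF assms True] by (metis norm_one norm_power)
  thus ?thesis using \<open>d > 0\<close> True power_eq_1_iff[of "norm (chi a)" "totient d"] by simp
next
  case False
  thus ?thesis using assms by (simp add: dirichlet_character_def)
qed

lemma dirichlet_character_times:
  assumes "dirichlet_character d chi" "dirichlet_character d psi"
  shows "dirichlet_character d (\<lambda>n. chi n * psi n)"
  using assms unfolding dirichlet_character_def by auto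

lemma dirichlet_character_cnj:
  assumes "dirichlet_character d chi"
  shows "dirichlet_character d (\<lambda>n. cnj (chi n))"
  using assms unfolding dirichlet_character_def by auto

lemma dirichlet_character_cnj_mult_self:
  assumes "dirichlet_character d chi"
  shows "cnj (chi a) * chi a = (if coprime a (int d) then 1 else 0)"
  using norm_dirichlet_character[OF assms, of a]
  by (metis complex_norm_square mult.commute of_real_0 of_real_1 power_one zero_power2)

text \<open>Multiplication by a character \<open>psi\<close> with \<open>psi a \<noteq> 1\<close>
  permutes the characters, so the sum equals \<open>psi a\<close> times itself.\<close>

lemma sum_dirichlet_characters_eq_0:
  assumes d: "d > 0" and a: "coprime a (int d)" "\<not> [a = 1] (mod int d)"
  shows "(\<Sum>chi | dirichlet_character d chi. chi a) = 0"
proof -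
  obtain psi where psi: "dirichlet_character d psi" "psi a \<noteq> 1"
    using dirichlet_character_separating[OF d a] by blast
  \<comment> \<open>\<open>cnj psi * psi\<close> is 1 only at the units, but \<open>chi\<close>
    vanishes at all other integers.\<close>
  have absorb: "cnj (psi n) * psi n * chi n = chi n" if "dirichlet_character d chi" for chi n
    using dirichlet_character_cnj_mult_self[OF psi(1)] dirichlet_character_eq_0_iff[OF that] by auto
  have "(\<Sum>chi | dirichlet_character d chi. chi a) =
        (\<Sum>chi | dirichlet_character d chi. psi a * chi a)"
  proof (rule sum.reindex_bij_witness[where i = "\<lambda>chi n. psi n * chi n"
        and j = "\<lambda>chi n. cnj (psi n) * chi n"], goal_cases)
    case (1 chi) thus ?case using absorb[of chi] by (auto simp: mult_ac)
  next
    case (2 chi) thus ?case using dirichlet_character_times[OF dirichlet_character_cnj[OF psi(1)]] by auto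
  next
    case (3 chi) thus ?case using absorb[of chi] by (auto simp: mult_ac)
  next
    case (4 chi) thus ?case using dirichlet_character_times[OF psi(1)] by auto
  next
    case (5 chi) thus ?case using absorb[of chi] by (auto simp: mult_ac)
  qed
  also have "\<dots> = psi a * (\<Sum>chi | dirichlet_character d chi. chi a)"
    by (simp add: sum_distrib_left)
  finally show ?thesis using psi(2) by simp
qed

text \<open>Representatives are taken from 0 upwards, to fit \<open>mod\<close>. For
  \<open>d = 1\<close> this gives \<open>{0}\<close>, whereas \<open>totatives 1\<close> is
  \<open>{1}\<close>.\<close>

definition units_mod :: "nat \<Rightarrow> int set" where
  "units_mod d = {n \<in> {0..<int d}. coprime n (int d)}"

lemma finite_units_mod: "finite (units_mod d)"
  by (rule finite_subset[of _ "{0..<int d}"]) (auto simp: units_mod_def)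

lemma card_units_mod:
  assumes "d > 0"
  shows "card (units_mod d) = totient d"
proof (cases "d = 1")
  case True
  have "units_mod 1 = {0}" by (auto simp: units_mod_def)
  thus ?thesis by (simp add: True)
next
  case False
  hence d: "d > 1" using assms by simp
  have "units_mod d = int ` totatives d"
  proof safe
    fix n assume n: "n \<in> units_mod d"
    hence "n \<noteq> 0" using d by (auto simp: units_mod_def)
    hence "nat n \<in> totatives d" "n = int (nat n)"
      using n by (auto simp: units_mod_def in_totatives_iff coprime_int_iff [symmetric])
    thus "n \<in> int ` totatives d" by blast
  next
    fix n assume "n \<in> totatives d"
    thus "int n \<in> units_mod d"
      using totatives_less[of n d] d by (auto simp: units_mod_def in_totatives_iff)
  qed
  thus ?thesis by (simp add: card_image totient_def)
qed

lemma sum_units_dirichlet_character_eq_0: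
  assumes chi: "dirichlet_character d chi" and b: "coprime b (int d)" "chi b \<noteq> 1"
  shows "(\<Sum>n\<in>units_mod d. chi n) = 0"
proof -
  have d: "d > 0" using chi by (simp add: dirichlet_character_def)
  define f where "f n = (b * n) mod int d" for n
  have f_sub: "f ` units_mod d \<subseteq> units_mod d"
    using b d by (auto simp: units_mod_def f_def coprime_mod_left_iff)
  have f_inj: "inj_on f (units_mod d)"
  proof
    fix m n assume mn: "m \<in> units_mod d" "n \<in> units_mod d" "f m = f n"
    hence "[b * m = b * n] (mod int d)" by (simp add: f_def cong_def)
    hence "[m = n] (mod int d)" using b(1) cong_mult_lcancel by blast
    thus "m = n" using mn by (simp add: units_mod_def cong_def)
  qed
  have "f ` units_mod d = units_mod d"
    using f_sub f_inj finite_units_mod by (simp add: endo_inj_surj)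
  hence "(\<Sum>n\<in>units_mod d. chi n) = (\<Sum>n\<in>units_mod d. chi (f n))"
    using sum.reindex[OF f_inj, of chi] by simp
  also have "\<dots> = (\<Sum>n\<in>units_mod d. chi b * chi n)"
    by (simp add: f_def dirichlet_character_mod[OF chi] dirichlet_character_mult[OF chi])
  also have "\<dots> = chi b * (\<Sum>n\<in>units_mod d. chi n)"
    by (simp add: sum_distrib_left)
  finally show ?thesis using b(2) by simp
qed

definition principal_character :: "nat \<Rightarrow> int \<Rightarrow> complex" where
  "principal_character d n = (if coprime n (int d) then 1 else 0)"

lemma dirichlet_character_principal:
  assumes "d > 0"
  shows "dirichlet_character d (principal_character d)"
proof -
  have "coprime (n + int d) (int d) \<longleftrightarrow> coprime n (int d)" for n
    by (simp add: coprime_iff_gcd_eq_1)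
  thus ?thesis
    using assms by (auto simp: dirichlet_character_def principal_character_def)
qed

text \<open>Sum \<open>chi n\<close> over all characters and all units in both orders. Summing over
  \<open>n\<close> first, only the principal character contributes, giving \<open>totient d\<close>;
  summing over \<open>chi\<close> first, only the residue of 1 contributes, giving the number of
  characters.\<close>

lemma card_dirichlet_characters:
  assumes d: "d > 0"
  shows "card {chi. dirichlet_character d chi} = totient d"
proof -
  let ?C = "{chi. dirichlet_character d chi}"
  have "(\<Sum>chi\<in>?C. \<Sum>n\<in>units_mod d. chi n) =
        (\<Sum>chi\<in>?C. if chi = principal_character d then of_nat (totient d) else 0)"
  proof (intro sum.cong refl)
    fix chi assume chi: "chi \<in> ?C"
    show "(\<Sum>n\<in>units_mod d. chi n) = (if chi = principal_character d then of_nat (totient d) else 0)"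
    proof (cases "chi = principal_character d")
      case True
      have "(\<Sum>n\<in>units_mod d. chi n) = (\<Sum>n\<in>units_mod d. 1)"
        by (intro sum.cong) (auto simp: True principal_character_def units_mod_def)
      thus ?thesis by (simp add: card_units_mod d True)
    next
      case False
      then obtain b where b: "chi b \<noteq> principal_character d b" by blast
      have "coprime b (int d)"
        using b chi dirichlet_character_eq_0_iff[of d chi b] by (auto simp: principal_character_def)
      thus ?thesis
        using sum_units_dirichlet_character_eq_0[of d chi b] chi b False
        by (auto simp: principal_character_def)
    qed
  qed
  also have "\<dots> = of_nat (totient d)"
    using dirichlet_character_principal[OF d] finite_dirichlet_characters[of d]
    by (simp add: sum.delta)
  also have "(\<Sum>chi\<in>?C. \<Sum>n\<in>units_mod d. chi n) = (\<Sum>n\<in>units_mod d. \<Sum>chi\<in>?C. chi n)"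
    by (rule sum.swap)
  \<comment> \<open>\<open>1 mod int d\<close> is the representative of 1 in
    \<open>units_mod d\<close>; it is 0 when \<open>d = 1\<close>.\<close>
  also have "\<dots> = (\<Sum>n\<in>units_mod d. if n = 1 mod int d then of_nat (card ?C) else 0)"
  proof (intro sum.cong refl)
    fix n assume n: "n \<in> units_mod d"
    show "(\<Sum>chi\<in>?C. chi n) = (if n = 1 mod int d then of_nat (card ?C) else 0)"
    proof (cases "n = 1 mod int d")
      case True
      have "(\<Sum>chi\<in>?C. chi n) = (\<Sum>chi\<in>?C. 1)"
        by (intro sum.cong) (auto simp: True dirichlet_character_mod dirichlet_character_1)
      thus ?thesis by (simp add: True)
    next
      case False
      hence "\<not> [n = 1] (mod int d)" using n by (auto simp: cong_def units_mod_def)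
      thus ?thesis
        using sum_dirichlet_characters_eq_0[OF d] n False by (auto simp: units_mod_def)
    qed
  qed
  also have "\<dots> = of_nat (card ?C)"
  proof -
    have "1 mod int d \<in> units_mod d"
      using d by (auto simp: units_mod_def coprime_mod_left_iff)
    thus ?thesis by (simp add: sum.delta finite_units_mod)
  qed
  finally show ?thesis by (simp only: of_nat_eq_iff)
qed

text \<open>At a unit \<open>n\<close> the conjugate \<open>cnj (chi n)\<close> is the value of
  \<open>chi\<close> at an inverse \<open>n'\<close> of \<open>n\<close>, so the sum reduces to that
  of \<open>chi (m * n')\<close>.\<close>

lemma sum_dirichlet_characters:
  assumes d: "d > 0" and n: "coprime n (int d)"
  shows "(\<Sum>chi | dirichlet_character d chi. chi m * cnj (chi n)) =
         (if [m = n] (mod int d) then of_nat (totient d) else 0)"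
proof (cases "coprime m (int d)")
  case False
  hence "\<not> [m = n] (mod int d)" using n cong_imp_coprime cong_sym by blast
  moreover have "(\<Sum>chi | dirichlet_character d chi. chi m * cnj (chi n)) = 0"
    using False dirichlet_character_eq_0_iff by (intro sum.neutral) auto
  ultimately show ?thesis by simp
next
  case True
  obtain n' where n': "[n * n' = 1] (mod int d)"
    using cong_solve_coprime_int[OF n] by blast
  have cop: "coprime n' (int d)"
    using n' by (metis cong_imp_coprime cong_sym coprime_1_left coprime_mult_left_iff)
  have eq: "chi m * cnj (chi n) = chi (m * n')" if chi: "dirichlet_character d chi" for chi
  proof -
    have "chi n * chi n' = 1"
      using dirichlet_character_cong[OF chi n'] dirichlet_character_1[OF chi]
        dirichlet_character_mult[OF chi] by simp
    moreover have "cnj (chi n) * chi n = 1"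
      using dirichlet_character_cnj_mult_self[OF chi] n by simp
    ultimately have "cnj (chi n) = chi n'"
      by (metis mult.assoc mult.commute mult_1)
    thus ?thesis by (simp add: dirichlet_character_mult[OF chi])
  qed
  have iff: "[m * n' = 1] (mod int d) \<longleftrightarrow> [m = n] (mod int d)"
  proof
    assume "[m * n' = 1] (mod int d)"
    hence "[m * n' = n * n'] (mod int d)" using n' cong_sym cong_trans by blast
    thus "[m = n] (mod int d)" using cop cong_mult_rcancel by blast
  next
    assume "[m = n] (mod int d)"
    hence "[m * n' = n * n'] (mod int d)" by (intro cong_mult) auto
    thus "[m * n' = 1] (mod int d)" using n' cong_trans by blast
  qed
  have "(\<Sum>chi | dirichlet_character d chi. chi m * cnj (chi n)) =
        (\<Sum>chi | dirichlet_character d chi. chi (m * n'))"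
    by (intro sum.cong) (auto simp: eq)
  also have "\<dots> = (if [m * n' = 1] (mod int d) then of_nat (totient d) else 0)"
  proof (cases "[m * n' = 1] (mod int d)")
    case True': True
    have "(\<Sum>chi | dirichlet_character d chi. chi (m * n')) =
          (\<Sum>chi | dirichlet_character d chi. 1)"
    proof (intro sum.cong refl)
      fix chi assume "chi \<in> {chi. dirichlet_character d chi}"
      thus "chi (m * n') = 1"
        using dirichlet_character_cong[OF _ True'] dirichlet_character_1 by (metis mem_Collect_eq)
    qed
    thus ?thesis using True' card_dirichlet_characters[OF d] by simp
  next
    case False
    thus ?thesis using sum_dirichlet_characters_eq_0[OF d _ False] True cop by simp
  qed
  finally show ?thesis by (simp add: iff)
qed

section \<open>Induced characters and inclusion-exclusion\<close>

text \<open>For \<open>d dvd q\<close> these are the characters modulo \<open>q\<close> that factor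
  through the units modulo \<open>d\<close>. As a condition on the kernel, it lets intersections and
  divisibility of moduli be handled without mentioning the inducing character.\<close>

definition induced_characters :: "nat \<Rightarrow> nat \<Rightarrow> (int \<Rightarrow> complex) set" where
  "induced_characters q d =
     {chi. dirichlet_character q chi \<and> (\<forall>n. coprime n (int q) \<longrightarrow> [n = 1] (mod int d) \<longrightarrow> chi n = 1)}"

lemma induced_characters_self:
  "induced_characters q q = {chi. dirichlet_character q chi}"
  using dirichlet_character_cong dirichlet_character_1 unfolding induced_characters_def by fastforce

text \<open>Add to \<open>n\<close> the multiple \<open>d * t\<close>, where \<open>t\<close> is the
  product of the primes dividing \<open>q\<close> but not \<open>n\<close>. Every prime divisor of
  \<open>q\<close> then divides exactly one of \<open>n\<close> and \<open>d * t\<close>: if it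
  divides \<open>n\<close>, it divides neither \<open>d\<close>, which is coprime to
  \<open>n\<close>, nor \<open>t\<close>.\<close>

lemma coprime_lift:
  assumes q: "q > 0" and d: "d dvd q" and n: "coprime n (int d)"
  obtains n' where "[n' = n] (mod int d)" "coprime n' (int q)"
proof -
  define t where "t = (\<Prod>p | p \<in> prime_factors q \<and> \<not> int p dvd n. p)"
  define n' where "n' = n + int d * int t"
  have t: "p dvd t \<longleftrightarrow> \<not> int p dvd n" if p: "p \<in> prime_factors q" for p
  proof -
    have "prime p" using p by auto
    hence "p dvd t \<longleftrightarrow> (\<exists>r\<in>{r. r \<in> prime_factors q \<and> \<not> int r dvd n}. p dvd r)"
      unfolding t_def by (intro prime_dvd_prod_iff) auto
    also have "\<dots> \<longleftrightarrow> \<not> int p dvd n"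
      using p \<open>prime p\<close> by (auto dest: primes_dvd_imp_eq)
    finally show ?thesis .
  qed
  have "coprime n' (int q)"
  proof (rule ccontr)
    assume "\<not> coprime n' (int q)"
    then obtain r where r: "prime r" "r dvd n'" "r dvd int q"
      using prime_factor_int[of "gcd n' (int q)"]
      by (metis abs_gcd_int coprime_iff_gcd_eq_1 gcd_dvd1 gcd_dvd2 dvd_trans)
    define p where "p = nat r"
    have rp: "r = int p" using r by (simp add: p_def prime_ge_0_int)
    have p: "prime p" "p dvd q" using r rp by auto
    hence pq: "p \<in> prime_factors q" using q by (simp add: prime_factors_dvd)
    show False
    proof (cases "int p dvd n")
      case True
      hence "\<not> p dvd t" using t[OF pq] by simp
      moreover have "\<not> p dvd d"
        using n True p(1) coprime_common_divisor[of n "int d" "int p"] by (auto simp: prime_nat_iff)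
      moreover have "int p dvd int d * int t"
        using r(2) True unfolding rp n'_def by (simp add: dvd_add_right_iff)
      hence "p dvd d * t" by (metis of_nat_dvd_iff of_nat_mult)
      ultimately show False using p(1) prime_dvd_mult_iff by blast
    next
      case False
      hence "int p dvd int d * int t" using t[OF pq] by auto
      thus False using r(2) False unfolding rp n'_def by (simp add: dvd_add_left_iff)
    qed
  qed
  moreover have "[n' = n] (mod int d)" by (simp add: n'_def cong_iff_dvd_diff)
  ultimately show ?thesis using that by blast
qed

lemma dirichlet_character_induce:
  assumes q: "q > 0" and d: "d dvd q" and psi: "dirichlet_character d psi"
  shows "(\<lambda>n. if coprime n (int q) then psi n else 0) \<in> induced_characters q d"
proof -
  have cop: "coprime n (int d)" if "coprime n (int q)" for n
    using that d by (metis coprime_divisors dvd_refl of_nat_dvd_iff)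
  have per: "psi (n + int q) = psi n" for n
    using d by (intro dirichlet_character_cong[OF psi]) (auto simp: cong_iff_dvd_diff)
  have "coprime (n + int q) (int q) \<longleftrightarrow> coprime n (int q)" for n
    by (simp add: coprime_iff_gcd_eq_1)
  hence "dirichlet_character q (\<lambda>n. if coprime n (int q) then psi n else 0)"
    unfolding dirichlet_character_def
    using q cop dirichlet_character_mult[OF psi] dirichlet_character_eq_0_iff[OF psi] per by auto
  thus ?thesis
    unfolding induced_characters_def
    using dirichlet_character_cong[OF psi] dirichlet_character_1[OF psi] by auto
qed

lemma induced_characters_cong:
  assumes chi: "chi \<in> induced_characters q d" and q: "q > 0"
    and mn: "coprime m (int q)" "coprime n (int q)" "[m = n] (mod int d)" and d: "d dvd q"
  shows "chi m = chi n"
proof -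
  have ch: "dirichlet_character q chi" using chi by (simp add: induced_characters_def)
  obtain n' where n': "[n * n' = 1] (mod int q)"
    using cong_solve_coprime_int[OF mn(2)] by blast
  have "coprime n' (int q)"
    using n' by (metis cong_imp_coprime cong_sym coprime_1_left coprime_mult_left_iff)
  moreover have "[m * n' = 1] (mod int d)"
    using cong_mult[OF mn(3) cong_refl[of n']] n' d
    by (meson cong_dvd_modulus cong_trans of_nat_dvd_iff)
  ultimately have "chi (m * n') = 1"
    using chi mn(1) by (simp add: induced_characters_def)
  moreover have "chi (n * n') = 1"
    using dirichlet_character_cong[OF ch n'] dirichlet_character_1[OF ch] by simp
  ultimately show ?thesis
    by (simp add: dirichlet_character_mult[OF ch]) (metis mult_cancel_right zero_neq_one mult_zero_right)
qed

text \<open>At a unit \<open>n\<close> modulo \<open>d\<close> the inducing character takes the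
  value of \<open>chi\<close> at any lift of \<open>n\<close> that is coprime to \<open>q\<close>. A
  lift exists by \<open>coprime_lift\<close>, and \<open>induced_characters_cong\<close> makes the
  value independent of the choice.\<close>

lemma induced_charactersE:
  assumes chi: "chi \<in> induced_characters q d" and q: "q > 0" and d: "d dvd q"
  obtains psi where "dirichlet_character d psi" "chi = (\<lambda>n. if coprime n (int q) then psi n else 0)"
proof -
  have ch: "dirichlet_character q chi" using chi by (simp add: induced_characters_def)
  note wd = induced_characters_cong[OF chi q _ _ _ d]
  define L where "L n = (SOME n'. [n' = n] (mod int d) \<and> coprime n' (int q))" for n
  have L: "[L n = n] (mod int d)" "coprime (L n) (int q)" if n: "coprime n (int d)" for n
  proof -
    have "\<exists>n'. [n' = n] (mod int d) \<and> coprime n' (int q)"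
      using coprime_lift[OF q d n] by blast
    from someI_ex[OF this] show "[L n = n] (mod int d)" "coprime (L n) (int q)"
      unfolding L_def by auto
  qed
  define psi where "psi n = (if coprime n (int d) then chi (L n) else 0)" for n
  have cop: "coprime n (int d)" if "coprime n (int q)" for n
    using that d by (metis coprime_divisors dvd_refl of_nat_dvd_iff)
  have psi_eq: "psi n = chi n'" if "[n' = n] (mod int d)" "coprime n' (int q)" for n n'
  proof -
    have c: "coprime n (int d)" using that cop cong_imp_coprime by blast
    have "chi (L n) = chi n'"
      using L[OF c] that by (intro wd) (auto intro: cong_trans cong_sym)
    thus ?thesis by (simp add: psi_def c)
  qed
  have "d > 0" using d q by (metis dvd_0_left_iff gr0I not_less_zero)
  have "dirichlet_character d psi"
    unfolding dirichlet_character_def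
  proof (intro conjI allI)
    fix m n :: int
    show "psi (m * n) = psi m * psi n"
    proof (cases "coprime m (int d) \<and> coprime n (int d)")
      case True
      have "psi (m * n) = chi (L m * L n)"
        using True L by (intro psi_eq) (auto intro: cong_mult)
      thus ?thesis using True by (simp add: psi_def dirichlet_character_mult[OF ch])
    qed (auto simp: psi_def)
    have per: "coprime (n + int d) (int d) \<longleftrightarrow> coprime n (int d)"
      by (simp add: coprime_iff_gcd_eq_1)
    show "psi (n + int d) = psi n"
    proof (cases "coprime n (int d)")
      case True
      have "psi (n + int d) = chi (L n)"
        using L[OF True] by (intro psi_eq) (auto simp: cong_def)
      thus ?thesis by (simp add: psi_def True)
    qed (simp add: psi_def per)
    show "psi n = 0 \<longleftrightarrow> \<not> coprime n (int d)"
      using L(2) dirichlet_character_eq_0_iff[OF ch] by (auto simp: psi_def)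
  qed fact
  moreover have "chi n = (if coprime n (int q) then psi n else 0)" for n
    using psi_eq[of n n] dirichlet_character_eq_0_iff[OF ch] by auto
  ultimately show ?thesis using that by blast
qed

text \<open>Cutting a character modulo \<open>d\<close> down to the integers coprime to
  \<open>q\<close> is a bijection onto the induced characters, injective by
  \<open>coprime_lift\<close>; so orthogonality modulo \<open>d\<close> carries over.\<close>

lemma sum_induced_characters:
  assumes q: "q > 0" and d: "d dvd q" and mn: "coprime m (int q)" "coprime n (int q)"
  shows "(\<Sum>chi\<in>induced_characters q d. chi m * cnj (chi n)) =
         (if [m = n] (mod int d) then of_nat (totient d) else 0)"
proof -
  define E where "E psi = (\<lambda>n. if coprime n (int q) then psi n else (0::complex))" for psi :: "int \<Rightarrow> complex"
  have d0: "d > 0" using d q by (metis dvd_0_left_iff gr0I not_less_zero)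
  have nd: "coprime n (int d)"
    using mn d by (metis coprime_divisors dvd_refl of_nat_dvd_iff)
  have "bij_betw E {psi. dirichlet_character d psi} (induced_characters q d)"
    unfolding bij_betw_def
  proof
    show "inj_on E {psi. dirichlet_character d psi}"
    proof (rule inj_onI, rule ext)
      fix f g :: "int \<Rightarrow> complex" and a
      assume fg: "f \<in> {psi. dirichlet_character d psi}" "g \<in> {psi. dirichlet_character d psi}" "E f = E g"
      show "f a = g a"
      proof (cases "coprime a (int d)")
        case True
        from coprime_lift[OF q d True] obtain a' where a': "[a' = a] (mod int d)" "coprime a' (int q)" .
        have "f a' = g a'" using fun_cong[OF fg(3), of a'] a'(2) by (simp add: E_def)
        thus ?thesis using dirichlet_character_cong[OF _ a'(1)] fg(1,2) by (metis mem_Collect_eq)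
      next
        case False
        thus ?thesis using fg(1,2) dirichlet_character_eq_0_iff by (metis mem_Collect_eq)
      qed
    qed
    show "E ` {psi. dirichlet_character d psi} = induced_characters q d"
    proof
      show "E ` {psi. dirichlet_character d psi} \<subseteq> induced_characters q d"
        using dirichlet_character_induce[OF q d] unfolding E_def by blast
      show "induced_characters q d \<subseteq> E ` {psi. dirichlet_character d psi}"
        using induced_charactersE[OF _ q d] unfolding E_def by blast
    qed
  qed
  hence "(\<Sum>chi\<in>induced_characters q d. chi m * cnj (chi n)) =
         (\<Sum>psi | dirichlet_character d psi. E psi m * cnj (E psi n))"
    by (simp add: sum.reindex_bij_betw[symmetric])
  also have "\<dots> = (\<Sum>psi | dirichlet_character d psi. psi m * cnj (psi n))"
    using mn by (simp add: E_def)
  finally show ?thesis using sum_dirichlet_characters[OF d0 nd] by simp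
qed

lemma induced_characters_mono:
  assumes "chi \<in> induced_characters q d" "d dvd e"
  shows "chi \<in> induced_characters q e"
proof -
  have "[n = 1] (mod int d)" if "[n = 1] (mod int e)" for n
    using that assms(2) by (meson cong_dvd_modulus of_nat_dvd_iff)
  thus ?thesis using assms(1) unfolding induced_characters_def by blast
qed

text \<open>A proper divisor \<open>d\<close> of \<open>q\<close> divides \<open>q div p\<close> for
  any prime \<open>p\<close> dividing \<open>q div d\<close>, so primitivity can be tested on the
  maximal proper divisors.\<close>

lemma primitive_character_iff:
  assumes q: "q > 0"
  shows "primitive_character q chi \<longleftrightarrow>
    dirichlet_character q chi \<and> (\<forall>p\<in>prime_factors q. chi \<notin> induced_characters q (q div p))"
proof (intro iffI conjI ballI notI)
  assume "primitive_character q chi"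
  thus "dirichlet_character q chi" by (simp add: primitive_character_def)
next
  fix p assume prim: "primitive_character q chi" and p: "p \<in> prime_factors q"
    and chi: "chi \<in> induced_characters q (q div p)"
  have pq: "prime p" "p dvd q" using p by auto
  have d: "q div p dvd q" "q div p < q"
    using pq q prime_gt_1_nat[of p] by (auto simp: div_dvd_iff_mult dvd_div_iff_mult)
  from induced_charactersE[OF chi q d(1)] obtain psi where
    "dirichlet_character (q div p) psi" "chi = (\<lambda>n. if coprime n (int q) then psi n else 0)" .
  with d prim show False unfolding primitive_character_def by fastforce
next
  assume *: "dirichlet_character q chi \<and> (\<forall>p\<in>prime_factors q. chi \<notin> induced_characters q (q div p))"
  show "primitive_character q chi"
    unfolding primitive_character_def
  proof (intro conjI notI)
    assume "\<exists>d \<psi>. d dvd q \<and> d < q \<and> dirichlet_character d \<psi> \<and> (\<forall>n. coprime n (int q) \<longrightarrow> chi n = \<psi> n)"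
    then obtain d psi where d: "d dvd q" "d < q" "dirichlet_character d psi"
      "\<And>n. coprime n (int q) \<Longrightarrow> chi n = psi n" by blast
    obtain e where e: "q = d * e" using d(1) by blast
    have "e \<noteq> 1" using d(2) e by auto
    then obtain p where p: "prime p" "p dvd e" using prime_factor_nat by blast
    have pq: "p \<in> prime_factors q" using p e q by (auto simp: prime_factors_dvd)
    obtain f where f: "e = p * f" using p(2) by blast
    have "d dvd q div p" using p(1) by (simp add: e f)
    moreover have "chi \<in> induced_characters q d"
      using * d dirichlet_character_cong[OF d(3)] dirichlet_character_1[OF d(3)]
      by (auto simp: induced_characters_def)
    ultimately have "chi \<in> induced_characters q (q div p)"
      by (rule induced_characters_mono[rotated])
    thus False using * pq by blast
  qed (use * in blast)
qed

text \<open>Let \<open>n\<close> be a unit modulo \<open>q\<close> that is 1 modulo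
  \<open>g\<close>. As \<open>p\<close> and \<open>e\<close> are coprime, the Chinese remainder
  theorem provides a \<open>u\<close> that is 1 modulo \<open>g * e\<close> and agrees with
  \<open>n\<close> modulo \<open>g * p\<close>. Then \<open>chi n = chi u = 1\<close>.\<close>

lemma induced_characters_Int:
  assumes q: "q = g * (p * e)" "q > 0" and pe: "coprime p e"
    and chi: "chi \<in> induced_characters q (g * e)" "chi \<in> induced_characters q (g * p)"
  shows "chi \<in> induced_characters q g"
proof -
  have ch: "dirichlet_character q chi" using chi by (simp add: induced_characters_def)
  have "chi n = 1" if n: "coprime n (int q)" "[n = 1] (mod int g)" for n
  proof -
    obtain t where t: "n = 1 + int g * t"
      using n(2) by (metis add.commute cong_iff_lin cong_sym)
    obtain e' where e': "[int e * e' = 1] (mod int p)"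
      using cong_solve_coprime_int[of "int e" "int p"] pe by (auto simp: coprime_commute)
    define u where "u = 1 + int g * int e * (e' * t)"
    have u1: "[u = 1] (mod int (g * e))" by (simp add: u_def cong_iff_dvd_diff)
    have u2: "[u = n] (mod int (g * p))"
    proof -
      have "int p dvd int e * e' - 1" using e' by (simp add: cong_iff_dvd_diff)
      hence "int g * int p dvd int g * ((int e * e' - 1) * t)"
        by (intro mult_dvd_mono) auto
      moreover have "u - n = int g * ((int e * e' - 1) * t)"
        by (simp add: u_def t algebra_simps)
      ultimately show ?thesis by (simp add: cong_iff_dvd_diff)
    qed
    have "coprime u (int (g * e))"
      using u1 by (metis cong_imp_coprime cong_sym coprime_1_left)
    moreover have "coprime u (int (g * p))"
    proof -
      have "coprime n (int (g * p))" using n(1) unfolding q(1) by simp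
      thus ?thesis using u2 cong_imp_coprime cong_sym by blast
    qed
    ultimately have cu: "coprime u (int q)" unfolding q(1) by simp
    have "chi u = 1" using chi(1) cu u1 by (simp add: induced_characters_def)
    moreover have "chi u = chi n"
      using q u2 by (intro induced_characters_cong[OF chi(2) q(2) cu n(1)]) auto
    ultimately show ?thesis by simp
  qed
  thus ?thesis using ch by (simp add: induced_characters_def)
qed

lemma prime_dvd_prod_primes_iff:
  assumes "finite S" "\<And>r. r \<in> S \<Longrightarrow> prime (r::nat)" "prime p"
  shows "p dvd \<Prod>S \<longleftrightarrow> p \<in> S"
proof -
  have "p dvd \<Prod>S \<longleftrightarrow> (\<exists>r\<in>S. p dvd r)"
    using assms by (simp add: prime_dvd_prod_iff)
  also have "\<dots> \<longleftrightarrow> p \<in> S"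
    using assms(2,3) primes_dvd_imp_eq[OF assms(3)] by (metis dvd_refl)
  finally show ?thesis .
qed

lemma prod_prime_factors_subset_dvd:
  assumes "S \<subseteq> prime_factors (q::nat)"
  shows "\<Prod>S dvd q"
proof -
  have "finite S" using assms finite_subset by blast
  thus ?thesis using assms
  proof (induction S)
    case (insert p S)
    have "prime p" "p dvd q" using insert.prems by auto
    moreover have "\<not> p dvd \<Prod>S"
      using insert \<open>prime p\<close> by (subst prime_dvd_prod_primes_iff) auto
    hence "coprime p (\<Prod>S)" using \<open>prime p\<close> prime_imp_coprime by blast
    ultimately show ?case using insert by (simp add: divides_mult)
  qed auto
qed

text \<open>Iterating \<open>induced_characters_Int\<close> turns the intersection over
  \<open>p \<in> S\<close>, as it occurs in inclusion-exclusion, into a condition for a single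
  modulus, to which orthogonality applies.\<close>

lemma induced_characters_prod:
  assumes q: "q > 0" and S: "S \<subseteq> prime_factors q" and chi: "dirichlet_character q chi"
  shows "(\<forall>p\<in>S. chi \<in> induced_characters q (q div p)) \<longleftrightarrow> chi \<in> induced_characters q (q div \<Prod>S)"
proof -
  have "finite S" using S finite_subset by blast
  thus ?thesis using S
  proof (induction S)
    case empty
    thus ?case using chi by (simp add: induced_characters_self)
  next
    case (insert p S)
    have p: "prime p" using insert.prems by auto
    have "p dvd \<Prod>S \<longleftrightarrow> p \<in> S"
      using insert p by (intro prime_dvd_prod_primes_iff) auto
    hence p: "prime p" "\<not> p dvd \<Prod>S" using p insert.hyps by auto
    have "\<Prod>(insert p S) dvd q" using insert.prems by (rule prod_prime_factors_subset_dvd)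
    then obtain g where g: "q = g * (p * \<Prod>S)" using insert.hyps by (auto simp: dvd_def mult_ac)
    have pos: "p > 0" "\<Prod>S > 0" using g q by (auto intro!: Nat.gr0I)
    have divs: "q div p = g * \<Prod>S" "q div \<Prod>S = g * p" "q div \<Prod>(insert p S) = g"
      using pos insert.hyps unfolding g by (auto simp: mult_ac)
    have "(\<forall>r\<in>insert p S. chi \<in> induced_characters q (q div r)) \<longleftrightarrow>
          chi \<in> induced_characters q (g * \<Prod>S) \<and> chi \<in> induced_characters q (g * p)"
      using insert by (simp add: divs)
    also have "\<dots> \<longleftrightarrow> chi \<in> induced_characters q g"
      using induced_characters_Int[OF g q _ ] prime_imp_coprime[OF p] induced_characters_mono
      by (metis dvd_triv_left)
    finally show ?case by (simp add: divs)
  qed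
qed

text \<open>Inclusion-exclusion over the primes \<open>p\<close> for which \<open>chi\<close> is induced from \<open>q div p\<close>: a character is
  imprimitive iff there is such a prime.\<close>

lemma sum_primitive_eq_sum_induced:
  fixes f :: "(int \<Rightarrow> complex) \<Rightarrow> complex"
  assumes q: "q > 0"
  shows "(\<Sum>chi | primitive_character q chi. f chi) =
    (\<Sum>S\<in>Pow (prime_factors q). (-1) ^ card S * (\<Sum>chi\<in>induced_characters q (q div \<Prod>S). f chi))"
proof -
  let ?C = "{chi. dirichlet_character q chi}" and ?P = "prime_factors q"
  let ?x = "\<lambda>chi p. of_bool (chi \<in> induced_characters q (q div p)) :: complex"
  have "(\<Sum>chi | primitive_character q chi. f chi) = (\<Sum>chi\<in>?C. f chi * (\<Prod>p\<in>?P. 1 - ?x chi p))"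
  proof (intro sum.mono_neutral_cong_left)
    show "\<forall>chi\<in>?C - {chi. primitive_character q chi}. f chi * (\<Prod>p\<in>?P. 1 - ?x chi p) = 0"
      by (auto simp: primitive_character_iff[OF q])
    show "f chi = f chi * (\<Prod>p\<in>?P. 1 - ?x chi p)" if "chi \<in> {chi. primitive_character q chi}" for chi
      using that by (simp add: primitive_character_iff[OF q])
  qed (auto simp: finite_dirichlet_characters primitive_character_def)
  also have "\<dots> = (\<Sum>chi\<in>?C. \<Sum>S\<in>Pow ?P. (-1) ^ card S * (of_bool (chi \<in> induced_characters q (q div \<Prod>S)) * f chi))"
  proof (intro sum.cong refl)
    fix chi assume chi: "chi \<in> ?C"
    have eq: "(\<Prod>p\<in>S. ?x chi p) = of_bool (chi \<in> induced_characters q (q div \<Prod>S))" if S: "S \<subseteq> ?P" for S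
    proof -
      have "finite S" using S finite_subset by blast
      hence "(\<Prod>p\<in>S. ?x chi p) = of_bool (\<forall>p\<in>S. chi \<in> induced_characters q (q div p))"
        by (induction S) auto
      thus ?thesis using induced_characters_prod[OF q S] chi by simp
    qed
    have "f chi * (\<Prod>p\<in>?P. 1 - ?x chi p) =
      (\<Sum>S\<in>Pow ?P. f chi * ((-1) ^ card S * (\<Prod>p\<in>S. ?x chi p)))"
      by (simp only: prod_one_minus_eq_sum_Pow[OF finite_set_mset] sum_distrib_left)
    also have "\<dots> = (\<Sum>S\<in>Pow ?P. (-1) ^ card S * (of_bool (chi \<in> induced_characters q (q div \<Prod>S)) * f chi))"
    proof (intro sum.cong refl)
      fix S assume "S \<in> Pow ?P"
      hence "(\<Prod>p\<in>S. ?x chi p) = of_bool (chi \<in> induced_characters q (q div \<Prod>S))"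
        by (intro eq) auto
      thus "f chi * ((-1) ^ card S * (\<Prod>p\<in>S. ?x chi p)) =
        (-1) ^ card S * (of_bool (chi \<in> induced_characters q (q div \<Prod>S)) * f chi)"
        by (simp only: mult_ac)
    qed
    finally show "f chi * (\<Prod>p\<in>?P. 1 - ?x chi p) =
          (\<Sum>S\<in>Pow ?P. (-1) ^ card S * (of_bool (chi \<in> induced_characters q (q div \<Prod>S)) * f chi))" .
  qed
  also have "\<dots> = (\<Sum>S\<in>Pow ?P. (-1) ^ card S * (\<Sum>chi\<in>?C. of_bool (chi \<in> induced_characters q (q div \<Prod>S)) * f chi))"
    by (subst sum.swap) (simp add: sum_distrib_left)
  also have "\<dots> = (\<Sum>S\<in>Pow ?P. (-1) ^ card S * (\<Sum>chi\<in>induced_characters q (q div \<Prod>S). f chi))"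
  proof -
    have "(\<Sum>chi\<in>?C. of_bool (chi \<in> induced_characters q (q div \<Prod>S)) * f chi) =
          (\<Sum>chi\<in>induced_characters q (q div \<Prod>S). f chi)" for S
      by (intro sum.mono_neutral_cong_right)
         (auto simp: finite_dirichlet_characters induced_characters_def)
    thus ?thesis by simp
  qed
  finally show ?thesis .
qed

lemma sum_primitive_characters:
  assumes q: "q > 0" and mn: "coprime m (int q)" "coprime n (int q)"
  shows "(\<Sum>chi | primitive_character q chi. chi m * cnj (chi n)) =
    (\<Sum>S\<in>Pow (prime_factors q). (-1) ^ card S *
      (if [m = n] (mod int (q div \<Prod>S)) then of_nat (totient (q div \<Prod>S)) else 0))"
proof -
  have "q div \<Prod>S dvd q" if "S \<subseteq> prime_factors q" for S
    using prod_prime_factors_subset_dvd[OF that] by (metis dvd_div_mult_self dvd_triv_left)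
  thus ?thesis
    unfolding sum_primitive_eq_sum_induced[OF q]
    by (intro sum.cong refl) (simp add: sum_induced_characters[OF q _ mn])
qed

section \<open>Off-diagonal averages and the number of primitive characters\<close>

lemma inj_on_div_prod_primes:
  assumes q: "(q::nat) > 0"
  shows "inj_on (\<lambda>S. q div \<Prod>S) (Pow (prime_factors q))"
proof (rule inj_onI)
  fix S T assume ST: "S \<in> Pow (prime_factors q)" "T \<in> Pow (prime_factors q)"
    and eq: "q div \<Prod>S = q div \<Prod>T"
  have "\<Prod>S dvd q" "\<Prod>T dvd q"
    using ST by (auto intro: prod_prime_factors_subset_dvd)
  hence "q div \<Prod>S * \<Prod>S = q" "q div \<Prod>T * \<Prod>T = q"
    by simp_all
  have "\<Prod>S = \<Prod>T"
  proof -
    have "q div \<Prod>S * \<Prod>S = q div \<Prod>S * \<Prod>T"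
      using \<open>q div \<Prod>S * \<Prod>S = q\<close> \<open>q div \<Prod>T * \<Prod>T = q\<close> eq by metis
    moreover have "q div \<Prod>S \<noteq> 0" using \<open>q div \<Prod>S * \<Prod>S = q\<close> q by (intro notI) simp
    ultimately show ?thesis by simp
  qed
  moreover have "A = {p \<in> prime_factors q. p dvd \<Prod>A}" if A: "A \<in> Pow (prime_factors q)" for A
  proof -
    have "finite A" using A finite_subset by blast
    hence "p dvd \<Prod>A \<longleftrightarrow> p \<in> A" if "p \<in> prime_factors q" for p
      using that A by (intro prime_dvd_prod_primes_iff) auto
    thus ?thesis using A by blast
  qed
  ultimately show "S = T" using ST by metis
qed

text \<open>The moduli \<open>q div \<Prod>S\<close> that divide \<open>m - n\<close> are distinct
  divisors of \<open>\<bar>m - n\<bar>\<close>, and the totients of all divisors of that number add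
  up to it.\<close>

lemma norm_sum_primitive_characters_le:
  assumes q: "q > 0" and mn: "coprime m (int q)" "coprime n (int q)" "m \<noteq> n"
  shows "norm (\<Sum>chi | primitive_character q chi. chi m * cnj (chi n)) \<le> \<bar>of_int (m - n)\<bar>"
proof -
  let ?P = "Pow (prime_factors q)" and ?g = "\<lambda>S. q div \<Prod>S"
  let ?Q = "{S \<in> ?P. [m = n] (mod int (?g S))}"
  define D where "D = {d. d dvd nat \<bar>m - n\<bar>}"
  have "norm (\<Sum>chi | primitive_character q chi. chi m * cnj (chi n)) \<le>
    (\<Sum>S\<in>?P. norm ((-1) ^ card S *
      (if [m = n] (mod int (?g S)) then of_nat (totient (?g S)) else 0 :: complex)))"
    unfolding sum_primitive_characters[OF q mn(1,2)] by (rule norm_sum)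
  also have "\<dots> = (\<Sum>S\<in>?Q. real (totient (?g S)))"
    by (rule sum.mono_neutral_cong_right) (auto simp: norm_mult norm_power)
  also have "\<dots> = (\<Sum>d\<in>?g ` ?Q. real (totient d))"
    by (subst sum.reindex) (auto intro: inj_on_subset[OF inj_on_div_prod_primes[OF q]])
  also have "\<dots> \<le> (\<Sum>d\<in>D. real (totient d))"
  proof (rule sum_mono2)
    have "nat \<bar>m - n\<bar> > 0" using mn(3) by simp
    thus "finite D" unfolding D_def by (rule finite_divisors_nat)
    show "?g ` ?Q \<subseteq> D"
      by (auto simp: D_def cong_iff_dvd_diff)
  qed auto
  also have "\<dots> = real (nat \<bar>m - n\<bar>)"
    unfolding D_def by (metis of_nat_sum totient_divisor_sum)
  finally show ?thesis by simp
qed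

lemma norm_sum_primitive_characters_le_phi_star:
  "norm (\<Sum>chi | primitive_character q chi. chi m * cnj (chi n)) \<le> real (phi_star q)"
proof -
  have "norm (\<Sum>chi | primitive_character q chi. chi m * cnj (chi n)) \<le>
        (\<Sum>chi | primitive_character q chi. 1)"
  proof (intro sum_norm_le)
    fix chi assume "chi \<in> {chi. primitive_character q chi}"
    hence "dirichlet_character q chi" by (simp add: primitive_character_def)
    thus "norm (chi m * cnj (chi n)) \<le> 1"
      by (simp add: norm_mult norm_dirichlet_character)
  qed
  thus ?thesis by (simp add: phi_star_def)
qed

lemma sum_primitive_characters_diagonal:
  assumes "coprime n (int q)"
  shows "(\<Sum>chi | primitive_character q chi. chi n * cnj (chi n)) = of_nat (phi_star q)"
proof -
  have "chi n * cnj (chi n) = 1" if "primitive_character q chi" for chi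
    using that dirichlet_character_cnj_mult_self[of q chi n] assms
    by (simp add: primitive_character_def mult.commute)
  thus ?thesis by (simp add: phi_star_def)
qed

lemma totient_prime_mult:
  assumes "prime p"
  shows "totient (p * m) = (if p dvd m then p else p - 1) * totient m"
proof (cases "p dvd m")
  case True
  hence "gcd p m = p" by (simp add: gcd_nat.absorb1)
  moreover have "totient p > 0" using assms prime_gt_0_nat by simp
  ultimately show ?thesis using True by (simp add: totient_mult mult_ac)
next
  case False
  hence "coprime p m" using assms prime_imp_coprime by blast
  thus ?thesis using False assms by (simp add: totient_mult_coprime totient_prime)
qed

text \<open>Removing a prime \<open>p\<close> from the modulus divides the totient by
  \<open>p\<close> if \<open>p\<close> divides what is left and by \<open>p - 1\<close> otherwise.
  As \<open>S\<close> contains each prime once, the first case occurs exactly when the square of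
  \<open>p\<close> divides \<open>q\<close>.\<close>

lemma totient_div_prod_primes:
  assumes q: "q > 0" and S: "S \<subseteq> prime_factors q"
  shows "real (totient (q div \<Prod>S)) =
    real (totient q) * (\<Prod>p\<in>S. if p\<^sup>2 dvd q then 1 / real p else 1 / (real p - 1))"
proof -
  have "finite S" using S finite_subset by blast
  thus ?thesis using S
  proof (induction S)
    case (insert p S)
    have p: "prime p" using insert.prems by auto
    have "p dvd \<Prod>S \<longleftrightarrow> p \<in> S"
      using insert p by (intro prime_dvd_prod_primes_iff) auto
    hence p: "prime p" "\<not> p dvd \<Prod>S" using p insert.hyps by auto
    have "\<Prod>(insert p S) dvd q" using insert.prems by (rule prod_prime_factors_subset_dvd)
    then obtain g where g: "q = g * (p * \<Prod>S)" using insert.hyps by (auto simp: dvd_def mult_ac)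
    have pos: "p > 0" "\<Prod>S > 0" using g q by (auto intro!: Nat.gr0I)
    have divs: "q div \<Prod>S = p * g" "q div (p * \<Prod>S) = g"
      using pos insert.hyps unfolding g by (auto simp: mult_ac)
    have "p\<^sup>2 dvd q \<longleftrightarrow> p dvd g * \<Prod>S"
      using pos unfolding g power2_eq_square by (simp add: mult.left_commute)
    also have "\<dots> \<longleftrightarrow> p dvd g" using p by (simp add: prime_dvd_mult_iff)
    finally have iff: "p\<^sup>2 dvd q \<longleftrightarrow> p dvd g" .
    have "p > 1" using p prime_gt_1_nat by blast
    hence "real (totient g) = real (totient (p * g)) * (if p\<^sup>2 dvd q then 1 / real p else 1 / (real p - 1))"
      by (auto simp: totient_prime_mult[OF p(1)] iff of_nat_diff)
    thus ?case using insert by (simp add: divs)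
  qed auto
qed

text \<open>Taking \<open>m = n = 1\<close> in \<open>sum_primitive_characters\<close> counts the
  characters. The quotient \<open>totient (q div \<Prod>S) / totient q\<close> is a product over
  \<open>S\<close>, so the alternating sum collapses to a product over the primes. It vanishes
  exactly when \<open>q\<close> is 2 modulo 4, through the factor \<open>p - 2\<close> at
  \<open>p = 2\<close>.\<close>

lemma phi_star_eq:
  assumes q: "q > 0"
  shows "real (phi_star q) = (\<Prod>p\<in>prime_factors q.
    if p\<^sup>2 dvd q then real p ^ (multiplicity p q - 2) * (real p - 1)\<^sup>2 else real p - 2)"
proof -
  let ?r = "\<lambda>p. if p\<^sup>2 dvd q then 1 / real p else 1 / (real p - 1)"
  have "complex_of_real (real (phi_star q)) = (\<Sum>chi | primitive_character q chi. chi 1 * cnj (chi 1))"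
    by (subst sum_primitive_characters_diagonal) auto
  also have "\<dots> = of_real (\<Sum>S\<in>Pow (prime_factors q). (-1) ^ card S * real (totient (q div \<Prod>S)))"
    by (subst sum_primitive_characters[OF q]) auto
  finally have "real (phi_star q) = (\<Sum>S\<in>Pow (prime_factors q). (-1) ^ card S * real (totient (q div \<Prod>S)))"
    by (simp only: of_real_eq_iff)
  also have "\<dots> = (\<Sum>S\<in>Pow (prime_factors q). real (totient q) * ((-1) ^ card S * (\<Prod>p\<in>S. ?r p)))"
    by (intro sum.cong refl) (simp add: totient_div_prod_primes[OF q])
  also have "\<dots> = real (totient q) * (\<Prod>p\<in>prime_factors q. 1 - ?r p)"
    by (simp add: prod_one_minus_eq_sum_Pow sum_distrib_left)
  also have "\<dots> = (\<Prod>p\<in>prime_factors q. real p ^ (multiplicity p q - 1) * (real p - 1) * (1 - ?r p))"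
  proof -
    have "real (p - 1) = real p - 1" if "p \<in> prime_factors q" for p
    proof -
      have "p \<ge> 1" using that prime_ge_1_nat by auto
      thus ?thesis by (simp add: of_nat_diff)
    qed
    thus ?thesis
      unfolding totient_formula1[OF q] by (simp add: prod.distrib)
  qed
  also have "\<dots> = (\<Prod>p\<in>prime_factors q.
    if p\<^sup>2 dvd q then real p ^ (multiplicity p q - 2) * (real p - 1)\<^sup>2 else real p - 2)"
  proof (intro prod.cong refl)
    fix p assume p: "p \<in> prime_factors q"
    hence pp: "prime p" "p dvd q" by auto
    hence p1: "real p > 1" using prime_gt_1_nat by auto
    have m: "p\<^sup>2 dvd q \<longleftrightarrow> multiplicity p q \<ge> 2"
      using q pp by (subst power_dvd_iff_le_multiplicity) (auto simp: prime_gt_0_nat)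
    show "real p ^ (multiplicity p q - 1) * (real p - 1) * (1 - ?r p) =
      (if p\<^sup>2 dvd q then real p ^ (multiplicity p q - 2) * (real p - 1)\<^sup>2 else real p - 2)"
    proof (cases "p\<^sup>2 dvd q")
      case True
      hence "multiplicity p q - 1 = Suc (multiplicity p q - 2)" using m by simp
      thus ?thesis using True p1 by (simp add: field_simps power2_eq_square)
    next
      case False
      have "multiplicity p q > 0" using pp q by (simp add: prime_multiplicity_gt_zero_iff)
      hence "multiplicity p q = 1" using False m by simp
      thus ?thesis using False p1 by (simp add: field_simps)
    qed
  qed
  finally show ?thesis .
qed

text \<open>Prime by prime, the square of the local factor of \<open>phi_star q\<close> is at least
  \<open>p ^ multiplicity p q\<close>, except that \<open>p = 2\<close> and \<open>p = 3\<close> may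
  each lose a factor 4; hence 16. Positivity rules out the zero factor at
  \<open>p = 2\<close>.\<close>

lemma phi_star_lower_bound:
  assumes pos: "phi_star q > 0" and q: "q > 0"
  shows "real q \<le> 16 * real (phi_star q) ^ 2"
proof -
  let ?P = "prime_factors q"
  let ?g = "\<lambda>p. if p\<^sup>2 dvd q then real p ^ (multiplicity p q - 2) * (real p - 1)\<^sup>2 else real p - 2"
  let ?c = "\<lambda>p. if p \<in> {2,3} then 1/4 else 1 :: real"
  have local: "real p ^ multiplicity p q * ?c p \<le> ?g p ^ 2" if p: "p \<in> ?P" for p
  proof -
    have pp: "prime p" "p dvd q" using p by auto
    hence p2: "p \<ge> 2" using prime_ge_2_nat by auto
    have m: "p\<^sup>2 dvd q \<longleftrightarrow> multiplicity p q \<ge> 2"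
      using q pp by (subst power_dvd_iff_le_multiplicity) (auto simp: prime_gt_0_nat)
    show ?thesis
    proof (cases "p\<^sup>2 dvd q")
      case True
      define a where "a = multiplicity p q - 2"
      have a: "multiplicity p q = a + 2" using True m by (simp add: a_def)
      have le: "real p ^ 2 * ?c p \<le> (real p - 1) ^ 4"
      proof (cases "p = 2")
        case False
        hence "p \<ge> 3" using p2 by simp
        hence "real p * (real p - 3) \<ge> 0" by simp
        hence "real p \<le> (real p - 1)\<^sup>2"
          by (simp add: power2_eq_square algebra_simps)
        hence "real p ^ 2 \<le> ((real p - 1)\<^sup>2) ^ 2" by (intro power_mono) auto
        moreover have "real p ^ 2 * ?c p \<le> real p ^ 2" by simp
        ultimately show ?thesis by (simp flip: power_mult)
      qed simp
      have "real p ^ multiplicity p q * ?c p = real p ^ a * (real p ^ 2 * ?c p)"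
        by (simp add: a power_add power2_eq_square)
      also have "\<dots> \<le> real p ^ (2 * a) * (real p - 1) ^ 4"
        using p2 le by (intro mult_mono power_increasing) auto
      also have "\<dots> = ?g p ^ 2"
        using True by (simp add: a power_mult_distrib mult.commute flip: power_mult)
      finally show ?thesis .
    next
      case False
      have "multiplicity p q > 0" using pp q by (simp add: prime_multiplicity_gt_zero_iff)
      hence mult: "multiplicity p q = 1" using False m by simp
      have "?g p \<noteq> 0"
      proof
        assume "?g p = 0"
        hence "real (phi_star q) = 0"
          unfolding phi_star_eq[OF q] using p by (intro prod_zero bexI[of _ p]) auto
        thus False using pos by simp
      qed
      hence "p \<noteq> 2" using False by auto
      have "p \<noteq> 4"
      proof
        assume "p = 4"
        hence "2 dvd p" by simp
        thus False using pp(1) \<open>p \<noteq> 2\<close> by (auto simp: prime_nat_iff)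
      qed
      show ?thesis
      proof (cases "p = 3")
        case False': False
        hence "p \<ge> 5" using \<open>p \<noteq> 2\<close> \<open>p \<noteq> 4\<close> p2 by linarith
        hence "(real p - 4) * (real p - 1) \<ge> 0" by (intro mult_nonneg_nonneg) auto
        thus ?thesis using False False' \<open>p \<noteq> 2\<close> mult by (simp add: power2_eq_square algebra_simps)
      qed (use False mult in simp)
    qed
  qed
  have "real q = (\<Prod>p\<in>?P. real p ^ multiplicity p q)"
    using prime_factorization_nat[OF q] by (metis (no_types, lifting) of_nat_power of_nat_prod prod.cong)
  moreover have "1 / 16 \<le> (\<Prod>p\<in>?P. ?c p)"
  proof -
    have "(\<Prod>p\<in>?P. ?c p) = (\<Prod>p\<in>?P \<inter> {2,3}. 1/4)"
      by (intro prod.mono_neutral_cong_right) auto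
    also have "\<dots> = (1/4) ^ card (?P \<inter> {2,3})" by simp
    also have "\<dots> \<ge> (1/4) ^ 2"
    proof (intro power_decreasing)
      have "card (?P \<inter> {2,3}) \<le> card {2,3::nat}" by (intro card_mono) auto
      thus "card (?P \<inter> {2,3}) \<le> 2" by simp
    qed auto
    finally show ?thesis by (simp add: power2_eq_square)
  qed
  ultimately have "real q * (1 / 16) \<le> (\<Prod>p\<in>?P. real p ^ multiplicity p q) * (\<Prod>p\<in>?P. ?c p)"
    using mult_left_mono[of "1 / 16" "\<Prod>p\<in>?P. ?c p" "real q"] by simp
  also have "\<dots> = (\<Prod>p\<in>?P. real p ^ multiplicity p q * ?c p)"
    by (rule prod.distrib [symmetric])
  also have "\<dots> \<le> (\<Prod>p\<in>?P. ?g p ^ 2)"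
    using local by (intro prod_mono) auto
  also have "\<dots> = real (phi_star q) ^ 2"
    unfolding phi_star_eq[OF q] by (rule prod_power_distrib [symmetric])
  finally show ?thesis by simp
qed


section \<open>Coefficients of the Euler factors\<close>

lemma d_primepow_0 [simp]: "d_primepow k 0 = 1"
  by (simp add: d_primepow_def)

lemma d_primepow_Suc: "d_primepow k (Suc m) = (k + real m) / real (Suc m) * d_primepow k m"
  by (simp add: d_primepow_def pochhammer_Suc field_simps)

lemma d_primepow_nonneg: "k \<ge> 0 \<Longrightarrow> d_primepow k m \<ge> 0"
  by (induction m) (auto simp: d_primepow_Suc)

text \<open>The coefficients of \<open>F z = (1 - z) powr (-k)\<close> satisfy
  \<open>F' = k * F / (1 - z)\<close>, and this is that identity coefficient by coefficient. It is
  the recurrence of \<open>trunc_coeff\<close> without the truncation, so the two can be compared by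
  induction.\<close>

lemma d_primepow_convolution:
  "d_primepow k (Suc m) = k / real (Suc m) * (\<Sum>i\<le>m. d_primepow k (m - i))"
proof -
  have "(\<Sum>i\<le>m. d_primepow k (m - i)) = (\<Sum>i\<le>m. d_primepow k i)"
    by (rule sum.reindex_bij_witness[where i = "\<lambda>i. m - i" and j = "\<lambda>i. m - i"]) auto
  moreover have "k * (\<Sum>i\<le>m. d_primepow k i) = (k + real m) * d_primepow k m"
  proof (induction m)
    case (Suc m)
    have "k * (\<Sum>i\<le>Suc m. d_primepow k i) = (k + real m) * d_primepow k m + k * d_primepow k (Suc m)"
      using Suc by (simp add: algebra_simps)
    also have "(k + real m) * d_primepow k m = real (Suc m) * d_primepow k (Suc m)"
      by (simp add: d_primepow_Suc)
    finally show ?case by (simp add: algebra_simps)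
  qed simp
  ultimately show ?thesis by (simp add: d_primepow_Suc)
qed

text \<open>Consecutive coefficients have a ratio tending to 1, whatever the power \<open>r\<close>;
  \<open>r = 1\<close> serves the expansion of \<open>P_X\<close> and \<open>r = 2\<close> the
  diagonal.\<close>

lemma summable_d_primepow:
  assumes k: "k \<ge> 0" and x: "0 \<le> x" "x < 1"
  shows "summable (\<lambda>m. d_primepow k m ^ r * x ^ m)"
proof -
  have "(\<lambda>m. ((k + real m) / real (Suc m)) ^ r * x) \<longlonglongrightarrow> 1 ^ r * x"
    by (intro tendsto_mult tendsto_power tendsto_const) real_asymp
  hence "eventually (\<lambda>m. ((k + real m) / real (Suc m)) ^ r * x < (1 + x) / 2) sequentially"
    using x by (intro order_tendstoD(2)[where y = "1 ^ r * x"]) auto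
  then obtain N where N: "\<And>m. m \<ge> N \<Longrightarrow> ((k + real m) / real (Suc m)) ^ r * x < (1 + x) / 2"
    by (auto simp: eventually_at_top_linorder)
  show ?thesis
  proof (rule summable_ratio_test)
    show "(1 + x) / 2 < 1" using x by simp
    fix m assume m: "m \<ge> N"
    have "d_primepow k (Suc m) ^ r * x ^ Suc m =
          (((k + real m) / real (Suc m)) ^ r * x) * (d_primepow k m ^ r * x ^ m)"
      by (simp only: d_primepow_Suc power_mult_distrib power_Suc mult_ac)
    moreover have "d_primepow k (Suc m) ^ r * x ^ Suc m \<ge> 0"
      using d_primepow_nonneg[OF k] x by simp
    ultimately have "norm (d_primepow k (Suc m) ^ r * x ^ Suc m) =
          (((k + real m) / real (Suc m)) ^ r * x) * (d_primepow k m ^ r * x ^ m)"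
      by simp
    also have "\<dots> \<le> (1 + x) / 2 * (d_primepow k m ^ r * x ^ m)"
      using N[OF m] k x d_primepow_nonneg[OF k, of m] by (intro mult_right_mono) auto
    finally show "norm (d_primepow k (Suc m) ^ r * x ^ Suc m) \<le> (1 + x) / 2 * norm (d_primepow k m ^ r * x ^ m)"
      using k x d_primepow_nonneg[OF k, of m] by simp
  qed
qed

text \<open>The coefficients of \<open>exp (k * (\<Sum>j=1..J. z ^ j / j))\<close>, defined by the recurrence that
  logarithmic differentiation yields.\<close>

fun trunc_coeff :: "real \<Rightarrow> nat \<Rightarrow> nat \<Rightarrow> real" where
  "trunc_coeff k J 0 = 1"
| "trunc_coeff k J (Suc m) = k / real (Suc m) * (\<Sum>i\<le>m. if i < J then trunc_coeff k J (m - i) else 0)"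

lemma trunc_coeff_nonneg: "k \<ge> 0 \<Longrightarrow> trunc_coeff k J m \<ge> 0"
proof (induction m rule: less_induct)
  case (less m)
  show ?case
  proof (cases m)
    case (Suc n)
    have "(\<Sum>i\<le>n. if i < J then trunc_coeff k J (n - i) else 0) \<ge> 0"
      using less Suc by (intro sum_nonneg) auto
    thus ?thesis using Suc less.prems by simp
  qed simp
qed

lemma trunc_coeff_le: "k \<ge> 0 \<Longrightarrow> trunc_coeff k J m \<le> d_primepow k m"
proof (induction m rule: less_induct)
  case (less m)
  show ?case
  proof (cases m)
    case (Suc n)
    have "(\<Sum>i\<le>n. if i < J then trunc_coeff k J (n - i) else 0) \<le> (\<Sum>i\<le>n. d_primepow k (n - i))"
      using less Suc d_primepow_nonneg by (intro sum_mono) auto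
    thus ?thesis using Suc less.prems by (auto simp: d_primepow_convolution intro!: mult_left_mono divide_right_mono)
  qed simp
qed

lemma trunc_coeff_eq: "m \<le> J \<Longrightarrow> trunc_coeff k J m = d_primepow k m"
proof (induction m rule: less_induct)
  case (less m)
  show ?case
  proof (cases m)
    case (Suc n)
    have "(\<Sum>i\<le>n. if i < J then trunc_coeff k J (n - i) else 0) = (\<Sum>i\<le>n. d_primepow k (n - i))"
      using less Suc by (intro sum.cong) auto
    thus ?thesis using Suc by (simp add: d_primepow_convolution)
  qed simp
qed

lemma summable_trunc_coeff:
  assumes k: "k \<ge> 0" and x: "0 \<le> x" "x < 1"
  shows "summable (\<lambda>m. trunc_coeff k J m * x ^ m)"
proof (rule summable_comparison_test')
  show "summable (\<lambda>m. d_primepow k m ^ 1 * x ^ m)" by (rule summable_d_primepow[OF assms])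
  show "norm (trunc_coeff k J m * x ^ m) \<le> d_primepow k m ^ 1 * x ^ m" for m
    using trunc_coeff_nonneg[OF k, of J m] trunc_coeff_le[OF k, of J m] x
    by (simp add: abs_mult mult_right_mono)
qed

text \<open>The recurrence says \<open>F' = k * S' * F\<close> for the power series \<open>F\<close>
  with these coefficients, where \<open>S\<close> is the truncated logarithm and
  \<open>S' z = 1 + z + ... + z ^ (J - 1)\<close>. Hence \<open>F * exp (- k * S)\<close> has
  derivative 0 on the unit disc and keeps its value 1 at the origin.\<close>

lemma trunc_coeff_sums_complex:
  fixes z :: complex
  assumes k: "k \<ge> 0" and z: "norm z < 1"
  shows "(\<lambda>m. of_real (trunc_coeff k J m) * z ^ m) sums exp (of_real k * (\<Sum>j=1..J. z ^ j / of_nat j))"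
proof -
  define F where "F = Abs_fps (\<lambda>m. complex_of_real (trunc_coeff k J m))"
  define G where "G = Abs_fps (\<lambda>i. if i < J then 1 else 0 :: complex)"
  define S where "S z = (\<Sum>j=1..J. z ^ j / of_nat j)" for z :: complex
  define S' where "S' z = (\<Sum>i<J. z ^ i)" for z :: complex
  have rF: "fps_conv_radius F \<ge> 1"
    unfolding fps_conv_radius_def
  proof (rule conv_radius_geI_ex')
    fix r :: real assume r: "0 < r" "ereal r < 1"
    have "summable (\<lambda>m. complex_of_real (trunc_coeff k J m * r ^ m))"
      using r k by (intro summable_of_real summable_trunc_coeff) auto
    thus "summable (\<lambda>m. fps_nth F m * of_real r ^ m)" by (simp add: F_def)
  qed
  have rG: "fps_conv_radius G = \<infinity>"
    unfolding fps_conv_radius_def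
    by (subst conv_radius_cong[of _ "\<lambda>_. 0"])
       (auto simp: G_def eventually_at_top_linorder intro!: exI[of _ J])
  have evG: "eval_fps G z = S' z" for z
  proof -
    have "(\<Sum>n. (if n < J then 1 else 0) * z ^ n) = (\<Sum>n<J. z ^ n)"
      by (subst suminf_finite[of "{..<J}"]) auto
    thus ?thesis by (simp add: eval_fps_def G_def S'_def)
  qed
  have dF: "fps_deriv F = fps_const (of_real k) * (G * F)"
  proof (rule fps_ext)
    fix n
    have "(\<Sum>i\<le>n. if i < J then complex_of_real (trunc_coeff k J (n - i)) else 0) = (\<Sum>i=0..n. (if i < J then 1 else 0) * complex_of_real (trunc_coeff k J (n - i)))"
      unfolding atLeast0AtMost by (intro sum.cong) auto
    hence "fps_nth (fps_deriv F) n = of_real k * fps_nth (G * F) n"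
      by (simp add: F_def G_def fps_mult_nth if_distrib[of of_real] del: of_nat_Suc cong: if_cong)
    thus "fps_nth (fps_deriv F) n = fps_nth (fps_const (of_real k) * (G * F)) n"
      by simp
  qed
  have ev_dF: "eval_fps (fps_deriv F) z = of_real k * S' z * eval_fps F z" if "norm z < 1" for z
  proof -
    have r: "ereal (norm z) < fps_conv_radius F" using that rF by (metis ereal_less(3) less_le_trans)
    have "ereal (norm z) < min (fps_conv_radius G) (fps_conv_radius F)" using r rG by simp
    hence "ereal (norm z) < fps_conv_radius (G * F)" using fps_conv_radius_mult less_le_trans by blast
    thus ?thesis unfolding dF using r rG by (simp add: eval_fps_mult evG)
  qed
  have dS: "(S has_field_derivative S' z) (at z within A)" for z A
  proof -
    have "(S has_field_derivative (\<Sum>j=1..J. of_nat j * z ^ (j - 1) / of_nat j)) (at z within A)"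
      unfolding S_def by (intro derivative_eq_intros) auto
    also have "(\<Sum>j=1..J. of_nat j * z ^ (j - 1) / of_nat j) = (\<Sum>j=1..J. z ^ (j - 1))"
      by (intro sum.cong) auto
    also have "\<dots> = S' z"
      unfolding S'_def by (rule sum.reindex_bij_witness[where i = Suc and j = "\<lambda>j. j - 1"]) auto
    finally show ?thesis .
  qed
  define h where "h z = eval_fps F z * exp (- (of_real k * S z))" for z
  have "\<exists>c. \<forall>z\<in>ball 0 1. h z = c"
  proof (rule has_field_derivative_zero_constant)
    fix z :: complex assume "z \<in> ball 0 1"
    hence z: "norm z < 1" by simp
    have r: "ereal (norm z) < fps_conv_radius F" using z rF by (metis ereal_less(3) less_le_trans)
    show "(h has_field_derivative 0) (at z within ball 0 1)"
      unfolding h_def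
      by (rule derivative_eq_intros has_field_derivative_eval_fps r dS refl)+
         (simp add: ev_dF[OF z] algebra_simps)
  qed auto
  then obtain c where c: "\<And>z. norm z < 1 \<Longrightarrow> h z = c" by auto
  have "S 0 = 0" unfolding S_def by (intro sum.neutral) auto
  hence "h 0 = 1" by (simp add: h_def eval_fps_at_0 F_def)
  hence "h z = 1" using c[of 0] c[OF z] by simp
  hence "eval_fps F z = exp (of_real k * S z)"
    by (simp add: h_def exp_minus field_simps)
  moreover have "ereal (norm z) < fps_conv_radius F" using z rF by (metis ereal_less(3) less_le_trans)
  from sums_eval_fps[OF this] have "(\<lambda>m. of_real (trunc_coeff k J m) * z ^ m) sums eval_fps F z"
    by (simp add: F_def)
  ultimately show ?thesis by (simp add: S_def)
qed

lemma trunc_coeff_sums_real: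
  fixes x :: real
  assumes "k \<ge> 0" "\<bar>x\<bar> < 1"
  shows "(\<lambda>m. trunc_coeff k J m * x ^ m) sums exp (k * (\<Sum>j=1..J. x ^ j / real j))"
proof -
  have "(\<lambda>m. complex_of_real (trunc_coeff k J m * x ^ m)) sums complex_of_real (exp (k * (\<Sum>j=1..J. x ^ j / real j)))"
    using trunc_coeff_sums_complex[of k "of_real x" J] assms by (simp add: exp_of_real [symmetric])
  thus ?thesis by (simp only: sums_of_real_iff)
qed

lemma has_sum_mult_Times:
  fixes f :: "'a \<Rightarrow> 'c :: {real_normed_field, banach}" and g :: "'b \<Rightarrow> 'c"
  assumes f: "(f has_sum S) A" "f abs_summable_on A" and g: "(g has_sum T) B" "g abs_summable_on B"
  shows "((\<lambda>(a, b). f a * g b) has_sum (S * T)) (A \<times> B)"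
    and "(\<lambda>(a, b). f a * g b) abs_summable_on (A \<times> B)"
proof -
  show abs: "(\<lambda>(a, b). f a * g b) abs_summable_on (A \<times> B)"
  proof (rule summable_on_SigmaI)
    show "((\<lambda>b. norm (case (a, b) of (a, b) \<Rightarrow> f a * g b)) has_sum
            (norm (f a) * (\<Sum>\<^sub>\<infinity>b\<in>B. norm (g b)))) B" for a
      using has_sum_cmult_right[OF has_sum_infsum[OF g(2)], of "norm (f a)"] by (simp add: norm_mult)
    show "(\<lambda>a. norm (f a) * (\<Sum>\<^sub>\<infinity>b\<in>B. norm (g b))) summable_on A"
      by (rule summable_on_cmult_left[OF f(2)])
  qed simp
  show "((\<lambda>(a, b). f a * g b) has_sum (S * T)) (A \<times> B)"
  proof (rule has_sum_SigmaI)
    show "((\<lambda>b. case (a, b) of (a, b) \<Rightarrow> f a * g b) has_sum f a * T) B" for a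
      using has_sum_cmult_right[OF g(1)] by simp
    show "((\<lambda>a. f a * T) has_sum S * T) A" by (rule has_sum_cmult_left[OF f(1)])
    show "(\<lambda>(a, b). f a * g b) summable_on A \<times> B" using abs abs_summable_summable by blast
  qed
qed


section \<open>Mertens' third theorem\<close>

lemma card_multiples_le:
  assumes "d \<ge> 1"
  shows "card {n \<in> {1..N}. d dvd n} = N div d"
proof -
  have "{n \<in> {1..N}. d dvd n} = (\<lambda>k. d * k) ` {1..N div d}"
  proof (intro equalityI subsetI)
    fix n assume "n \<in> {n \<in> {1..N}. d dvd n}"
    then obtain k where k: "n = d * k" "n \<ge> 1" "n \<le> N" by (auto elim!: dvdE)
    hence "k \<le> N div d" using assms by (simp add: less_eq_div_iff_mult_less_eq mult.commute)
    thus "n \<in> (\<lambda>k. d * k) ` {1..N div d}" using k by (auto intro!: image_eqI[of _ _ k] Nat.gr0I simp: Suc_le_eq)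
  next
    fix n assume "n \<in> (\<lambda>k. d * k) ` {1..N div d}"
    then obtain k where "k \<in> {1..N div d}" "n = d * k" by blast
    thus "n \<in> {n \<in> {1..N}. d dvd n}"
      using assms by (auto simp: less_eq_div_iff_mult_less_eq mult.commute Suc_le_eq)
  qed
  thus ?thesis using assms by (simp add: card_image inj_on_def)
qed

lemma sum_ln_eq_sum_mangoldt:
  "(\<Sum>n=1..N. ln (real n)) = (\<Sum>d=1..N. mangoldt d * real (N div d))"
proof -
  have "(\<Sum>n=1..N. ln (real n)) = (\<Sum>n=1..N. \<Sum>d | d dvd n. mangoldt d)"
  proof (intro sum.cong refl)
    fix n assume "n \<in> {1..N}"
    thus "ln (real n) = (\<Sum>d | d dvd n. mangoldt d)"
      using mangoldt_sum[of n, where ?'a = real] by simp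
  qed
  also have "\<dots> = (\<Sum>n=1..N. \<Sum>d\<in>{1..N}. if d dvd n then mangoldt d else 0)"
  proof (rule sum.cong, rule refl)
    fix n assume n: "n \<in> {1..N}"
    have "d \<le> N" if "d dvd n" for d using that n dvd_imp_le[of d n] by auto
    hence eq: "{d. d dvd n} = {d \<in> {1..N}. d dvd n}"
      using n by (auto simp: Suc_le_eq intro!: Nat.gr0I)
    show "(\<Sum>d | d dvd n. mangoldt d) = (\<Sum>d\<in>{1..N}. if d dvd n then mangoldt d else 0 :: real)"
      unfolding eq by (rule sum.inter_filter) simp
  qed
  also have "\<dots> = (\<Sum>d\<in>{1..N}. \<Sum>n=1..N. if d dvd n then mangoldt d else 0)"
    by (rule sum.swap)
  also have "\<dots> = (\<Sum>d=1..N. mangoldt d * real (N div d))"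
  proof (intro sum.cong refl)
    fix d assume d: "d \<in> {1..N}"
    have "(\<Sum>n=1..N. if d dvd n then mangoldt d else 0) = (\<Sum>n\<in>{n \<in> {1..N}. d dvd n}. mangoldt d :: real)"
      by (rule sum.inter_filter [symmetric]) simp
    also have "\<dots> = real (card {n \<in> {1..N}. d dvd n}) * mangoldt d" by simp
    also have "card {n \<in> {1..N}. d dvd n} = N div d" using d by (intro card_multiples_le) simp
    finally show "(\<Sum>n=1..N. if d dvd n then mangoldt d else 0) = mangoldt d * real (N div d)"
      by simp
  qed
  finally show ?thesis .
qed

lemma sum_ln_upper: "(\<Sum>n=1..N. ln (real n)) \<le> real N * ln (real N)"
proof -
  have "(\<Sum>n=1..N. ln (real n)) \<le> (\<Sum>n=1..N. ln (real N))"
    by (intro sum_mono) auto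
  thus ?thesis by simp
qed

lemma sum_ln_lower: "(\<Sum>n=1..N. ln (real n)) \<ge> real N * ln (real N) - real N"
proof (induction N)
  case (Suc N)
  show ?case
  proof (cases "N = 0")
    case False
    have "ln (1 + 1 / real N) \<le> 1 / real N" using False by (intro ln_add_one_self_le_self) auto
    moreover have "1 + 1 / real N = real (Suc N) / real N" using False by (simp add: field_simps)
    ultimately have "ln (real (Suc N)) - ln (real N) \<le> 1 / real N"
      using False by (simp add: ln_div)
    hence "real N * (ln (real (Suc N)) - ln (real N)) \<le> real N * (1 / real N)"
      by (intro mult_left_mono) auto
    hence "real N * (ln (real (Suc N)) - ln (real N)) \<le> 1" using False by simp
    thus ?thesis using Suc by (simp add: algebra_simps)
  qed simp
qed simp

definition chebyshev_psi :: "nat \<Rightarrow> real" where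
  "chebyshev_psi N = (\<Sum>d=1..N. mangoldt d)"

lemma chebyshev_psi_mono: "M \<le> N \<Longrightarrow> chebyshev_psi M \<le> chebyshev_psi N"
  unfolding chebyshev_psi_def by (intro sum_mono2) (auto simp: mangoldt_nonneg)

text \<open>\<open>T (2 * N) - 2 * T N\<close> is the logarithm of a central binomial coefficient,
  at most \<open>2 * N * ln 2\<close>. In its expansion the weights of \<open>mangoldt d\<close> are
  nonnegative, and at least 1 for \<open>N < d \<le> 2 * N\<close>.\<close>

lemma chebyshev_psi_double: "chebyshev_psi (2 * N) \<le> chebyshev_psi N + 2 * real N * ln 2"
proof -
  define T where "T N = (\<Sum>n=1..N. ln (real n))" for N
  have T_fact: "T n = ln (fact n)" for n
    unfolding T_def
  proof (induction n)
    case (Suc n)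
    have "ln (fact (Suc n) :: real) = ln (real (Suc n) * fact n)" by simp
    also have "\<dots> = ln (real (Suc n)) + ln (fact n)" by (rule ln_mult_pos) auto
    finally show ?case using Suc by simp
  qed simp
  have "real (fact N * fact (2 * N - N) * (2 * N choose N)) = real (fact (2 * N))"
    by (subst binomial_fact_lemma) auto
  hence "fact (2 * N) = (fact N * fact N * real (2 * N choose N))"
    by simp
  moreover have "real (2 * N choose N) > 0" by simp
  ultimately have "T (2 * N) = 2 * T N + ln (real (2 * N choose N))"
    unfolding T_fact by (simp add: ln_mult)
  moreover have "ln (real (2 * N choose N)) \<le> ln (2 ^ (2 * N))"
  proof (subst ln_le_cancel_iff)
    show "real (2 * N choose N) \<le> 2 ^ (2 * N)"
      using binomial_le_pow2[of "2 * N" N] by (metis of_nat_le_iff of_nat_numeral of_nat_power)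
  qed auto
  ultimately have le: "T (2 * N) - 2 * T N \<le> 2 * real N * ln 2"
    by (simp add: ln_realpow)
  have "T N = (\<Sum>d=1..2*N. mangoldt d * real (N div d))"
    unfolding T_def sum_ln_eq_sum_mangoldt by (rule sum.mono_neutral_left) auto
  hence eq: "T (2 * N) - 2 * T N = (\<Sum>d=1..2*N. mangoldt d * (real (2 * N div d) - 2 * real (N div d)))"
    unfolding T_def[of "2 * N"] sum_ln_eq_sum_mangoldt
    by (simp add: sum_distrib_left sum_subtractf algebra_simps)
  have "chebyshev_psi (2 * N) - chebyshev_psi N = (\<Sum>d=1..2*N. mangoldt d * (if d > N then 1 else 0))"
  proof -
    have "chebyshev_psi N = (\<Sum>d=1..2*N. mangoldt d * (if d > N then 0 else 1))"
      unfolding chebyshev_psi_def by (rule sum.mono_neutral_cong_left) auto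
    thus ?thesis
      unfolding chebyshev_psi_def[of "2 * N"] by (simp add: sum_subtractf [symmetric] if_distrib cong: if_cong)
  qed
  also have "\<dots> \<le> (\<Sum>d=1..2*N. mangoldt d * (real (2 * N div d) - 2 * real (N div d)))"
  proof (intro sum_mono mult_left_mono mangoldt_nonneg)
    fix d assume d: "d \<in> {1..2*N}"
    have "N div d + N div d \<le> (N + N) div d" using div_add1_eq[of N N d] by linarith
    hence "2 * (N div d) \<le> 2 * N div d" by (simp add: mult_2)
    hence "2 * real (N div d) \<le> real (2 * N div d)" by linarith
    moreover have "2 * N div d \<ge> 1" "N div d = 0" if "d > N"
      using that d by (auto simp: Suc_le_eq div_greater_zero_iff)
    ultimately show "(if N < d then 1 else 0) \<le> real (2 * N div d) - 2 * real (N div d)"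
      by auto
  qed
  also have "\<dots> \<le> 2 * real N * ln 2" using le eq by simp
  finally show ?thesis by simp
qed

text \<open>Doubling and \<open>ln 2 < 1\<close> give the bound \<open>2 * 2 ^ j\<close> at
  \<open>2 ^ j\<close>; the least power of 2 that is not below \<open>N\<close> is at most
  \<open>2 * N\<close>.\<close>

lemma chebyshev_psi_bound: "chebyshev_psi N \<le> 4 * real N"
proof (cases "N = 0")
  case True
  thus ?thesis by (simp add: chebyshev_psi_def)
next
  case False
  have pow: "chebyshev_psi (2 ^ j) \<le> 2 * 2 ^ j" for j
  proof (induction j)
    case 0
    show ?case by (simp add: chebyshev_psi_def)
  next
    case (Suc j)
    have "chebyshev_psi (2 * 2 ^ j) \<le> chebyshev_psi (2 ^ j) + 2 * real (2 ^ j) * ln 2"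
      by (rule chebyshev_psi_double)
    also have "\<dots> \<le> 2 * 2 ^ j + 2 * 2 ^ j * 1"
      using Suc ln_2_less_1 by (intro add_mono mult_mono) auto
    finally show ?case by simp
  qed
  define j where "j = (LEAST j. N \<le> 2 ^ j)"
  have ex: "N \<le> 2 ^ N" using less_exp[of N] by simp
  have j: "N \<le> 2 ^ j" unfolding j_def using ex by (rule LeastI)
  have "2 ^ j \<le> 2 * N"
  proof (cases j)
    case (Suc i)
    hence "\<not> N \<le> 2 ^ i" using not_less_Least[of i "\<lambda>j. N \<le> 2 ^ j"] unfolding j_def by auto
    thus ?thesis using Suc by simp
  qed (use False in simp)
  hence "2 ^ j \<le> real (2 * N)" by (metis of_nat_le_iff of_nat_numeral of_nat_power)
  thus ?thesis using chebyshev_psi_mono[OF j] pow[of j] by simp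
qed

text \<open>Replacing \<open>N div d\<close> by \<open>N / d\<close> in the expansion of the sum of
  logarithms costs at most \<open>chebyshev_psi N \<le> 4 * N\<close>, and that sum is within
  \<open>N\<close> of \<open>N * ln N\<close>; then divide by \<open>N\<close>.\<close>

lemma mertens_first:
  assumes "N \<ge> 1"
  shows "\<bar>(\<Sum>d=1..N. mangoldt d / real d) - ln (real N)\<bar> \<le> 4"
proof -
  define E where "E = (\<Sum>d=1..N. mangoldt d / real d :: real)"
  define T where "T = (\<Sum>n=1..N. ln (real n))"
  have N: "real N > 0" using assms by simp
  have "real N * E - T = (\<Sum>d=1..N. mangoldt d * (real N / real d - real (N div d)))"
    unfolding E_def T_def sum_ln_eq_sum_mangoldt
    by (simp add: sum_distrib_left sum_subtractf algebra_simps)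
  moreover have "0 \<le> real N / real d - real (N div d)" "real N / real d - real (N div d) \<le> 1"
    if "d \<in> {1..N}" for d
  proof -
    have "real (N div d) = of_int \<lfloor>real N / real d\<rfloor>"
      by (simp add: floor_divide_of_nat_eq)
    thus "0 \<le> real N / real d - real (N div d)" "real N / real d - real (N div d) \<le> 1"
      by linarith+
  qed
  ultimately have "0 \<le> real N * E - T" "real N * E - T \<le> (\<Sum>d=1..N. mangoldt d * 1)"
    by (auto intro!: sum_nonneg sum_mono mult_left_mono mult_nonneg_nonneg simp: mangoldt_nonneg
          simp del: mult_1_right)
  hence "0 \<le> real N * E - T" "real N * E - T \<le> 4 * real N"
    using chebyshev_psi_bound[of N] by (auto simp: chebyshev_psi_def)
  moreover have "T \<le> real N * ln (real N)" "T \<ge> real N * ln (real N) - real N"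
    unfolding T_def using sum_ln_upper sum_ln_lower by auto
  ultimately have "real N * (E - ln (real N)) \<le> real N * 4" "real N * (E - ln (real N)) \<ge> real N * (-4)"
    by (simp_all add: algebra_simps) 
  hence "E - ln (real N) \<le> 4" "E - ln (real N) \<ge> -4"
    using N by (simp_all only: mult_le_cancel_left_pos)
  thus ?thesis unfolding E_def by linarith
qed

section \<open>Abel means and exponential blocks\<close>

text \<open>The weights \<open>(1 - z) * z ^ m\<close> have total mass 1, and as \<open>z\<close>
  tends to 1 the mass leaves every finite set of indices.\<close>

lemma abel_mean_tendsto:
  fixes D :: "nat \<Rightarrow> real"
  assumes D: "D \<longlonglongrightarrow> l"
  shows "((\<lambda>z. (1 - z) * (\<Sum>m. D m * z ^ m)) \<longlongrightarrow> l) (at_left 1)"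
proof (rule tendstoI)
  fix \<epsilon> :: real assume \<epsilon>: "\<epsilon> > 0"
  have "(\<lambda>m. D m - l) \<longlonglongrightarrow> 0" using D by (simp add: LIM_zero_iff)
  hence "Bseq (\<lambda>m. D m - l)" by (intro convergent_imp_Bseq) (auto simp: convergent_def)
  then obtain B where B: "B > 0" "\<And>m. norm (D m - l) \<le> B" unfolding Bseq_def by blast
  obtain N where N: "\<And>m. m \<ge> N \<Longrightarrow> \<bar>D m - l\<bar> < \<epsilon> / 2"
    using D \<epsilon> unfolding LIMSEQ_iff by (metis half_gt_zero real_norm_def)
  have bound: "\<bar>(1 - z) * (\<Sum>m. D m * z ^ m) - l\<bar> \<le> \<epsilon> / 2 + (1 - z) * (real N * B)"
    if z: "0 < z" "z < 1" for z
  proof -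
    have g: "summable (\<lambda>m. z ^ m)" "(\<Sum>m. z ^ m) = 1 / (1 - z)"
      using z by (auto intro: summable_geometric suminf_geometric)
    \<comment> \<open>From \<open>N\<close> on the deviation is below \<open>\<epsilon> / 2\<close>;
      the first \<open>N\<close> terms cost at most \<open>B\<close> each, a total that the factor
      \<open>1 - z\<close> makes negligible.\<close>
    let ?h = "\<lambda>m. \<epsilon> / 2 * z ^ m + (if m < N then B else 0)"
    have le: "norm ((D m - l) * z ^ m) \<le> ?h m" for m
    proof (cases "m < N")
      case True
      have "\<bar>D m - l\<bar> * z ^ m \<le> B * 1"
        using B(2)[of m] z B(1) by (intro mult_mono) (auto simp: power_le_one)
      thus ?thesis using True \<epsilon> z by (auto simp: abs_mult intro: order_trans)
    next
      case False
      thus ?thesis using N[of m] z by (auto simp: abs_mult intro!: mult_right_mono less_imp_le)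
    qed
    have fin: "(\<lambda>m. if m < N then B else 0) sums (real N * B)"
      using sums_finite[of "{..<N}" "\<lambda>m. if m < N then B else 0"] by simp
    have smh: "summable ?h"
      using g fin by (intro summable_add summable_mult) (auto simp: sums_iff)
    have sm: "summable (\<lambda>m. (D m - l) * z ^ m)"
      using smh le by (rule summable_comparison_test'[where N = 0])
    have "(\<lambda>m. D m * z ^ m) = (\<lambda>m. (D m - l) * z ^ m + l * z ^ m)" by (auto simp: algebra_simps)
    hence "(\<Sum>m. D m * z ^ m) = (\<Sum>m. (D m - l) * z ^ m) + l * (1 / (1 - z))"
      using sm g by (simp add: suminf_add [symmetric] suminf_mult summable_mult)
    hence "(1 - z) * (\<Sum>m. D m * z ^ m) - l = (1 - z) * (\<Sum>m. (D m - l) * z ^ m)"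
      using z by (simp add: field_simps)
    moreover have "\<bar>\<Sum>m. (D m - l) * z ^ m\<bar> \<le> (\<Sum>m. ?h m)"
    proof -
      have "norm (\<Sum>m. (D m - l) * z ^ m) \<le> (\<Sum>m. norm ((D m - l) * z ^ m))"
        using summable_comparison_test'[OF smh, of 0 "\<lambda>m. norm ((D m - l) * z ^ m)"] le
        by (intro summable_norm) auto
      also have "\<dots> \<le> (\<Sum>m. ?h m)"
        using summable_comparison_test'[OF smh, of 0 "\<lambda>m. norm ((D m - l) * z ^ m)"] le
        by (intro suminf_le smh) auto
      finally show ?thesis by simp
    qed
    moreover have "(\<Sum>m. ?h m) = \<epsilon> / 2 * (1 / (1 - z)) + real N * B"
    proof -
      have "(\<lambda>m. z ^ m) sums (1 / (1 - z))" using z by (intro geometric_sums) auto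
      from sums_add[OF sums_mult[OF this, of "\<epsilon> / 2"] fin] show ?thesis
        by (rule sums_unique [symmetric])
    qed
    ultimately have "\<bar>(1 - z) * (\<Sum>m. D m * z ^ m) - l\<bar> \<le> (1 - z) * (\<epsilon> / 2 * (1 / (1 - z)) + real N * B)"
      using z by (simp add: abs_mult mult_left_mono)
    also have "\<dots> = \<epsilon> / 2 + (1 - z) * (real N * B)" using z by (simp add: field_simps)
    finally show ?thesis .
  qed
  have "((\<lambda>z. \<epsilon> / 2 + (1 - z) * (real N * B)) \<longlongrightarrow> \<epsilon> / 2 + (1 - 1) * (real N * B)) (at_left 1)"
    by (intro tendsto_intros)
  from order_tendstoD(2)[OF this, of \<epsilon>]
  have "eventually (\<lambda>z. \<epsilon> / 2 + (1 - z) * (real N * B) < \<epsilon>) (at_left 1)"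
    using \<epsilon> by simp
  moreover have "eventually (\<lambda>z. z \<in> {0<..<1::real}) (at_left 1)"
    by (intro eventually_at_left_real) auto
  ultimately show "eventually (\<lambda>z. dist ((1 - z) * (\<Sum>m. D m * z ^ m)) l < \<epsilon>) (at_left 1)"
    by eventually_elim (use bound in \<open>force simp: dist_real_def\<close>)
qed

text \<open>Ends of the blocks on which \<open>ln n\<close> lies in \<open>(m, m + 1]\<close>. On a
  block \<open>1 / ln n\<close> is close to \<open>1 / m\<close>, and
  \<open>n powr (-\<sigma>)\<close> is close to a power of \<open>exp (-\<sigma>)\<close>.\<close>

definition exp_floor :: "nat \<Rightarrow> nat" where
  "exp_floor m = nat \<lfloor>exp (real m)\<rfloor>"

lemma le_exp_floor_iff: "n \<ge> 1 \<Longrightarrow> n \<le> exp_floor m \<longleftrightarrow> ln (real n) \<le> real m"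
proof -
  assume n: "n \<ge> 1"
  have "n \<le> exp_floor m \<longleftrightarrow> int n \<le> \<lfloor>exp (real m)\<rfloor>"
    unfolding exp_floor_def by (subst le_nat_iff) auto
  also have "\<dots> \<longleftrightarrow> real n \<le> exp (real m)" by (simp add: le_floor_iff)
  also have "\<dots> \<longleftrightarrow> ln (real n) \<le> real m" using n ln_le_cancel_iff[of "real n" "exp (real m)"] by simp
  finally show ?thesis .
qed

lemma exp_floor_0: "exp_floor 0 = 1"
  by (simp add: exp_floor_def)

lemma exp_floor_ge_1: "exp_floor m \<ge> 1"
  using le_exp_floor_iff[of 1 m] by simp

lemma exp_floor_mono: "m \<le> n \<Longrightarrow> exp_floor m \<le> exp_floor n"
  unfolding exp_floor_def by (intro nat_mono floor_mono) simp

lemma ln_exp_floor: "\<bar>ln (real (exp_floor m)) - real m\<bar> \<le> 1"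
proof -
  have e: "exp_floor m \<ge> 1" by (rule exp_floor_ge_1)
  have "ln (real (exp_floor m)) \<le> real m" using le_exp_floor_iff[OF e, of m] by simp
  moreover have "real m < ln (real (Suc (exp_floor m)))"
    using le_exp_floor_iff[of "Suc (exp_floor m)" m] by simp
  moreover have "ln (real (Suc (exp_floor m))) \<le> ln (2 * real (exp_floor m))"
    using e by (subst ln_le_cancel_iff) auto
  moreover have "\<dots> = ln 2 + ln (real (exp_floor m))" using e by (simp add: ln_mult)
  ultimately show ?thesis using ln_2_less_1 by linarith
qed

definition mertens_sum :: "nat \<Rightarrow> real" where
  "mertens_sum N = (\<Sum>n\<in>{2..N}. mangoldt n / ln (real n) * (1 / real n))"

lemma mertens_sum_mono: "M \<le> N \<Longrightarrow> mertens_sum M \<le> mertens_sum N"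
  unfolding mertens_sum_def by (intro sum_mono2) (auto simp: mangoldt_nonneg)

lemma sum_split_exp_floor:
  fixes f :: "nat \<Rightarrow> real"
  shows "(\<Sum>n\<in>{2..exp_floor M}. f n) = (\<Sum>m<M. \<Sum>n\<in>{exp_floor m<..exp_floor (Suc m)}. f n)"
proof (induction M)
  case 0
  show ?case by (simp add: exp_floor_0)
next
  case (Suc M)
  have "{2..exp_floor (Suc M)} = {2..exp_floor M} \<union> {exp_floor M<..exp_floor (Suc M)}"
    using exp_floor_mono[of M "Suc M"] exp_floor_ge_1[of M] by auto
  thus ?case using Suc by (simp add: sum.union_disjoint ivl_disj_int)
qed

lemma block_bounds:
  assumes "n \<in> {exp_floor m<..exp_floor (Suc m)}"
  shows "n \<ge> 2" "ln (real n) > real m" "ln (real n) \<le> real (Suc m)"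
proof -
  show n: "n \<ge> 2" using assms exp_floor_ge_1[of m] by auto
  show "ln (real n) > real m" "ln (real n) \<le> real (Suc m)"
    using assms n le_exp_floor_iff[of n m] le_exp_floor_iff[of n "Suc m"] by auto
qed

text \<open>Discrete partial summation. The error \<open>R m\<close> of Mertens' first theorem at
  the block ends is only bounded, but in \<open>G m = D m - R m / (m + 1)\<close> its increments
  cancel, and consecutive differences of \<open>G\<close> are of order \<open>1 / m^2\<close>. So
  \<open>G\<close> converges, and \<open>R m / (m + 1)\<close> tends to 0.\<close>

lemma mertens_block_difference_convergent:
  "convergent (\<lambda>m. mertens_sum (exp_floor m) - harm m)"
proof -
  define D where "D m = mertens_sum (exp_floor m) - harm m" for m
  define E where "E m = (\<Sum>d=1..exp_floor m. mangoldt d / real d :: real)" for m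
  define R where "R m = E m - real m" for m
  define G where "G m = D m - R m / real (Suc m)" for m
  have R: "\<bar>R m\<bar> \<le> 5" for m
    using mertens_first[OF exp_floor_ge_1, of m] ln_exp_floor[of m] unfolding R_def E_def by linarith
  have E_Suc: "E (Suc m) - E m = (\<Sum>n\<in>{exp_floor m<..exp_floor (Suc m)}. mangoldt n / real n)" for m
  proof -
    have "{1..exp_floor (Suc m)} = {1..exp_floor m} \<union> {exp_floor m<..exp_floor (Suc m)}"
      using exp_floor_mono[of m "Suc m"] exp_floor_ge_1[of m] by auto
    thus ?thesis unfolding E_def by (simp add: sum.union_disjoint ivl_disj_int)
  qed
  have S_Suc: "mertens_sum (exp_floor (Suc m)) - mertens_sum (exp_floor m) =
      (\<Sum>n\<in>{exp_floor m<..exp_floor (Suc m)}. mangoldt n / ln (real n) * (1 / real n))" for m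
    unfolding mertens_sum_def sum_split_exp_floor by simp
  \<comment> \<open>\<open>16 = 11 + 5\<close>: the sum \<open>e\<close> of
    \<open>mangoldt n / n\<close> over a block is at most \<open>1 + 5 + 5\<close>, so replacing
    \<open>ln n\<close> by \<open>m + 1\<close> costs at most \<open>11 / (m * (m + 1))\<close>; the
    5 bounds what is left of \<open>R (Suc m)\<close>.\<close>
  have G_Suc: "\<bar>G (Suc m) - G m\<bar> \<le> 16 * inverse (real m ^ 2)" if m: "m \<ge> 1" for m
  proof -
    define s where "s = (\<Sum>n\<in>{exp_floor m<..exp_floor (Suc m)}. mangoldt n / ln (real n) * (1 / real n))"
    define e where "e = E (Suc m) - E m"
    have e: "e = 1 + R (Suc m) - R m" by (simp add: e_def R_def)
    have e11: "e \<le> 11" using R[of m] R[of "Suc m"] e by linarith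
    have e0: "e \<ge> 0" unfolding e_def E_Suc by (intro sum_nonneg) (auto simp: mangoldt_nonneg)
    have lo: "e / real (Suc m) \<le> s"
      unfolding s_def e_def E_Suc sum_divide_distrib
    proof (intro sum_mono)
      fix n assume n: "n \<in> {exp_floor m<..exp_floor (Suc m)}"
      note b = block_bounds[OF n]
      have "ln (real n) > 0" using b by simp
      hence "mangoldt n / real n / real (Suc m) \<le> mangoldt n / real n / ln (real n)"
        using b by (intro divide_left_mono) (auto simp: mangoldt_nonneg)
      thus "mangoldt n / real n / real (Suc m) \<le> mangoldt n / ln (real n) * (1 / real n)"
        by (simp add: field_simps)
    qed
    have hi: "s \<le> e / real m"
      unfolding s_def e_def E_Suc sum_divide_distrib
    proof (intro sum_mono)
      fix n assume n: "n \<in> {exp_floor m<..exp_floor (Suc m)}"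
      note b = block_bounds[OF n]
      have "mangoldt n / real n / ln (real n) \<le> mangoldt n / real n / real m"
        using b m by (intro divide_left_mono) (auto simp: mangoldt_nonneg)
      thus "mangoldt n / ln (real n) * (1 / real n) \<le> mangoldt n / real n / real m"
        by (simp add: field_simps)
    qed
    define r where "r = s - e / real (Suc m)"
    have r: "0 \<le> r" "r \<le> 11 * (1 / (real m * real (Suc m)))"
    proof -
      show "0 \<le> r" using lo by (simp add: r_def)
      have "r \<le> e / real m - e / real (Suc m)" using hi by (simp add: r_def)
      also have "\<dots> = e * (1 / (real m * real (Suc m)))" using m by (simp add: field_simps)
      also have "\<dots> \<le> 11 * (1 / (real m * real (Suc m)))" using e11 by (intro mult_right_mono) auto
      finally show "r \<le> 11 * (1 / (real m * real (Suc m)))" .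
    qed
    have "G (Suc m) - G m = s - 1 / real (Suc m) - R (Suc m) / real (Suc (Suc m)) + R m / real (Suc m)"
      unfolding G_def D_def s_def S_Suc [symmetric] by (simp add: harm_Suc inverse_eq_divide)
    also have "s = r + (1 + R (Suc m) - R m) / real (Suc m)" by (simp add: r_def e)
    also have "\<dots> - 1 / real (Suc m) - R (Suc m) / real (Suc (Suc m)) + R m / real (Suc m) =
      r + R (Suc m) * (1 / real (Suc m) - 1 / real (Suc (Suc m)))"
      by (simp add: algebra_simps add_divide_distrib diff_divide_distrib)
    also have "1 / real (Suc m) - 1 / real (Suc (Suc m)) = 1 / (real (Suc m) * real (Suc (Suc m)))"
      by (simp add: field_simps)
    finally have "\<bar>G (Suc m) - G m\<bar> \<le> \<bar>r\<bar> + \<bar>R (Suc m)\<bar> * (1 / (real (Suc m) * real (Suc (Suc m))))"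
      by (metis abs_triangle_ineq abs_mult abs_of_nonneg of_nat_0_le_iff mult_nonneg_nonneg zero_le_divide_1_iff)
    also have "\<dots> \<le> 11 * (1 / (real m * real (Suc m))) + 5 * (1 / (real (Suc m) * real (Suc (Suc m))))"
      using r R[of "Suc m"] by (intro add_mono mult_right_mono) auto
    also have "\<dots> \<le> 11 * (1 / (real m * real m)) + 5 * (1 / (real m * real m))"
      using m by (intro add_mono mult_left_mono divide_left_mono mult_mono) auto
    also have "\<dots> = 16 * inverse (real m ^ 2)" by (simp add: power2_eq_square inverse_eq_divide)
    finally show ?thesis .
  qed
  have "summable (\<lambda>m. G (Suc m) - G m)"
  proof (rule summable_comparison_test')
    show "summable (\<lambda>m. 16 * inverse (real m ^ 2))"
      by (intro summable_mult inverse_power_summable) simp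
    show "norm (G (Suc m) - G m) \<le> 16 * inverse (real m ^ 2)" if "m \<ge> 1" for m
      using G_Suc[OF that] by simp
  qed
  hence "convergent (\<lambda>n. \<Sum>m<n. G (Suc m) - G m)" by (simp add: summable_iff_convergent)
  hence "convergent (\<lambda>n. G n - G 0)" by (simp add: sum_lessThan_telescope)
  then obtain L where "(\<lambda>n. G n - G 0) \<longlonglongrightarrow> L" by (auto simp: convergent_def)
  hence "(\<lambda>n. (G n - G 0) + G 0) \<longlonglongrightarrow> L + G 0" by (intro tendsto_intros)
  hence G: "G \<longlonglongrightarrow> L + G 0" by simp
  have "(\<lambda>m. R m / real (Suc m)) \<longlonglongrightarrow> 0"
  proof (rule Lim_null_comparison)
    show "\<forall>\<^sub>F m in sequentially. norm (R m / real (Suc m)) \<le> 5 / real (Suc m)"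
      using R by (intro always_eventually allI) (auto simp: abs_divide intro!: divide_right_mono)
    show "(\<lambda>m. 5 / real (Suc m)) \<longlonglongrightarrow> 0" by real_asymp
  qed
  from tendsto_add[OF G this] have "D \<longlonglongrightarrow> L + G 0" by (simp add: G_def)
  thus ?thesis unfolding D_def convergent_def by blast
qed

section \<open>The logarithm of zeta to the right of 1\<close>

text \<open>Mean value theorem for \<open>x powr (-\<sigma>)\<close>. Summed over \<open>n\<close>,
  the differences telescope and compare the partial sums of zeta at \<open>1 + \<sigma>\<close> with
  \<open>1 / \<sigma>\<close>.\<close>

lemma powr_step_bounds:
  assumes "\<sigma> > 0" "n \<ge> 1"
  shows "\<sigma> * real (Suc n) powr (-(1+\<sigma>)) \<le> real n powr (-\<sigma>) - real (Suc n) powr (-\<sigma>)"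
    and "real n powr (-\<sigma>) - real (Suc n) powr (-\<sigma>) \<le> \<sigma> * real n powr (-(1+\<sigma>))"
proof -
  have "\<exists>z. real n < z \<and> z < real (Suc n) \<and>
    real (Suc n) powr (-\<sigma>) - real n powr (-\<sigma>) = (real (Suc n) - real n) * (-\<sigma> * z powr (-\<sigma> - 1))"
    using assms by (intro MVT2) (auto intro!: derivative_eq_intros simp: powr_diff)
  then obtain z where z: "real n < z" "z < real (Suc n)" and eq:
    "real (Suc n) powr (-\<sigma>) - real n powr (-\<sigma>) = (real (Suc n) - real n) * (-\<sigma> * z powr (-\<sigma> - 1))"
    by blast
  have "-\<sigma> - 1 = -(1+\<sigma>)" by simp
  with eq have z: "real n < z" "z < real (Suc n)"
    "real n powr (-\<sigma>) - real (Suc n) powr (-\<sigma>) = \<sigma> * z powr (-(1+\<sigma>))"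
    using z by simp_all
  show "\<sigma> * real (Suc n) powr (-(1+\<sigma>)) \<le> real n powr (-\<sigma>) - real (Suc n) powr (-\<sigma>)"
    "real n powr (-\<sigma>) - real (Suc n) powr (-\<sigma>) \<le> \<sigma> * real n powr (-(1+\<sigma>))"
    unfolding z(3) using z assms by (intro mult_left_mono powr_mono2'; simp)+
qed

lemma zeta_sum_upper:
  assumes "\<sigma> > 0"
  shows "(\<Sum>n=1..N. real n powr (-(1+\<sigma>))) \<le> 1 + 1 / \<sigma>"
proof (cases "N \<ge> 1")
  case True
  hence "\<sigma> * (\<Sum>n=1..N. real n powr (-(1+\<sigma>))) \<le> \<sigma> + 1 - real N powr (-\<sigma>)"
  proof (induction N rule: dec_induct)
    case (step N)
    thus ?case using powr_step_bounds(1)[OF assms, of N] by (simp add: algebra_simps)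
  qed simp
  also have "\<dots> \<le> \<sigma> + 1" by simp
  finally show ?thesis using assms by (simp add: field_simps)
qed (use assms in auto)

lemma zeta_sum_lower:
  assumes "\<sigma> > 0"
  shows "(1 - real (Suc N) powr (-\<sigma>)) / \<sigma> \<le> (\<Sum>n=1..N. real n powr (-(1+\<sigma>)))"
proof -
  have "1 - real (Suc N) powr (-\<sigma>) \<le> \<sigma> * (\<Sum>n=1..N. real n powr (-(1+\<sigma>)))"
  proof (induction N)
    case (Suc N)
    thus ?case using powr_step_bounds(2)[OF assms, of "Suc N"] by (simp add: algebra_simps)
  qed simp
  thus ?thesis using assms by (simp add: field_simps)
qed

lemma geometric_has_sum:
  fixes x :: real
  assumes "0 \<le> x" "x < 1"
  shows "((\<lambda>m. x ^ m) has_sum (1 / (1 - x))) UNIV"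
  using assms by (intro norm_summable_imp_has_sum geometric_sums) (auto simp: abs_mult power_abs intro!: summable_geometric)

lemma prime_powr_less_1:
  assumes "prime p" "s > 0"
  shows "real p powr (-s) < 1" "real p powr (-s) > 0"
  using assms prime_gt_1_nat[of p] by (auto simp: powr_less_one)

lemma euler_product_has_sum:
  assumes s: "s > 0" and P: "finite P" "\<And>p. p \<in> P \<Longrightarrow> prime p"
  shows "((\<lambda>n. real n powr (-s)) has_sum (\<Prod>p\<in>P. 1 / (1 - real p powr (-s))))
           (prime_power_prod P ` PiE P (\<lambda>_. UNIV))"
proof -
  have hs: "((\<lambda>m. (real p powr (-s)) ^ m) has_sum (1 / (1 - real p powr (-s)))) UNIV" if "p \<in> P" for p
    using prime_powr_less_1[OF P(2)[OF that] s] by (intro geometric_has_sum) auto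
  have "((\<lambda>e. \<Prod>p\<in>P. (real p powr (-s)) ^ e p) has_sum
     (\<Prod>p\<in>P. infsum (\<lambda>m. (real p powr (-s)) ^ m) UNIV)) (PiE P (\<lambda>_. UNIV))"
  proof (rule prod_PiE_has_sum[OF P(1)])
    fix p assume p: "p \<in> P"
    show "(\<lambda>m. (real p powr (-s)) ^ m) summable_on UNIV" using hs[OF p] by (auto simp: summable_on_def)
    show "infsum (\<lambda>m. (real p powr (-s)) ^ m) UNIV > 0"
      using infsumI[OF hs[OF p]] prime_powr_less_1[OF P(2)[OF p] s] by simp
  qed auto
  moreover have "(\<Prod>p\<in>P. infsum (\<lambda>m. (real p powr (-s)) ^ m) UNIV) = (\<Prod>p\<in>P. 1 / (1 - real p powr (-s)))"
    using infsumI[OF hs] by (intro prod.cong) auto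
  ultimately have "((\<lambda>e. real (prime_power_prod P e) powr (-s)) has_sum (\<Prod>p\<in>P. 1 / (1 - real p powr (-s)))) (PiE P (\<lambda>_. UNIV))"
    by (simp add: prime_power_prod_powr)
  thus ?thesis
    using has_sum_reindex[OF inj_on_prime_power_prod[OF P], of "\<lambda>n. real n powr (-s)"] by (simp add: o_def)
qed

lemma euler_product_lower:
  assumes "s > 0"
  shows "(\<Sum>n=1..N. real n powr (-s)) \<le> (\<Prod>p\<in>primes_upto N. 1 / (1 - real p powr (-s)))"
  by (rule finite_sum_le_has_sum[OF euler_product_has_sum]) (use assms prime_power_prod_surj in auto)

lemma euler_product_upper:
  assumes s: "s > 0" and B: "\<And>M. (\<Sum>n=1..M. real n powr (-s)) \<le> B"
  shows "(\<Prod>p\<in>primes_upto N. 1 / (1 - real p powr (-s))) \<le> B"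
proof (rule has_sum_le_finite_sums[OF euler_product_has_sum])
  let ?P = "primes_upto N"
  fix F assume F: "finite F" "F \<subseteq> prime_power_prod ?P ` PiE ?P (\<lambda>_. UNIV)"
  have "n \<in> {1..Max F}" if n: "n \<in> F" for n
  proof -
    obtain e where "n = prime_power_prod ?P e" using n F(2) by blast
    hence "n > 0" using prime_power_prod_pos[of ?P e] by simp
    thus ?thesis using Max_ge[OF F(1) n] by simp
  qed
  hence "(\<Sum>n\<in>F. real n powr (-s)) \<le> (\<Sum>n=1..Max F. real n powr (-s))"
    by (intro sum_mono2) auto
  thus "(\<Sum>n\<in>F. real n powr (-s)) \<le> B" using B order_trans by blast
qed (use s in auto)

text \<open>The term at \<open>n = 0\<close> is \<open>1 / 0 = 0\<close>, so the series effectively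
  starts at \<open>n = 1\<close>.\<close>

lemma minus_ln_sums:
  fixes x :: real
  assumes "\<bar>x\<bar> < 1"
  shows "(\<lambda>n. x ^ n / real n) sums (- ln (1 - x))"
  using sums_minus[OF ln_series'[of "-x"]] assms by simp

lemma log_zeta_sum_upper:
  assumes \<sigma>: "\<sigma> > 0"
  shows "(\<Sum>n\<in>{2..N}. mangoldt n / ln (real n) * real n powr (-(1+\<sigma>))) \<le> ln (1 + 1 / \<sigma>)"
proof -
  let ?P = "primes_upto N"
  define x where "x p = real p powr (-(1+\<sigma>))" for p
  have x: "0 < x p" "x p < 1" if "prime p" for p
    unfolding x_def using prime_powr_less_1[OF that, of "1+\<sigma>"] \<sigma> by auto
  have "(\<Sum>n\<in>{2..N}. mangoldt n / ln (real n) * real n powr (-(1+\<sigma>))) =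
        (\<Sum>p\<in>?P. \<Sum>j\<in>{1..max_exponent N p}. real (p ^ j) powr (-(1+\<sigma>)) / real j)"
    using sum_mangoldt_eq_sum_primes[of "\<lambda>n. real n powr (-(1+\<sigma>))" N] by simp
  also have "\<dots> \<le> (\<Sum>p\<in>?P. - ln (1 - x p))"
  proof (rule sum_mono)
    fix p assume "p \<in> ?P"
    hence p: "prime p" by simp
    have sums: "(\<lambda>n. x p ^ n / real n) sums (- ln (1 - x p))"
      using x[OF p] by (intro minus_ln_sums) auto
    have "(\<Sum>j\<in>{1..max_exponent N p}. real (p ^ j) powr (-(1+\<sigma>)) / real j) =
          (\<Sum>j\<in>{1..max_exponent N p}. x p ^ j / real j)"
      unfolding x_def powr_nat_power ..
    also have "\<dots> \<le> - ln (1 - x p)"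
      using sums_unique[OF sums] sum_le_suminf[OF sums_summable[OF sums], of "{1..max_exponent N p}"] x[OF p]
      by simp
    finally show "(\<Sum>j\<in>{1..max_exponent N p}. real (p ^ j) powr (-(1+\<sigma>)) / real j) \<le> - ln (1 - x p)" .
  qed
  also have "\<dots> = (\<Sum>p\<in>?P. ln (1 / (1 - x p)))"
    using x by (intro sum.cong refl) (simp add: ln_div)
  also have "\<dots> = ln (\<Prod>p\<in>?P. 1 / (1 - x p))"
    by (subst ln_prod) (auto dest: x(2))
  also have "\<dots> \<le> ln (1 + 1 / \<sigma>)"
  proof (subst ln_le_cancel_iff)
    show "0 < (\<Prod>p\<in>?P. 1 / (1 - x p))" using x by (intro prod_pos) auto
    show "(\<Prod>p\<in>?P. 1 / (1 - x p)) \<le> 1 + 1 / \<sigma>"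
      unfolding x_def using \<sigma> zeta_sum_upper[OF \<sigma>] by (intro euler_product_upper) auto
    show "0 < 1 + 1 / \<sigma>" using \<sigma> by (simp add: add_pos_pos)
  qed
  finally show ?thesis .
qed

text \<open>A sum over \<open>n \<le> N\<close> contains the powers of each prime only up to
  \<open>N\<close>, so it is not directly comparable with an Euler product from below. All
  \<open>p ^ j\<close> with \<open>p \<le> M\<close> and \<open>j < K\<close> occur for
  \<open>N = M ^ K\<close>; letting \<open>K\<close> tend to infinity gives the product over
  \<open>p \<le> M\<close>, and letting \<open>M\<close> do so gives
  \<open>1 / \<sigma>\<close>.\<close>

lemma log_zeta_sum_lower:
  assumes \<sigma>: "\<sigma> > 0" and L: "\<And>N. (\<Sum>n\<in>{2..N}. mangoldt n / ln (real n) * real n powr (-(1+\<sigma>))) \<le> L"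
  shows "- ln \<sigma> \<le> L"
proof -
  define x where "x p = real p powr (-(1+\<sigma>))" for p
  have x: "0 < x p" "x p < 1" if "prime p" for p
    unfolding x_def using prime_powr_less_1[OF that, of "1+\<sigma>"] \<sigma> by auto
  have fin: "(\<Sum>p\<in>primes_upto M. - ln (1 - x p)) \<le> L" if M: "M \<ge> 1" for M
  proof (rule LIMSEQ_le_const2)
    let ?P = "{p. prime p \<and> p \<le> M}"
    show "(\<lambda>K. \<Sum>p\<in>?P. \<Sum>j<K. x p ^ j / real j) \<longlonglongrightarrow> (\<Sum>p\<in>?P. - ln (1 - x p))"
    proof (rule tendsto_sum)
      fix p assume "p \<in> ?P"
      thus "(\<lambda>K. \<Sum>j<K. x p ^ j / real j) \<longlonglongrightarrow> - ln (1 - x p)"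
        using minus_ln_sums[of "x p"] x[of p] by (simp add: sums_def)
    qed
    show "\<exists>N. \<forall>K\<ge>N. (\<Sum>p\<in>?P. \<Sum>j<K. x p ^ j / real j) \<le> L"
    proof (intro exI[of _ 1] allI impI)
      fix K :: nat assume K: "K \<ge> 1"
      have "(\<Sum>p\<in>?P. \<Sum>j<K. x p ^ j / real j) \<le>
            (\<Sum>p\<in>?P. \<Sum>j\<in>{1..max_exponent (M ^ K) p}. real (p ^ j) powr (-(1+\<sigma>)) / real j)"
      proof (rule sum_mono)
        fix p assume p: "p \<in> ?P"
        hence "p ^ K \<le> M ^ K" by (intro power_mono) auto
        hence "K \<le> max_exponent (M ^ K) p"
          using power_le_iff_max_exponent[of p "M ^ K" K] p prime_ge_2_nat[of p] M by simp
        hence "(\<Sum>j<K. x p ^ j / real j) \<le> (\<Sum>j\<in>{0..max_exponent (M ^ K) p}. x p ^ j / real j)"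
          using x[of p] p by (intro sum_mono2) auto
        also have "\<dots> = (\<Sum>j\<in>{1..max_exponent (M ^ K) p}. x p ^ j / real j)"
          by (rule sum.mono_neutral_right) auto
        also have "\<dots> = (\<Sum>j\<in>{1..max_exponent (M ^ K) p}. real (p ^ j) powr (-(1+\<sigma>)) / real j)"
          unfolding x_def powr_nat_power ..
        finally show "(\<Sum>j<K. x p ^ j / real j) \<le>
          (\<Sum>j\<in>{1..max_exponent (M ^ K) p}. real (p ^ j) powr (-(1+\<sigma>)) / real j)" .
      qed
      also have "\<dots> \<le> (\<Sum>p\<in>primes_upto (M ^ K). \<Sum>j\<in>{1..max_exponent (M ^ K) p}. real (p ^ j) powr (-(1+\<sigma>)) / real j)"
      proof (rule sum_mono2)
        have "M ^ 1 \<le> M ^ K" using K M by (intro power_increasing) auto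
        thus "?P \<subseteq> {p. prime p \<and> p \<le> M ^ K}" by auto
      qed (auto intro!: sum_nonneg)
      also have "\<dots> = (\<Sum>n\<in>{2..M^K}. mangoldt n / ln (real n) * real n powr (-(1+\<sigma>)))"
        using sum_mangoldt_eq_sum_primes[of "\<lambda>n. real n powr (-(1+\<sigma>))" "M ^ K"] by simp
      also have "\<dots> \<le> L" by (rule L)
      finally show "(\<Sum>p\<in>?P. \<Sum>j<K. x p ^ j / real j) \<le> L" .
    qed
  qed
  have "ln ((1 - real (Suc M) powr (-\<sigma>)) / \<sigma>) \<le> L" if M: "M \<ge> 1" for M
  proof -
    let ?P = "{p. prime p \<and> p \<le> M}"
    have "real (Suc M) powr (-\<sigma>) < 1" using M \<sigma> by (simp add: powr_less_one)
    hence "ln ((1 - real (Suc M) powr (-\<sigma>)) / \<sigma>) \<le> ln (\<Prod>p\<in>?P. 1 / (1 - x p))"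
    proof (subst ln_le_cancel_iff)
      show "0 < (\<Prod>p\<in>?P. 1 / (1 - x p))" using x by (intro prod_pos) auto
      show "(1 - real (Suc M) powr (-\<sigma>)) / \<sigma> \<le> (\<Prod>p\<in>?P. 1 / (1 - x p))"
        unfolding x_def
        using zeta_sum_lower[OF \<sigma>, of M] euler_product_lower[of "1+\<sigma>" M] \<sigma> by simp
    qed (use \<sigma> in auto)
    also have "\<dots> = (\<Sum>p\<in>?P. ln (1 / (1 - x p)))"
      by (subst ln_prod) (auto dest: x(2))
    also have "\<dots> = (\<Sum>p\<in>?P. - ln (1 - x p))"
      using x by (intro sum.cong refl) (simp add: ln_div)
    also have "\<dots> \<le> L" by (rule fin[OF M])
    finally show ?thesis .
  qed
  moreover have "(\<lambda>M. ln ((1 - real (Suc M) powr (-\<sigma>)) / \<sigma>)) \<longlonglongrightarrow> ln (inverse \<sigma>)"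
    using \<sigma> by real_asymp
  hence "(\<lambda>M. ln ((1 - real (Suc M) powr (-\<sigma>)) / \<sigma>)) \<longlonglongrightarrow> - ln \<sigma>"
    using \<sigma> by (simp add: ln_inverse)
  ultimately show ?thesis by (intro LIMSEQ_le_const2) auto
qed

section \<open>The constant in Mertens' theorem\<close>

text \<open>The limit \<open>l\<close> of \<open>D\<close> is also the limit of its Abel means
  \<open>W z\<close>. For \<open>z = exp (-\<sigma>)\<close>, the quantity
  \<open>W z - ln (1 - z)\<close> lies between \<open>z * L\<close> and \<open>L\<close>, where
  \<open>- ln \<sigma> \<le> L \<le> ln (1 + 1 / \<sigma>)\<close>. As
  \<open>ln (1 - exp (-\<sigma>))\<close> compensates \<open>- ln \<sigma>\<close> up to
  \<open>o(1)\<close>, the means tend to 0.\<close>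

lemma mertens_block_tendsto:
  "(\<lambda>m. mertens_sum (exp_floor m) - harm m) \<longlonglongrightarrow> 0"
proof -
  define D where "D m = mertens_sum (exp_floor m) - harm m" for m
  obtain l where l: "D \<longlonglongrightarrow> l"
    using mertens_block_difference_convergent unfolding D_def convergent_def by blast
  define c where "c m = mertens_sum (exp_floor (Suc m)) - mertens_sum (exp_floor m)" for m
  define W where "W z = (1 - z) * (\<Sum>m. D m * z ^ m)" for z
  have c_eq: "c m = (\<Sum>n\<in>{exp_floor m<..exp_floor (Suc m)}. mangoldt n / ln (real n) * (1 / real n))" for m
    unfolding c_def mertens_sum_def sum_split_exp_floor by simp
  have bounds: "- exp (-\<sigma>) * ln \<sigma> + ln (1 - exp (-\<sigma>)) \<le> W (exp (-\<sigma>))"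
    "W (exp (-\<sigma>)) \<le> ln (1 + 1 / \<sigma>) + ln (1 - exp (-\<sigma>))" if \<sigma>: "\<sigma> > 0" for \<sigma>
  proof -
    define z where "z = exp (-\<sigma>)"
    have z: "0 < z" "z < 1" using \<sigma> by (auto simp: z_def)
    define S where "S N = (\<Sum>n\<in>{2..N}. mangoldt n / ln (real n) * real n powr (-(1+\<sigma>)))" for N
    \<comment> \<open>\<open>L\<close> is the logarithm of zeta at \<open>1 + \<sigma>\<close>,
      obtained as a supremum of finite sums.\<close>
    define L where "L = (SUP N. S N)"
    have bdd: "bdd_above (range S)"
      using log_zeta_sum_upper[OF \<sigma>] by (intro bdd_aboveI[of _ "ln (1 + 1 / \<sigma>)"]) (auto simp: S_def)
    have S_le: "S N \<le> L" for N unfolding L_def using bdd by (intro cSUP_upper) auto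
    have L_upper: "L \<le> ln (1 + 1 / \<sigma>)"
      unfolding L_def using log_zeta_sum_upper[OF \<sigma>] by (intro cSUP_least) (auto simp: S_def)
    have L_lower: "- ln \<sigma> \<le> L"
      using log_zeta_sum_lower[OF \<sigma>] S_le by (simp add: S_def)
    have incS: "incseq S"
      unfolding S_def by (intro incseq_SucI sum_mono2) (auto simp: mangoldt_nonneg)
    have S_lim: "S \<longlonglongrightarrow> L"
      unfolding L_def by (rule LIMSEQ_incseq_SUP[OF bdd incS])
    have "filterlim exp_floor at_top sequentially"
      unfolding exp_floor_def by real_asymp
    hence S_lim': "(\<lambda>M. S (exp_floor M)) \<longlonglongrightarrow> L" by (rule filterlim_compose[OF S_lim])
    have "Bseq D" using l by (intro convergent_imp_Bseq) (auto simp: convergent_def)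
    then obtain B where B: "\<And>m. norm (D m) \<le> B" unfolding Bseq_def by blast
    have smD: "summable (\<lambda>m. D m * z ^ m)"
    proof (rule summable_comparison_test')
      show "summable (\<lambda>m. B * z ^ m)" using z by (intro summable_mult summable_geometric) auto
      show "norm (D m * z ^ m) \<le> B * z ^ m" for m
        using B[of m] z by (simp add: abs_mult mult_right_mono)
    qed
    \<comment> \<open>No boundary term arises when the series is shifted by one index.\<close>
    have D0: "D 0 = 0" by (simp add: D_def exp_floor_0 mertens_sum_def harm_def)
    have "(\<lambda>m. D (Suc m) * z ^ Suc m) sums ((\<Sum>m. D m * z ^ m) - D 0 * z ^ 0)"
      using summable_sums[OF smD] by (subst sums_Suc_iff) simp
    from sums_diff[OF this sums_mult[OF summable_sums[OF smD], of z]]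
    have "(\<lambda>m. (D (Suc m) - D m) * z ^ Suc m) sums W z"
      by (simp add: D0 W_def algebra_simps)
    moreover have "(\<lambda>m. z ^ Suc m / real (Suc m)) sums (- ln (1 - z))"
    proof -
      have "(\<lambda>n. z ^ n / real n) sums (- ln (1 - z))" using z by (intro minus_ln_sums) auto
      thus ?thesis by (subst sums_Suc_iff) simp
    qed
    ultimately have "(\<lambda>m. (D (Suc m) - D m) * z ^ Suc m + z ^ Suc m / real (Suc m)) sums (W z + - ln (1 - z))"
      by (rule sums_add)
    moreover have "(D (Suc m) - D m) * z ^ Suc m + z ^ Suc m / real (Suc m) = c m * z ^ Suc m" for m
      by (simp add: D_def c_def harm_Suc inverse_eq_divide algebra_simps add_divide_distrib)
    ultimately have "(\<lambda>m. c m * z ^ Suc m) sums (W z - ln (1 - z))" by simp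
    hence C_lim: "(\<lambda>M. \<Sum>m<M. c m * z ^ Suc m) \<longlonglongrightarrow> W z - ln (1 - z)" by (simp add: sums_def)
    have zpow: "z ^ j = exp (- \<sigma> * real j)" for j
      by (simp add: z_def mult.commute flip: exp_of_nat_mult)
    have npow: "real n powr (-(1+\<sigma>)) = 1 / real n * exp (- \<sigma> * ln (real n))" if "n \<ge> 1" for n
    proof -
      have "real n powr (-(1+\<sigma>)) = exp (- ln (real n) + - \<sigma> * ln (real n))"
        using that by (simp add: powr_def algebra_simps)
      also have "\<dots> = exp (- ln (real n)) * exp (- \<sigma> * ln (real n))" by (rule exp_add)
      also have "exp (- ln (real n)) = 1 / real n" using that by (simp add: exp_minus inverse_eq_divide)
      finally show ?thesis .
    qed
    \<comment> \<open>On block \<open>m\<close> one has \<open>ln n \<le> m + 1\<close>, so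
      \<open>z ^ (m + 1) \<le> n powr (-\<sigma>)\<close>.\<close>
    have "(\<Sum>m<M. c m * z ^ Suc m) \<le> S (exp_floor M)" for M
      unfolding S_def sum_split_exp_floor c_eq sum_distrib_right
    proof (intro sum_mono)
      fix m n assume n: "n \<in> {exp_floor m<..exp_floor (Suc m)}"
      note b = block_bounds[OF n]
      have "z ^ Suc m \<le> exp (- \<sigma> * ln (real n))"
        unfolding zpow using b \<sigma> by simp
      hence "mangoldt n / ln (real n) * (1 / real n) * z ^ Suc m \<le>
             mangoldt n / ln (real n) * (1 / real n) * exp (- \<sigma> * ln (real n))"
        using b by (intro mult_left_mono) (auto simp: mangoldt_nonneg)
      moreover have "mangoldt n / ln (real n) * real n powr (-(1+\<sigma>)) =
             mangoldt n / ln (real n) * (1 / real n) * exp (- \<sigma> * ln (real n))"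
        using npow[of n] b by (simp only: mult.assoc)
      ultimately show "mangoldt n / ln (real n) * (1 / real n) * z ^ Suc m \<le>
            mangoldt n / ln (real n) * real n powr (-(1+\<sigma>))" by simp
    qed
    hence up: "W z - ln (1 - z) \<le> L"
      using S_le by (intro LIMSEQ_le_const2[OF C_lim]) (meson order_trans)
    \<comment> \<open>On block \<open>m\<close> also \<open>m < ln n\<close>, so
      \<open>n powr (-\<sigma>) \<le> z ^ m\<close>; the extra factor \<open>z\<close> makes up for
      the missing power.\<close>
    have "z * S (exp_floor M) \<le> (\<Sum>m<M. c m * z ^ Suc m)" for M
      unfolding S_def sum_split_exp_floor c_eq sum_distrib_right sum_distrib_left
    proof (intro sum_mono)
      fix m n assume n: "n \<in> {exp_floor m<..exp_floor (Suc m)}"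
      note b = block_bounds[OF n]
      have "z * exp (- \<sigma> * ln (real n)) = exp (- \<sigma> * (1 + ln (real n)))"
        by (simp add: z_def algebra_simps flip: exp_add)
      also have "\<dots> \<le> z ^ Suc m"
        unfolding zpow using b \<sigma> by simp
      finally have "mangoldt n / ln (real n) * (1 / real n) * (z * exp (- \<sigma> * ln (real n))) \<le>
             mangoldt n / ln (real n) * (1 / real n) * z ^ Suc m"
        using b by (intro mult_left_mono) (auto simp: mangoldt_nonneg)
      moreover have "z * (mangoldt n / ln (real n) * real n powr (-(1+\<sigma>))) =
             mangoldt n / ln (real n) * (1 / real n) * (z * exp (- \<sigma> * ln (real n)))"
        using npow[of n] b by (simp only: mult_ac)
      ultimately show "z * (mangoldt n / ln (real n) * real n powr (-(1+\<sigma>))) \<le>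
            mangoldt n / ln (real n) * (1 / real n) * z ^ Suc m" by simp
    qed
    hence "z * L \<le> W z - ln (1 - z)"
      by (intro LIMSEQ_le[OF tendsto_mult_left[OF S_lim'] C_lim]) auto
    moreover have "z * (- ln \<sigma>) \<le> z * L" using L_lower z by (intro mult_left_mono) auto
    ultimately show "- exp (-\<sigma>) * ln \<sigma> + ln (1 - exp (-\<sigma>)) \<le> W (exp (-\<sigma>))"
      unfolding z_def by simp
    show "W (exp (-\<sigma>)) \<le> ln (1 + 1 / \<sigma>) + ln (1 - exp (-\<sigma>))"
      using up L_upper unfolding z_def by simp
  qed
  have pos: "eventually (\<lambda>\<sigma>. \<sigma> > 0) (at_right (0::real))"
    by (rule eventually_at_right_less)
  have "((\<lambda>\<sigma>. W (exp (-\<sigma>))) \<longlongrightarrow> 0) (at_right 0)"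
  proof (rule tendsto_sandwich)
    show "eventually (\<lambda>\<sigma>. - exp (-\<sigma>) * ln \<sigma> + ln (1 - exp (-\<sigma>)) \<le> W (exp (-\<sigma>))) (at_right 0)"
      using pos by eventually_elim (rule bounds)
    show "eventually (\<lambda>\<sigma>. W (exp (-\<sigma>)) \<le> ln (1 + 1 / \<sigma>) + ln (1 - exp (-\<sigma>))) (at_right 0)"
      using pos by eventually_elim (rule bounds)
    show "((\<lambda>\<sigma>. - exp (-\<sigma>) * ln \<sigma> + ln (1 - exp (-\<sigma>))) \<longlongrightarrow> 0) (at_right (0::real))" by real_asymp
    show "((\<lambda>\<sigma>. ln (1 + 1 / \<sigma>) + ln (1 - exp (-\<sigma>))) \<longlongrightarrow> 0) (at_right (0::real))" by real_asymp
  qed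
  moreover have "((\<lambda>\<sigma>. W (exp (-\<sigma>))) \<longlongrightarrow> l) (at_right 0)"
  proof (rule filterlim_compose[OF abel_mean_tendsto[OF l, folded W_def]])
    show "filterlim (\<lambda>\<sigma>::real. exp (-\<sigma>)) (at_left 1) (at_right 0)" by real_asymp
  qed
  ultimately have "l = 0" using tendsto_unique[OF trivial_limit_at_right_real] by blast
  thus ?thesis using l by (simp add: D_def[abs_def])
qed

text \<open>Between two block ends \<open>mertens_sum\<close> is monotone and
  \<open>ln (ln N)\<close> moves by at most \<open>ln (r + 1) - ln r\<close>, so the limit passes
  from the block ends to all \<open>N\<close>.\<close>

lemma mertens_sum_tendsto:
  "(\<lambda>N. mertens_sum N - ln (ln (real N))) \<longlonglongrightarrow> euler_mascheroni"
proof -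
  define T where "T m = mertens_sum (exp_floor m) - ln (real m)" for m
  have T: "T \<longlonglongrightarrow> euler_mascheroni"
    using tendsto_add[OF mertens_block_tendsto euler_mascheroni_LIMSEQ] by (simp add: T_def[abs_def])
  define r where "r N = nat \<lfloor>ln (real N)\<rfloor>" for N :: nat
  have r: "filterlim r at_top sequentially" unfolding r_def by real_asymp
  have r': "filterlim (\<lambda>N. Suc (r N)) at_top sequentially"
    by (rule filterlim_compose[OF filterlim_Suc r])
  have d: "(\<lambda>m. ln (real (Suc m)) - ln (real m)) \<longlonglongrightarrow> 0" by real_asymp
  have ev: "eventually (\<lambda>N. N \<ge> 3 \<and> r N \<ge> 1) sequentially"
    using r by (intro eventually_conj eventually_ge_at_top) (simp add: filterlim_at_top)
  have bounds: "T (r N) - (ln (real (Suc (r N))) - ln (real (r N))) \<le> mertens_sum N - ln (ln (real N))"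
      "mertens_sum N - ln (ln (real N)) \<le> T (Suc (r N)) + (ln (real (Suc (r N))) - ln (real (r N)))"
    if N: "N \<ge> 3 \<and> r N \<ge> 1" for N
  proof -
    have lnN: "real (r N) \<le> ln (real N)" "ln (real N) \<le> real (Suc (r N))"
      using N unfolding r_def by (auto intro: order_trans[OF of_nat_floor]) linarith+
    have "exp_floor (r N) \<le> N"
    proof (rule ccontr)
      assume "\<not> exp_floor (r N) \<le> N"
      hence "Suc N \<le> exp_floor (r N)" by simp
      hence "ln (real (Suc N)) \<le> real (r N)" using le_exp_floor_iff[of "Suc N" "r N"] by simp
      moreover have "ln (real N) < ln (real (Suc N))" using N by (subst ln_less_cancel_iff) auto
      ultimately show False using lnN by simp
    qed
    hence 1: "mertens_sum (exp_floor (r N)) \<le> mertens_sum N" by (rule mertens_sum_mono)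
    have "N \<le> exp_floor (Suc (r N))" using le_exp_floor_iff[of N "Suc (r N)"] N lnN by simp
    hence 2: "mertens_sum N \<le> mertens_sum (exp_floor (Suc (r N)))" by (rule mertens_sum_mono)
    have "ln (real (r N)) \<le> ln (ln (real N))" using lnN N by (subst ln_le_cancel_iff) auto
    moreover have "ln (ln (real N)) \<le> ln (real (Suc (r N)))" using lnN N by (subst ln_le_cancel_iff) auto
    ultimately show "T (r N) - (ln (real (Suc (r N))) - ln (real (r N))) \<le> mertens_sum N - ln (ln (real N))"
      "mertens_sum N - ln (ln (real N)) \<le> T (Suc (r N)) + (ln (real (Suc (r N))) - ln (real (r N)))"
      using 1 2 unfolding T_def by linarith+
  qed
  show ?thesis
  proof (rule tendsto_sandwich)
    show "eventually (\<lambda>N. T (r N) - (ln (real (Suc (r N))) - ln (real (r N))) \<le> mertens_sum N - ln (ln (real N))) sequentially"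
      using ev by eventually_elim (rule bounds)
    show "eventually (\<lambda>N. mertens_sum N - ln (ln (real N)) \<le> T (Suc (r N)) + (ln (real (Suc (r N))) - ln (real (r N)))) sequentially"
      using ev by eventually_elim (rule bounds)
    show "(\<lambda>N. T (r N) - (ln (real (Suc (r N))) - ln (real (r N)))) \<longlonglongrightarrow> euler_mascheroni"
      using tendsto_diff[OF filterlim_compose[OF T r] filterlim_compose[OF d r]] by simp
    show "(\<lambda>N. T (Suc (r N)) + (ln (real (Suc (r N))) - ln (real (r N)))) \<longlonglongrightarrow> euler_mascheroni"
      using tendsto_add[OF filterlim_compose[OF T r'] filterlim_compose[OF d r]] by simp
  qed
qed

text \<open>\<open>mertens_sum\<close> contains only the prime powers up to \<open>N\<close>; the
  missing ends of the series for \<open>- ln (1 - 1 / p)\<close> form \<open>G\<close>, which is at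
  most a multiple of \<open>N powr (-1/4)\<close>.\<close>

theorem mertens_third:
  "(\<lambda>N. (\<Sum>p\<in>primes_upto N. - ln (1 - 1 / real p)) - ln (ln (real N))) \<longlonglongrightarrow> euler_mascheroni"
proof -
  have sm: "summable (\<lambda>m. 1 / real m * (2 powr (-3/4)) ^ m)"
    using sums_summable[OF minus_ln_sums[of "2 powr (-3/4)"]] by (simp add: powr_less_one)
  have nn: "1 / real m \<ge> 0" for m by simp
  obtain K where "K \<ge> 0" and smt:
    "\<And>(N::nat) (p::nat). prime p \<Longrightarrow> p \<le> N \<Longrightarrow>
       summable (\<lambda>m. 1 / real (m + Suc (max_exponent N p)) / real p ^ (m + Suc (max_exponent N p)))" and K:
    "\<And>(N::nat). (\<Sum>p\<in>primes_upto N. prime_power_tail (\<lambda>m. 1 / real m) N p)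
       \<le> K * real N powr (-1/4)"
    by (rule prime_power_tail_bound[OF nn sm]) (rule that)
  define G where "G N = (\<Sum>p\<in>primes_upto N. prime_power_tail (\<lambda>m. 1 / real m) N p)" for N
  have eq: "(\<Sum>p\<in>primes_upto N. - ln (1 - 1 / real p)) = mertens_sum N + G N" for N
  proof -
    have "mertens_sum N = (\<Sum>p\<in>primes_upto N. \<Sum>j\<in>{1..max_exponent N p}. 1 / real (p ^ j) / real j)"
      unfolding mertens_sum_def using sum_mangoldt_eq_sum_primes[of "\<lambda>n. 1 / real n" N] by simp
    moreover have "- ln (1 - 1 / real p) = (\<Sum>j\<in>{1..max_exponent N p}. 1 / real (p ^ j) / real j) +
       (prime_power_tail (\<lambda>m. 1 / real m) N p)"
      if p: "prime p" for p
    proof -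
      let ?k = "Suc (max_exponent N p)" and ?f = "\<lambda>n. (1 / real p) ^ n / real n"
      have "real p > 1" using prime_gt_1_nat[OF p] by simp
      hence s: "?f sums (- ln (1 - 1 / real p))" by (intro minus_ln_sums) auto
      have "- ln (1 - 1 / real p) = (\<Sum>m. ?f (m + ?k)) + (\<Sum>j<?k. ?f j)"
        using suminf_split_initial_segment[OF sums_summable[OF s], of ?k] sums_unique[OF s] by simp
      also have "(\<Sum>j<?k. ?f j) = (\<Sum>j\<in>{1..max_exponent N p}. ?f j)"
        by (rule sum.mono_neutral_right) auto
      finally show ?thesis by (simp add: power_one_over field_simps)
    qed
    ultimately show ?thesis unfolding G_def by (simp add: sum.distrib)
  qed
  have "G \<longlonglongrightarrow> 0"
  proof (rule tendsto_sandwich[OF _ _ tendsto_const])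
    show "eventually (\<lambda>N. 0 \<le> G N) sequentially"
      unfolding G_def
    proof (intro always_eventually allI sum_nonneg)
      fix N p :: nat assume "p \<in> primes_upto N"
      thus "0 \<le> (prime_power_tail (\<lambda>m. 1 / real m) N p)"
        by (intro suminf_nonneg smt) auto
    qed
    show "eventually (\<lambda>N. G N \<le> K * real N powr (-1/4)) sequentially"
      using K by (simp add: G_def)
    show "(\<lambda>N. K * real N powr (-1/4)) \<longlonglongrightarrow> 0" by real_asymp
  qed
  from tendsto_add[OF mertens_sum_tendsto this] show ?thesis
    unfolding eq by (simp add: algebra_simps)
qed


section \<open>The mean value over primitive characters\<close>

lemma has_sum_sum:
  fixes f :: "'a \<Rightarrow> 'b \<Rightarrow> 'c :: topological_comm_monoid_add"
  assumes "finite I" "\<And>i. i \<in> I \<Longrightarrow> (f i has_sum S i) A"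
  shows "((\<lambda>x. \<Sum>i\<in>I. f i x) has_sum (\<Sum>i\<in>I. S i)) A"
  using assms by (induction I) (auto intro!: has_sum_add)

text \<open>Off the diagonal the double series is dominated by a multiple of
  \<open>g a * g b\<close>, whose sum over \<open>A \<times> A\<close> is \<open>W * W\<close>; on
  it the character average is exactly 1. The abstract index set \<open>A\<close> stands for exponent
  vectors, and injectivity of \<open>N\<close> ensures that distinct indices mean distinct
  integers.\<close>

lemma primitive_mean_value:
  fixes w :: "'a \<Rightarrow> real" and N :: "'a \<Rightarrow> nat"
  assumes q: "q > 0" and pos: "phi_star q > 0" and w: "\<And>a. a \<in> A \<Longrightarrow> w a \<ge> 0"
    and inj: "inj_on N A" and cop: "\<And>a. a \<in> A \<Longrightarrow> coprime (int (N a)) (int q)"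
    and N: "\<And>a. a \<in> A \<Longrightarrow> N a \<ge> 1" and \<eta>: "0 < \<eta>" "\<eta> \<le> 1"
    and sm: "((\<lambda>a. w a * real (N a) powr \<eta>) has_sum W) A"
  shows "\<bar>1 / real (phi_star q) * (\<Sum>chi | primitive_character q chi.
            (cmod (\<Sum>\<^sub>\<infinity>a\<in>A. of_real (w a) * chi (int (N a))))\<^sup>2) - (\<Sum>\<^sub>\<infinity>a\<in>A. (w a)\<^sup>2)\<bar>
         \<le> real (phi_star q) powr (-\<eta>) * W\<^sup>2"
proof -
  define \<phi> where "\<phi> = real (phi_star q)"
  have \<phi>: "\<phi> \<ge> 1" using pos by (simp add: \<phi>_def)
  let ?C = "{chi. primitive_character q chi}"
  define F where "F a b = (\<Sum>chi\<in>?C. chi (int (N a)) * cnj (chi (int (N b))))" for a b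
  have powr_ge: "real (N a) powr \<eta> \<ge> 1" if "a \<in> A" for a
    using N[OF that] \<eta> by (intro ge_one_powr_ge_zero) auto
  have w_le: "w a \<le> w a * real (N a) powr \<eta>" if "a \<in> A" for a
    using mult_left_mono[OF powr_ge[OF that] w[OF that]] by simp
  have smw: "w summable_on A"
    by (rule summable_on_comparison_test[OF has_sum_imp_summable[OF sm]]) (use w_le w in auto)
  define f where "f chi a = complex_of_real (w a) * chi (int (N a))" for chi a
  have f_abs: "(\<lambda>a. norm (f chi a)) summable_on A" if "chi \<in> ?C" for chi
  proof (rule summable_on_comparison_test[OF smw])
    fix a assume a: "a \<in> A"
    have "dirichlet_character q chi" using that by (simp add: primitive_character_def)
    thus "norm (f chi a) \<le> w a" using w[OF a] by (simp add: f_def norm_mult norm_dirichlet_character)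
  qed auto
  have term_sum: "((\<lambda>(a, b). f chi a * cnj (f chi b)) has_sum of_real ((cmod (infsum (f chi) A))\<^sup>2)) (A \<times> A)"
    if chi: "chi \<in> ?C" for chi
  proof -
    have hs: "(f chi has_sum infsum (f chi) A) A"
      using f_abs[OF chi] abs_summable_summable has_sum_infsum by blast
    have hs': "((\<lambda>a. cnj (f chi a)) has_sum cnj (infsum (f chi) A)) A"
      using hs by (simp add: has_sum_cnj_iff)
    have "((\<lambda>(a, b). f chi a * cnj (f chi b)) has_sum (infsum (f chi) A * cnj (infsum (f chi) A))) (A \<times> A)"
      using f_abs[OF chi] by (intro has_sum_mult_Times(1) hs hs') simp_all
    thus ?thesis by (simp only: complex_norm_square)
  qed
  define M where "M = 1 / \<phi> * (\<Sum>chi\<in>?C. (cmod (infsum (f chi) A))\<^sup>2)"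
  have "((\<lambda>x. \<Sum>chi\<in>?C. case x of (a, b) \<Rightarrow> f chi a * cnj (f chi b)) has_sum
     (\<Sum>chi\<in>?C. of_real ((cmod (infsum (f chi) A))\<^sup>2))) (A \<times> A)"
    by (rule has_sum_sum[OF finite_primitive_characters term_sum])
  from has_sum_cmult_right[OF this, of "of_real (1 / \<phi>)"]
  have "((\<lambda>x. of_real (1 / \<phi>) * (\<Sum>chi\<in>?C. case x of (a, b) \<Rightarrow> f chi a * cnj (f chi b))) has_sum of_real M) (A \<times> A)"
    by (simp add: M_def)
  also have "(\<lambda>x. of_real (1 / \<phi>) * (\<Sum>chi\<in>?C. case x of (a, b) \<Rightarrow> f chi a * cnj (f chi b))) =
             (\<lambda>(a, b). of_real (w a * w b) * (F a b / of_real \<phi>))"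
    by (auto simp: F_def f_def sum_distrib_left sum_divide_distrib mult_ac fun_eq_iff intro!: sum.cong)
  finally have M: "((\<lambda>(a, b). of_real (w a * w b) * (F a b / of_real \<phi>)) has_sum of_real M) (A \<times> A)" .
  define D where "D = (\<Sum>\<^sub>\<infinity>a\<in>A. (w a)\<^sup>2)"
  have sm2: "(\<lambda>a. (w a)\<^sup>2) summable_on A"
  proof -
    have "(\<lambda>(a, b). w a * w b) summable_on A \<times> A"
    proof -
      have abs: "(\<lambda>a. norm (w a)) summable_on A" by (rule summable_on_cong[THEN iffD2, OF _ smw]) (use w in auto)
      have "((\<lambda>(a, b). w a * w b) has_sum (infsum w A * infsum w A)) (A \<times> A)"
        using has_sum_infsum[OF smw] abs by (intro has_sum_mult_Times(1))
      thus ?thesis by (rule has_sum_imp_summable)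
    qed
    hence "(\<lambda>(a, b). w a * w b) summable_on (\<lambda>a. (a, a)) ` A"
      by (rule summable_on_subset_banach) auto
    thus ?thesis
      by (subst (asm) summable_on_reindex) (auto simp: inj_on_def o_def power2_eq_square)
  qed
  have "((\<lambda>a. complex_of_real ((w a)\<^sup>2)) has_sum of_real D) A"
    unfolding D_def by (intro has_sum_of_real has_sum_infsum sm2)
  hence "((\<lambda>(a, b). of_real (w a * w b)) has_sum complex_of_real D) ((\<lambda>a. (a, a)) ` A)"
    by (subst has_sum_reindex) (auto simp: inj_on_def o_def power2_eq_square)
  hence diag: "((\<lambda>(a, b). if a = b then of_real (w a * w b) else 0) has_sum complex_of_real D) (A \<times> A)"
    by (rule has_sum_cong_neutral[THEN iffD1, rotated -1]) auto
  have diff: "((\<lambda>x. (case x of (a, b) \<Rightarrow> of_real (w a * w b) * (F a b / of_real \<phi>)) -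
      (case x of (a, b) \<Rightarrow> if a = b then of_real (w a * w b) else 0)) has_sum (of_real M - of_real D)) (A \<times> A)"
    using has_sum_add[OF M has_sum_cmult_right[OF diag, of "-1"]] by simp
  define g where "g a = w a * real (N a) powr \<eta>" for a
  have "(\<lambda>a. norm (g a)) summable_on A"
    by (rule summable_on_cong[THEN iffD2, OF _ has_sum_imp_summable[OF sm]]) (use w in \<open>auto simp: g_def\<close>)
  hence "((\<lambda>(a, b). g a * g b) has_sum (W * W)) (A \<times> A)"
    using sm by (intro has_sum_mult_Times(1)) (simp_all add: g_def)
  from has_sum_cmult_right[OF this, of "\<phi> powr (-\<eta>)"]
  have major: "((\<lambda>x. \<phi> powr (-\<eta>) * (case x of (a, b) \<Rightarrow> g a * g b)) has_sum (\<phi> powr (-\<eta>) * (W * W))) (A \<times> A)" .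
  have "norm (complex_of_real M - of_real D) \<le> \<phi> powr (-\<eta>) * (W * W)"
  proof (rule norm_infsum_le[OF diff major], clarify)
    fix a b assume ab: "a \<in> A" "b \<in> A"
    have g0: "0 \<le> g a * g b" using ab w by (simp add: g_def)
    show "norm ((of_real (w a * w b) * (F a b / of_real \<phi>)) - (if a = b then of_real (w a * w b) else 0))
       \<le> \<phi> powr (-\<eta>) * (g a * g b)"
    proof (cases "a = b")
      case True
      have "F a b = of_real \<phi>"
        unfolding F_def \<phi>_def True using sum_primitive_characters_diagonal[OF cop[OF ab(2)]] by simp
      thus ?thesis using True g0 \<phi> by simp
    next
      case False
      have ne: "N a \<noteq> N b" using False ab inj by (auto simp: inj_on_def)
      define t where "t = real (N a) * real (N b)"
      have t: "t \<ge> 1" unfolding t_def using N[OF ab(1)] N[OF ab(2)]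
        using mult_mono[of 1 "real (N a)" 1 "real (N b)"] by simp
      have F1: "norm (F a b) \<le> \<phi>"
        unfolding F_def \<phi>_def by (rule norm_sum_primitive_characters_le_phi_star)
      have F2: "norm (F a b) \<le> t"
      proof -
        have "norm (F a b) \<le> \<bar>of_int (int (N a) - int (N b))\<bar>"
          unfolding F_def using cop ab ne q by (intro norm_sum_primitive_characters_le) auto
        also have "\<dots> \<le> max (real (N a)) (real (N b))" by auto
        also have "\<dots> \<le> t"
          unfolding t_def using N[OF ab(1)] N[OF ab(2)]
            mult_left_mono[of 1 "real (N b)" "real (N a)"] mult_right_mono[of 1 "real (N a)" "real (N b)"] by auto
        finally show ?thesis .
      qed
      have "norm (F a b) / \<phi> \<le> (t / \<phi>) powr \<eta>"
      proof (cases "t \<le> \<phi>")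
        case True
        have "norm (F a b) / \<phi> \<le> (t / \<phi>) powr 1" using F2 \<phi> t by (simp add: divide_right_mono)
        also have "\<dots> \<le> (t / \<phi>) powr \<eta>" using True t \<phi> \<eta> by (intro powr_mono') auto
        finally show ?thesis .
      next
        case False
        have "norm (F a b) / \<phi> \<le> 1" using F1 \<phi> by simp
        also have "\<dots> \<le> (t / \<phi>) powr \<eta>" using False \<phi> \<eta> by (intro ge_one_powr_ge_zero) auto
        finally show ?thesis .
      qed
      also have "\<dots> = \<phi> powr (-\<eta>) * (real (N a) powr \<eta> * real (N b) powr \<eta>)"
        using \<phi> by (simp add: t_def powr_divide powr_mult powr_minus field_simps)
      finally have "w a * w b * (norm (F a b) / \<phi>) \<le>
          w a * w b * (\<phi> powr (-\<eta>) * (real (N a) powr \<eta> * real (N b) powr \<eta>))"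
        using ab w by (intro mult_left_mono) auto
      thus ?thesis using False ab w \<phi> by (simp add: norm_mult norm_divide g_def mult_ac)
    qed
  qed
  also have "norm (complex_of_real M - of_real D) = \<bar>M - D\<bar>"
    by (metis norm_of_real of_real_diff)
  finally have "\<bar>M - D\<bar> \<le> \<phi> powr (-\<eta>) * (W * W)" .
  thus ?thesis unfolding M_def D_def \<phi>_def f_def power2_eq_square[of W] by simp
qed

section \<open>The moment as an Euler product\<close>

text \<open>The power \<open>k\<close> is taken inside the exponential:
  \<open>cmod (exp S) powr (2 * k)\<close> is the square of \<open>cmod (exp (k * S))\<close>, so no
  branch of a complex power is involved for real \<open>k\<close>. Primes dividing \<open>q\<close>
  drop out because \<open>chi\<close> vanishes at them.\<close>

lemma P_X_eq_prod:
  assumes chi: "dirichlet_character q chi" and X: "X \<ge> 0"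
  defines "N \<equiv> nat \<lfloor>X\<rfloor>"
  shows "cmod (P_X X chi) powr (2 * k) =
    (cmod (\<Prod>p | prime p \<and> p \<le> N \<and> \<not> p dvd q.
      exp (of_real k * (\<Sum>j=1..max_exponent N p. (chi (int p) * of_real (real p powr (-1/2))) ^ j / of_nat j))))\<^sup>2"
proof -
  define x where "x p = chi (int p) * of_real (real p powr (-1/2))" for p
  define S where "S = (\<Sum>n | 2 \<le> n \<and> real n \<le> X. mangoldt n * chi (int n) / of_real (real n powr (1/2) * ln (real n)))"
  have set: "{n. 2 \<le> n \<and> real n \<le> X} = {2..N}"
    using X unfolding N_def by (auto simp: le_nat_floor le_nat_iff le_floor_iff)
  have "S = (\<Sum>n\<in>{2..N}. mangoldt n / of_real (ln (real n)) * (chi (int n) * of_real (real n powr (-1/2))))"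
    unfolding S_def set by (intro sum.cong refl) (simp add: powr_minus divide_simps)
  also have "\<dots> = (\<Sum>p\<in>primes_upto N. \<Sum>j=1..max_exponent N p.
      chi (int (p ^ j)) * of_real (real (p ^ j) powr (-1/2)) / of_nat j)"
    by (rule sum_mangoldt_eq_sum_primes)
  also have "\<dots> = (\<Sum>p\<in>primes_upto N. \<Sum>j=1..max_exponent N p. x p ^ j / of_nat j)"
  proof (intro sum.cong refl)
    fix p j
    show "chi (int (p ^ j)) * of_real (real (p ^ j) powr (-1/2)) / of_nat j = x p ^ j / of_nat j"
      unfolding x_def powr_nat_power by (simp add: power_mult_distrib dirichlet_character_power[OF chi])
  qed
  also have "\<dots> = (\<Sum>p | prime p \<and> p \<le> N \<and> \<not> p dvd q. \<Sum>j=1..max_exponent N p. x p ^ j / of_nat j)"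
  proof (rule sum.mono_neutral_right)
    show "\<forall>p\<in>primes_upto N - {p. prime p \<and> p \<le> N \<and> \<not> p dvd q}. (\<Sum>j=1..max_exponent N p. x p ^ j / of_nat j) = 0"
    proof
      fix p assume "p \<in> primes_upto N - {p. prime p \<and> p \<le> N \<and> \<not> p dvd q}"
      hence p: "prime p" "p dvd q" by auto
      hence "\<not> coprime (int p) (int q)" using coprime_common_divisor_nat[of p q p] by (auto simp: prime_nat_iff)
      hence "x p = 0" using dirichlet_character_eq_0_iff[OF chi] by (simp add: x_def)
      thus "(\<Sum>j=1..max_exponent N p. x p ^ j / of_nat j) = 0" by (intro sum.neutral) auto
    qed
  qed auto
  finally have S: "S = (\<Sum>p | prime p \<and> p \<le> N \<and> \<not> p dvd q. \<Sum>j=1..max_exponent N p. x p ^ j / of_nat j)" .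
  have fin: "finite {p. prime p \<and> p \<le> N \<and> \<not> p dvd q}"
    by (rule finite_subset[OF _ finite_primes_le[of N]]) auto
  have "cmod (P_X X chi) powr (2 * k) = exp (Re S) powr (2 * k)"
    unfolding P_X_def S_def [symmetric] by simp
  also have "\<dots> = exp (2 * (k * Re S))" by (simp add: powr_def mult_ac)
  also have "\<dots> = (cmod (exp (of_real k * S)))\<^sup>2"
    by (simp add: exp_double)
  also have "exp (of_real k * S) = (\<Prod>p | prime p \<and> p \<le> N \<and> \<not> p dvd q.
      exp (of_real k * (\<Sum>j=1..max_exponent N p. x p ^ j / of_nat j)))"
    unfolding S sum_distrib_left[of "of_real k"] by (rule exp_sum[OF fin])
  finally show ?thesis by (simp only: x_def)
qed

text \<open>\<open>mangoldt n \<le> ln n\<close> passes from prime powers to all \<open>n\<close>;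
  then \<open>n powr \<eta> \<le> N powr \<eta>\<close>, and the sum of \<open>1 / sqrt n\<close> is
  at most \<open>2 * sqrt N\<close> by telescoping.\<close>

lemma prime_power_sum_bound:
  assumes \<eta>: "0 \<le> \<eta>" "\<eta> < 1/2"
  shows "(\<Sum>p\<in>primes_upto N. \<Sum>j=1..max_exponent N p. (real p powr (\<eta> - 1/2)) ^ j / real j)
    \<le> 2 * real N powr (1/2 + \<eta>)"
proof -
  have "(\<Sum>p\<in>primes_upto N. \<Sum>j=1..max_exponent N p. (real p powr (\<eta> - 1/2)) ^ j / real j) =
        (\<Sum>p\<in>primes_upto N. \<Sum>j=1..max_exponent N p. real (p ^ j) powr (\<eta> - 1/2) / real j)"
    unfolding powr_nat_power ..
  also have "\<dots> = (\<Sum>n\<in>{2..N}. mangoldt n / ln (real n) * real n powr (\<eta> - 1/2))"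
    using sum_mangoldt_eq_sum_primes[of "\<lambda>n. real n powr (\<eta> - 1/2)" N] by simp
  also have "\<dots> \<le> (\<Sum>n\<in>{2..N}. 1 * (real N powr \<eta> * real n powr (-1/2)))"
  proof (intro sum_mono mult_mono)
    fix n assume n: "n \<in> {2..N}"
    have "ln (real n) > 0" using n by simp
    thus "mangoldt n / ln (real n) \<le> 1" using mangoldt_le[of n] n by simp
    have "real n powr (\<eta> - 1/2) = real n powr \<eta> * real n powr (-1/2)" by (simp flip: powr_add)
    also have "\<dots> \<le> real N powr \<eta> * real n powr (-1/2)"
      using n \<eta> by (intro mult_right_mono powr_mono2) auto
    finally show "real n powr (\<eta> - 1/2) \<le> real N powr \<eta> * real n powr (-1/2)" .
  qed auto
  also have "\<dots> = real N powr \<eta> * (\<Sum>n\<in>{2..N}. real n powr (-1/2))"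
    by (simp add: sum_distrib_left)
  also have "(\<Sum>n\<in>{2..N}. real n powr (-1/2)) \<le> (\<Sum>n\<in>{1..N}. 1 / sqrt (real n))"
    by (rule order_trans[OF _ sum_mono2[of _ "{2..N}"]])
       (auto intro!: sum_mono simp: powr_minus_divide powr_half_sqrt)
  also have "\<dots> \<le> 2 * sqrt (real N)"
  proof (induction N)
    case (Suc N)
    have "1 / sqrt (real (Suc N)) \<le> 2 * (sqrt (real (Suc N)) - sqrt (real N))"
    proof -
      have "(sqrt (real (Suc N)) - sqrt (real N)) * (sqrt (real (Suc N)) + sqrt (real N)) = 1"
        by (simp add: algebra_simps)
      moreover have "(sqrt (real (Suc N)) - sqrt (real N)) * (sqrt (real (Suc N)) + sqrt (real N)) \<le>
          (sqrt (real (Suc N)) - sqrt (real N)) * (2 * sqrt (real (Suc N)))"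
        by (intro mult_left_mono) auto
      ultimately have "1 \<le> 2 * (sqrt (real (Suc N)) - sqrt (real N)) * sqrt (real (Suc N))"
        by (simp only: mult_ac)
      moreover have "sqrt (real (Suc N)) > 0" by simp
      ultimately show ?thesis by (subst pos_divide_le_eq)
    qed
    thus ?case using Suc by simp
  qed simp
  also have "real N powr \<eta> * (2 * sqrt (real N)) = 2 * real N powr (1/2 + \<eta>)"
    by (simp add: powr_add powr_half_sqrt)
  finally show ?thesis by (simp add: mult_left_mono)
qed

lemma dirichlet_character_prime_power_prod:
  assumes chi: "dirichlet_character q chi" and P: "finite P"
  shows "chi (int (prime_power_prod P e)) = (\<Prod>p\<in>P. chi (int p) ^ e p)"
  using P unfolding prime_power_prod_def
proof (induction P)
  case empty
  show ?case using dirichlet_character_1[OF chi] by simp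
next
  case (insert p P)
  thus ?case by (simp add: dirichlet_character_mult[OF chi] dirichlet_character_power[OF chi])
qed

lemma trunc_coeff_squares_summable:
  assumes k: "k \<ge> 0" and p: "prime p"
  shows "summable (\<lambda>m. (d_primepow k m)\<^sup>2 / real p ^ m)"
    and "summable (\<lambda>m. (trunc_coeff k J m)\<^sup>2 / real p ^ m)"
proof -
  have p1: "real p > 1" using prime_gt_1_nat[OF p] by simp
  have "summable (\<lambda>m. (d_primepow k m)\<^sup>2 * (1 / real p) ^ m)"
    using p1 by (intro summable_d_primepow k) auto
  thus sm: "summable (\<lambda>m. (d_primepow k m)\<^sup>2 / real p ^ m)" by (simp add: power_one_over)
  show "summable (\<lambda>m. (trunc_coeff k J m)\<^sup>2 / real p ^ m)"
  proof (rule summable_comparison_test'[OF sm])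
    show "norm ((trunc_coeff k J m)\<^sup>2 / real p ^ m) \<le> (d_primepow k m)\<^sup>2 / real p ^ m" for m
      using trunc_coeff_nonneg[OF k, of J m] trunc_coeff_le[OF k, of J m]
      by (simp add: divide_right_mono power_mono)
  qed
qed

text \<open>The local factor of the diagonal as \<open>P_X\<close> produces it: only the powers
  \<open>p ^ j \<le> N\<close> enter the exponent.\<close>

definition trunc_factor :: "real \<Rightarrow> nat \<Rightarrow> nat \<Rightarrow> real" where
  "trunc_factor k N p = (\<Sum>m. (trunc_coeff k (max_exponent N p) m)\<^sup>2 / real p ^ m)"

lemma trunc_factor_ge_1:
  assumes "k \<ge> 0" "prime p"
  shows "trunc_factor k N p \<ge> 1"
proof -
  have "(\<Sum>m\<in>{0}. (trunc_coeff k (max_exponent N p) m)\<^sup>2 / real p ^ m) \<le> trunc_factor k N p"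
    unfolding trunc_factor_def by (intro sum_le_suminf trunc_coeff_squares_summable assms) auto
  thus ?thesis by simp
qed

lemma trunc_factor_le_local_factor:
  assumes "k \<ge> 0" "prime p"
  shows "trunc_factor k N p \<le> local_factor k p"
  unfolding trunc_factor_def local_factor_def
  using trunc_coeff_nonneg[OF assms(1)] trunc_coeff_le[OF assms(1)]
  by (intro suminf_le trunc_coeff_squares_summable assms allI divide_right_mono power_mono) auto

lemma local_factor_minus_trunc_factor_le:
  assumes k: "k \<ge> 0" and p: "prime p"
  shows "local_factor k p - trunc_factor k N p \<le>
    (prime_power_tail (\<lambda>m. (d_primepow k m)\<^sup>2) N p)"
proof -
  let ?J = "max_exponent N p"
  note sm = trunc_coeff_squares_summable[OF k p]
  have "(\<Sum>m<Suc ?J. (d_primepow k m)\<^sup>2 / real p ^ m) = (\<Sum>m<Suc ?J. (trunc_coeff k ?J m)\<^sup>2 / real p ^ m)"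
    by (intro sum.cong refl) (simp add: trunc_coeff_eq)
  also have "\<dots> \<le> trunc_factor k N p"
    unfolding trunc_factor_def by (intro sum_le_suminf sm) auto
  finally show ?thesis
    unfolding local_factor_def using suminf_split_initial_segment[OF sm(1), of "Suc ?J"] by simp
qed

lemma primitive_moment_approx:
  assumes k: "k \<ge> 0" and X: "X \<ge> 0" and q: "q > 0" and pos: "phi_star q > 0" and \<eta>: "0 < \<eta>" "\<eta> < 1/2"
  defines "N \<equiv> nat \<lfloor>X\<rfloor>"
  shows "\<bar>primitive_moment k X q - (\<Prod>p | prime p \<and> p \<le> N \<and> \<not> p dvd q. trunc_factor k N p)\<bar>
    \<le> real (phi_star q) powr (-\<eta>) * exp (4 * k * real N powr (1/2 + \<eta>))"
proof -
  define P where "P = {p. prime p \<and> p \<le> N \<and> \<not> p dvd q}"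
  have fin: "finite P" unfolding P_def by (rule finite_subset[OF _ finite_primes_le[of N]]) auto
  have pr: "prime p" if "p \<in> P" for p using that by (simp add: P_def)
  define b where "b p m = trunc_coeff k (max_exponent N p) m" for p m
  have b0: "b p m \<ge> 0" for p m unfolding b_def by (rule trunc_coeff_nonneg[OF k])
  define y where "y p = real p powr (-1/2)" for p
  have y: "0 < y p" "y p < 1" if "p \<in> P" for p
    unfolding y_def using prime_powr_less_1[OF pr[OF that], of "1/2"] by auto
  define A where "A = PiE P (\<lambda>_. UNIV :: nat set)"
  \<comment> \<open>The coefficient of \<open>chi n\<close> for \<open>n = Q e\<close>; the factors
    \<open>y p ^ e p\<close> multiply to \<open>n powr (-1/2)\<close>.\<close>
  define w where "w e = (\<Prod>p\<in>P. b p (e p) * y p ^ e p)" for e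
  define Q where "Q = prime_power_prod P"
  \<comment> \<open>Closed form of the sum of \<open>w e * Q e powr \<eta>\<close>: the weight
    shifts the exponent from \<open>-1/2\<close> to \<open>\<eta> - 1/2\<close>, which is still
    negative, so the series of each local factor converges.\<close>
  define W where "W = (\<Prod>p\<in>P. exp (k * (\<Sum>j=1..max_exponent N p. (real p powr (\<eta> - 1/2)) ^ j / real j)))"
  have W_sum: "((\<lambda>e. w e * real (Q e) powr \<eta>) has_sum W) A"
  proof -
    have hs: "((\<lambda>m. b p m * (real p powr (\<eta> - 1/2)) ^ m) has_sum
        exp (k * (\<Sum>j=1..max_exponent N p. (real p powr (\<eta> - 1/2)) ^ j / real j))) UNIV" if p: "p \<in> P" for p
    proof (rule norm_summable_imp_has_sum)
      have lt: "real p powr (\<eta> - 1/2) < 1" using prime_powr_less_1[OF pr[OF p], of "1/2 - \<eta>"] \<eta> by simp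
      show "(\<lambda>m. b p m * (real p powr (\<eta> - 1/2)) ^ m) sums
        exp (k * (\<Sum>j=1..max_exponent N p. (real p powr (\<eta> - 1/2)) ^ j / real j))"
        unfolding b_def using lt by (intro trunc_coeff_sums_real k) auto
      show "summable (\<lambda>m. norm (b p m * (real p powr (\<eta> - 1/2)) ^ m))"
        using summable_trunc_coeff[OF k _ lt, of "max_exponent N p"] b0 by (simp add: abs_mult b_def[symmetric])
    qed
    have "((\<lambda>e. \<Prod>p\<in>P. b p (e p) * (real p powr (\<eta> - 1/2)) ^ e p) has_sum
      (\<Prod>p\<in>P. infsum (\<lambda>m. b p m * (real p powr (\<eta> - 1/2)) ^ m) UNIV)) A"
      unfolding A_def
    proof (rule prod_PiE_has_sum[OF fin])
      fix p assume p: "p \<in> P"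
      show "(\<lambda>m. b p m * (real p powr (\<eta> - 1/2)) ^ m) summable_on UNIV"
        using hs[OF p] by (rule has_sum_imp_summable)
      show "infsum (\<lambda>m. b p m * (real p powr (\<eta> - 1/2)) ^ m) UNIV > 0"
        using infsumI[OF hs[OF p]] by simp
    qed (use b0 in auto)
    also have "(\<Prod>p\<in>P. infsum (\<lambda>m. b p m * (real p powr (\<eta> - 1/2)) ^ m) UNIV) = W"
      unfolding W_def using infsumI[OF hs] by (intro prod.cong) auto
    also have "(\<lambda>e. \<Prod>p\<in>P. b p (e p) * (real p powr (\<eta> - 1/2)) ^ e p) = (\<lambda>e. w e * real (Q e) powr \<eta>)"
    proof
      fix e
      have "w e * real (Q e) powr \<eta> = (\<Prod>p\<in>P. b p (e p) * y p ^ e p * (real p powr \<eta>) ^ e p)"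
        unfolding w_def Q_def prime_power_prod_powr by (simp add: prod.distrib)
      also have "\<dots> = (\<Prod>p\<in>P. b p (e p) * (real p powr (\<eta> - 1/2)) ^ e p)"
      proof (intro prod.cong refl)
        fix p assume "p \<in> P"
        have "y p * real p powr \<eta> = real p powr (\<eta> - 1/2)" by (simp add: y_def flip: powr_add)
        thus "b p (e p) * y p ^ e p * (real p powr \<eta>) ^ e p = b p (e p) * (real p powr (\<eta> - 1/2)) ^ e p"
          by (metis mult.assoc power_mult_distrib)
      qed
      finally show "(\<Prod>p\<in>P. b p (e p) * (real p powr (\<eta> - 1/2)) ^ e p) = w e * real (Q e) powr \<eta>" ..
    qed
    finally show ?thesis .
  qed
  have diag: "(\<Sum>\<^sub>\<infinity>e\<in>A. (w e)\<^sup>2) = (\<Prod>p\<in>P. trunc_factor k N p)"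
  proof -
    have hs: "((\<lambda>m. (b p m)\<^sup>2 / real p ^ m) has_sum trunc_factor k N p) UNIV" if p: "p \<in> P" for p
    proof (rule norm_summable_imp_has_sum)
      show "(\<lambda>m. (b p m)\<^sup>2 / real p ^ m) sums trunc_factor k N p"
        unfolding b_def trunc_factor_def by (intro summable_sums trunc_coeff_squares_summable k pr p)
      show "summable (\<lambda>m. norm ((b p m)\<^sup>2 / real p ^ m))"
        using trunc_coeff_squares_summable(2)[OF k pr[OF p], of "max_exponent N p"] by (simp add: b_def)
    qed
    have "((\<lambda>e. \<Prod>p\<in>P. (b p (e p))\<^sup>2 / real p ^ e p) has_sum
      (\<Prod>p\<in>P. infsum (\<lambda>m. (b p m)\<^sup>2 / real p ^ m) UNIV)) A"
      unfolding A_def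
    proof (rule prod_PiE_has_sum[OF fin])
      fix p assume p: "p \<in> P"
      show "(\<lambda>m. (b p m)\<^sup>2 / real p ^ m) summable_on UNIV" using hs[OF p] by (rule has_sum_imp_summable)
      show "infsum (\<lambda>m. (b p m)\<^sup>2 / real p ^ m) UNIV > 0"
        using infsumI[OF hs[OF p]] trunc_factor_ge_1[OF k pr[OF p], of N] by simp
    qed auto
    also have "(\<lambda>e. \<Prod>p\<in>P. (b p (e p))\<^sup>2 / real p ^ e p) = (\<lambda>e. (w e)\<^sup>2)"
    proof
      fix e
      have "(w e)\<^sup>2 = (\<Prod>p\<in>P. (b p (e p) * y p ^ e p)\<^sup>2)" unfolding w_def by (rule prod_power_distrib)
      also have "\<dots> = (\<Prod>p\<in>P. (b p (e p))\<^sup>2 / real p ^ e p)"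
      proof (intro prod.cong refl)
        fix p assume "p \<in> P"
        hence "real p > 0" using pr prime_gt_0_nat by auto
        hence "(y p)\<^sup>2 = 1 / real p"
          by (simp add: y_def power2_eq_square powr_minus_divide flip: powr_add)
        hence "(y p ^ e p)\<^sup>2 = 1 / real p ^ e p"
          by (metis mult.commute power_mult power_one_over)
        thus "(b p (e p) * y p ^ e p)\<^sup>2 = (b p (e p))\<^sup>2 / real p ^ e p"
          by (simp add: power_mult_distrib)
      qed
      finally show "(\<Prod>p\<in>P. (b p (e p))\<^sup>2 / real p ^ e p) = (w e)\<^sup>2" ..
    qed
    finally have "infsum (\<lambda>e. (w e)\<^sup>2) A = (\<Prod>p\<in>P. infsum (\<lambda>m. (b p m)\<^sup>2 / real p ^ m) UNIV)"
      by (rule infsumI)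
    also have "\<dots> = (\<Prod>p\<in>P. trunc_factor k N p)"
      using infsumI[OF hs] by (intro prod.cong) auto
    finally show ?thesis .
  qed
  have expand: "cmod (P_X X chi) powr (2 * k) = (cmod (\<Sum>\<^sub>\<infinity>e\<in>A. of_real (w e) * chi (int (Q e))))\<^sup>2"
    if "primitive_character q chi" for chi
  proof -
    have chi: "dirichlet_character q chi" using that by (simp add: primitive_character_def)
    define x where "x p = chi (int p) * of_real (real p powr (-1/2))" for p
    have x: "norm (x p) < 1" if "p \<in> P" for p
      using norm_dirichlet_character[OF chi, of "int p"] y[OF that] by (simp add: x_def y_def norm_mult)
    have hs: "((\<lambda>m. of_real (b p m) * x p ^ m) has_sum
        exp (of_real k * (\<Sum>j=1..max_exponent N p. x p ^ j / of_nat j))) UNIV"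
      "(\<lambda>m. norm (of_real (b p m) * x p ^ m)) summable_on UNIV" if p: "p \<in> P" for p
    proof -
      have sm: "summable (\<lambda>m. norm (of_real (b p m) * x p ^ m))"
        using summable_trunc_coeff[OF k norm_ge_zero x[OF p], of "max_exponent N p"] b0
        by (simp add: norm_mult norm_power b_def[symmetric])
      show "((\<lambda>m. of_real (b p m) * x p ^ m) has_sum
        exp (of_real k * (\<Sum>j=1..max_exponent N p. x p ^ j / of_nat j))) UNIV"
        using sm by (rule norm_summable_imp_has_sum) (unfold b_def, rule trunc_coeff_sums_complex[OF k x[OF p]])
      show "(\<lambda>m. norm (of_real (b p m) * x p ^ m)) summable_on UNIV"
        using sm by (intro norm_summable_imp_summable_on) simp
    qed
    have "(\<Prod>p\<in>P. exp (of_real k * (\<Sum>j=1..max_exponent N p. x p ^ j / of_nat j))) =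
          (\<Prod>p\<in>P. infsum (\<lambda>m. of_real (b p m) * x p ^ m) UNIV)"
      using infsumI[OF hs(1)] by (intro prod.cong) auto
    also have "\<dots> = (\<Sum>\<^sub>\<infinity>e\<in>A. \<Prod>p\<in>P. of_real (b p (e p)) * x p ^ e p)"
      unfolding A_def by (rule infsum_prod_PiE_abs[OF fin, symmetric]) (rule hs(2))
    also have "\<dots> = (\<Sum>\<^sub>\<infinity>e\<in>A. of_real (w e) * chi (int (Q e)))"
      by (intro infsum_cong)
         (simp add: w_def Q_def x_def y_def dirichlet_character_prime_power_prod[OF chi fin]
            power_mult_distrib mult_ac flip: prod.distrib)
    finally show ?thesis
      unfolding P_X_eq_prod[OF chi X] N_def[symmetric] P_def[symmetric] x_def by simp
  qed
  have cop: "coprime (int (Q e)) (int q)" if "e \<in> A" for e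
  proof -
    have "coprime (Q e) q"
      unfolding Q_def prime_power_prod_def
    proof (rule prod_coprime_left)
      fix p assume "p \<in> P"
      hence "coprime p q" by (simp add: P_def prime_imp_coprime)
      thus "coprime (p ^ e p) q" by simp
    qed
    thus ?thesis by simp
  qed
  have "\<bar>1 / real (phi_star q) * (\<Sum>chi | primitive_character q chi.
            (cmod (\<Sum>\<^sub>\<infinity>e\<in>A. of_real (w e) * chi (int (Q e))))\<^sup>2) - (\<Sum>\<^sub>\<infinity>e\<in>A. (w e)\<^sup>2)\<bar>
         \<le> real (phi_star q) powr (-\<eta>) * W\<^sup>2"
  proof (rule primitive_mean_value[OF q pos])
    show "0 \<le> w e" for e unfolding w_def using b0 y by (intro prod_nonneg mult_nonneg_nonneg) (auto simp: less_imp_le)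
    show "inj_on Q A" unfolding Q_def A_def using pr by (intro inj_on_prime_power_prod fin)
    show "Q e \<ge> 1" for e unfolding Q_def using prime_power_prod_pos[OF pr] by (simp add: Suc_le_eq)
  qed (use cop \<eta> W_sum in auto)
  moreover have "primitive_moment k X q = 1 / real (phi_star q) * (\<Sum>chi | primitive_character q chi.
            (cmod (\<Sum>\<^sub>\<infinity>e\<in>A. of_real (w e) * chi (int (Q e))))\<^sup>2)"
    unfolding primitive_moment_def using expand by simp
  moreover have "W\<^sup>2 \<le> exp (4 * k * real N powr (1/2 + \<eta>))"
  proof -
    have "W = exp (k * (\<Sum>p\<in>P. \<Sum>j=1..max_exponent N p. (real p powr (\<eta> - 1/2)) ^ j / real j))"
      unfolding W_def by (simp add: exp_sum[OF fin] sum_distrib_left[of k])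
    also have "\<dots> \<le> exp (k * (2 * real N powr (1/2 + \<eta>)))"
    proof (intro iffD2[OF exp_le_cancel_iff] mult_left_mono k)
      have "(\<Sum>p\<in>P. \<Sum>j=1..max_exponent N p. (real p powr (\<eta> - 1/2)) ^ j / real j) \<le>
        (\<Sum>p\<in>primes_upto N. \<Sum>j=1..max_exponent N p. (real p powr (\<eta> - 1/2)) ^ j / real j)"
        by (intro sum_mono2) (auto simp: P_def intro!: sum_nonneg)
      also have "\<dots> \<le> 2 * real N powr (1/2 + \<eta>)"
        using \<eta> by (intro prime_power_sum_bound) auto
      finally show "(\<Sum>p\<in>P. \<Sum>j=1..max_exponent N p. (real p powr (\<eta> - 1/2)) ^ j / real j)
        \<le> 2 * real N powr (1/2 + \<eta>)" .
    qed
    finally have "W\<^sup>2 \<le> (exp (k * (2 * real N powr (1/2 + \<eta>))))\<^sup>2"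
      unfolding W_def by (intro power_mono prod_nonneg) auto
    also have "\<dots> = exp (4 * k * real N powr (1/2 + \<eta>))" by (simp flip: exp_double)
    finally show ?thesis .
  qed
  hence "real (phi_star q) powr (-\<eta>) * W\<^sup>2 \<le> real (phi_star q) powr (-\<eta>) * exp (4 * k * real N powr (1/2 + \<eta>))"
    by (intro mult_left_mono) auto
  ultimately show ?thesis unfolding diag P_def by linarith
qed

text \<open>Each ratio lies in \<open>[0, 1]\<close> and, as
  \<open>local_factor k p \<ge> 1\<close>, differs from 1 by at most the prime power tail. The
  Weierstrass inequality turns the sum of these defects into a bound for the product, uniformly in
  \<open>P\<close> and hence in \<open>q\<close>.\<close>

lemma trunc_factor_prod_ratio:
  assumes k: "k \<ge> 0"
  obtains K where "\<And>N P. P \<subseteq> primes_upto N \<Longrightarrow>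
      1 - K * real N powr (-1/4) \<le> (\<Prod>p\<in>P. trunc_factor k N p) / (\<Prod>p\<in>P. local_factor k p) \<and>
      (\<Prod>p\<in>P. trunc_factor k N p) / (\<Prod>p\<in>P. local_factor k p) \<le> 1"
proof -
  have sm: "summable (\<lambda>m. (d_primepow k m)\<^sup>2 * (2 powr (-3/4)) ^ m)"
    by (intro summable_d_primepow k) (auto simp: powr_less_one)
  have nn: "(d_primepow k m)\<^sup>2 \<ge> 0" for m by simp
  obtain K where "K \<ge> 0" and smt: "\<And>(N::nat) (p::nat). prime p \<Longrightarrow> p \<le> N \<Longrightarrow>
      summable (\<lambda>m. (d_primepow k (m + Suc (max_exponent N p)))\<^sup>2 / real p ^ (m + Suc (max_exponent N p)))"
    and K: "\<And>(N::nat). (\<Sum>p\<in>primes_upto N. prime_power_tail (\<lambda>m. (d_primepow k m)\<^sup>2) N p)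
       \<le> K * real N powr (-1/4)"
    by (rule prime_power_tail_bound[OF nn sm]) (rule that)
  show ?thesis
  proof (rule that, rule conjI)
    fix N :: nat and P assume P: "P \<subseteq> primes_upto N"
    have fin: "finite P" by (rule finite_subset[OF P finite_primes_le])
    define r where "r p = trunc_factor k N p / local_factor k p" for p
    have tf: "trunc_factor k N p \<ge> 1" "trunc_factor k N p \<le> local_factor k p" if "p \<in> P" for p
      using that P trunc_factor_ge_1[OF k, of p N] trunc_factor_le_local_factor[OF k, of p N] by auto
    have r: "r p \<ge> 0" "r p \<le> 1" if "p \<in> P" for p
      using tf[OF that] by (auto simp: r_def divide_le_eq_1)
    have prod_r: "(\<Prod>p\<in>P. trunc_factor k N p) / (\<Prod>p\<in>P. local_factor k p) = (\<Prod>p\<in>P. r p)"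
      unfolding r_def by (rule prod_dividef [symmetric])
    show "(\<Prod>p\<in>P. trunc_factor k N p) / (\<Prod>p\<in>P. local_factor k p) \<le> 1"
      unfolding prod_r using r by (intro prod_le_1) auto
    have "(\<Sum>p\<in>P. 1 - r p) \<le> (\<Sum>p\<in>P. prime_power_tail (\<lambda>m. (d_primepow k m)\<^sup>2) N p)"
    proof (intro sum_mono)
      fix p assume p: "p \<in> P"
      have "1 - r p = (local_factor k p - trunc_factor k N p) / local_factor k p"
        using tf[OF p] by (simp add: r_def field_simps)
      also have "\<dots> \<le> local_factor k p - trunc_factor k N p"
        using tf[OF p] by (simp add: divide_le_eq mult_le_cancel_left1)
      also have "\<dots> \<le> (prime_power_tail (\<lambda>m. (d_primepow k m)\<^sup>2) N p)"
        using p P by (intro local_factor_minus_trunc_factor_le k) auto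
      finally show "1 - r p \<le> (prime_power_tail (\<lambda>m. (d_primepow k m)\<^sup>2) N p)" .
    qed
    also have "\<dots> \<le> (\<Sum>p\<in>primes_upto N. prime_power_tail (\<lambda>m. (d_primepow k m)\<^sup>2) N p)"
      using P smt by (intro sum_mono2 suminf_nonneg) auto
    also have "\<dots> \<le> K * real N powr (-1/4)" by (rule K)
    finally have "(\<Sum>p\<in>P. 1 - r p) \<le> K * real N powr (-1/4)" .
    moreover have "1 - (\<Sum>p\<in>P. 1 - r p) \<le> (\<Prod>p\<in>P. 1 - (1 - r p))"
      using r by (intro Weierstrass_prod_ineq) auto
    ultimately show "1 - K * real N powr (-1/4) \<le> (\<Prod>p\<in>P. trunc_factor k N p) / (\<Prod>p\<in>P. local_factor k p)"
      unfolding prod_r by simp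
  qed
qed


section \<open>Asymptotics\<close>

text \<open>The exponents 0 and 1 give \<open>1 + k^2 / p\<close>. From the others
  \<open>1 / p^2\<close> splits off, and what remains is largest at \<open>p = 2\<close>, where it
  is \<open>C\<close>.\<close>

lemma local_factor_expansion:
  assumes k: "k \<ge> 0"
  obtains C where "C \<ge> 0"
    "\<And>p. prime p \<Longrightarrow> 1 + k\<^sup>2 / real p \<le> local_factor k p"
    "\<And>p. prime p \<Longrightarrow> local_factor k p \<le> 1 + k\<^sup>2 / real p + C / real p ^ 2"
proof -
  define C where "C = (\<Sum>m. (d_primepow k (m + 2))\<^sup>2 * (1/2) ^ m)"
  have sm: "summable (\<lambda>m. (d_primepow k (m + 2))\<^sup>2 * (1/2) ^ m)"
  proof -
    have "summable (\<lambda>m. (d_primepow k m)\<^sup>2 * (1/2) ^ m)" by (intro summable_d_primepow k) auto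
    hence "summable (\<lambda>m. (d_primepow k (m + 2))\<^sup>2 * (1/2) ^ (m + 2))"
      by (rule summable_ignore_initial_segment)
    from summable_mult[OF this, of 4] show ?thesis by (simp add: power_add mult_ac)
  qed
  have C0: "C \<ge> 0" unfolding C_def by (intro suminf_nonneg sm) auto
  have eq: "local_factor k p = (\<Sum>m. (d_primepow k (m + 2))\<^sup>2 / real p ^ (m + 2)) + (1 + k\<^sup>2 / real p)"
    if p: "prime p" for p
    unfolding local_factor_def
    using suminf_split_initial_segment[OF trunc_coeff_squares_summable(1)[OF k p], of 2]
    by (simp add: eval_nat_numeral d_primepow_Suc)
  have smp: "summable (\<lambda>m. (d_primepow k (m + 2))\<^sup>2 / real p ^ (m + 2))" if p: "prime p" for p
    using trunc_coeff_squares_summable(1)[OF k p] by (rule summable_ignore_initial_segment)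
  have "(\<Sum>m. (d_primepow k (m + 2))\<^sup>2 / real p ^ (m + 2)) \<le> C / real p ^ 2" if p: "prime p" for p
  proof -
    have p2: "real p \<ge> 2" using prime_ge_2_nat[OF p] by simp
    have "(\<Sum>m. (d_primepow k (m + 2))\<^sup>2 / real p ^ (m + 2)) \<le>
          (\<Sum>m. (d_primepow k (m + 2))\<^sup>2 * (1/2) ^ m / real p ^ 2)"
    proof (intro suminf_le smp p summable_divide sm)
      fix m
      have "(1 / real p) ^ m \<le> (1/2) ^ m" using p2 by (intro power_mono) auto
      hence "(d_primepow k (m + 2))\<^sup>2 * (1 / real p) ^ m / real p ^ 2 \<le> (d_primepow k (m + 2))\<^sup>2 * (1/2) ^ m / real p ^ 2"
        by (intro divide_right_mono mult_left_mono) auto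
      thus "(d_primepow k (m + 2))\<^sup>2 / real p ^ (m + 2) \<le> (d_primepow k (m + 2))\<^sup>2 * (1/2) ^ m / real p ^ 2"
        by (simp add: power_one_over power2_eq_square mult_ac)
    qed
    also have "\<dots> = C / real p ^ 2" unfolding C_def by (rule suminf_divide[OF sm])
    finally show ?thesis .
  qed
  moreover have "(\<Sum>m. (d_primepow k (m + 2))\<^sup>2 / real p ^ (m + 2)) \<ge> 0" if "prime p" for p
    by (intro suminf_nonneg smp that) auto
  ultimately show ?thesis using eq C0 by (intro that[of C]) auto
qed

lemma local_factor_ge_1: "k \<ge> 0 \<Longrightarrow> prime p \<Longrightarrow> local_factor k p \<ge> 1"
  using trunc_factor_ge_1 trunc_factor_le_local_factor order_trans by blast

lemma local_factor_le_exp: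
  assumes k: "k \<ge> 0"
  obtains C where "C \<ge> 0" "\<And>p. prime p \<Longrightarrow> local_factor k p \<le> exp (C / real p)"
proof -
  obtain C where C: "C \<ge> 0" "\<And>p. prime p \<Longrightarrow> 1 + k\<^sup>2 / real p \<le> local_factor k p"
    "\<And>p. prime p \<Longrightarrow> local_factor k p \<le> 1 + k\<^sup>2 / real p + C / real p ^ 2"
    by (rule local_factor_expansion[OF k]) (rule that)
  show ?thesis
  proof (rule that[of "k\<^sup>2 + C"])
    fix p :: nat assume p: "prime p"
    have "real p \<ge> 1" using prime_ge_1_nat[OF p] by simp
    hence "C / real p ^ 2 \<le> C / real p"
      using C(1) by (intro divide_left_mono) (auto simp: power2_eq_square)
    hence "local_factor k p \<le> 1 + (k\<^sup>2 + C) / real p"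
      using C(3)[OF p] by (simp add: add_divide_distrib)
    also have "\<dots> \<le> exp ((k\<^sup>2 + C) / real p)" by (rule exp_ge_add_one_self)
    finally show "local_factor k p \<le> exp ((k\<^sup>2 + C) / real p)" .
  qed (use C(1) in simp)
qed

text \<open>The power of \<open>1 - 1 / p\<close> cancels the term \<open>k^2 / p\<close> of the
  local factor, so each factor is \<open>1 + O(1 / p^2)\<close> and the product converges
  absolutely; it is nonzero because no factor vanishes.\<close>

lemma a_const_convergent:
  assumes k: "k \<ge> 0"
  shows "(\<lambda>N. \<Prod>p\<in>primes_upto N. (1 - 1 / real p) powr (k\<^sup>2) * local_factor k p) \<longlonglongrightarrow> a_const k"
    and "a_const k \<noteq> 0"
proof -
  define f where "f p = (if prime p then (1 - 1 / real p) powr (k\<^sup>2) * local_factor k p else 1)" for p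
  define a where "a = k\<^sup>2"
  define h where "h p = (1 - 1 / real p) powr a * (1 + a / real p) - 1" for p :: nat
  obtain C where C: "C \<ge> 0" "\<And>p. prime p \<Longrightarrow> 1 + k\<^sup>2 / real p \<le> local_factor k p"
    "\<And>p. prime p \<Longrightarrow> local_factor k p \<le> 1 + k\<^sup>2 / real p + C / real p ^ 2"
    by (rule local_factor_expansion[OF k]) (rule that)
  have sq: "summable (\<lambda>p. inverse (real p ^ 2))" by (rule inverse_power_summable) simp
  have "h \<in> O(\<lambda>p. inverse (real p ^ 2))"
    unfolding h_def by real_asymp
  hence "(\<lambda>p. norm (h p)) \<in> O(\<lambda>p. inverse (real p ^ 2))"
    by simp
  moreover have "summable (\<lambda>p. norm (inverse (real p ^ 2)))" using sq by simp
  ultimately have smh: "summable (\<lambda>p. norm (h p))"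
    by (rule summable_comparison_test_bigo[rotated])
  have "summable (\<lambda>p. norm (f p - 1))"
  proof (rule summable_comparison_test')
    show "summable (\<lambda>p. norm (h p) + C * inverse (real p ^ 2))"
      by (intro summable_add smh summable_mult sq)
    fix p :: nat
    show "norm (norm (f p - 1)) \<le> norm (h p) + C * inverse (real p ^ 2)"
    proof (cases "prime p")
      case True
      have p1: "real p > 1" using prime_gt_1_nat[OF True] by simp
      define v where "v = (1 - 1 / real p) powr a"
      have v: "0 \<le> v" "v \<le> 1"
        using p1 unfolding v_def a_def by (auto intro!: powr_le1)
      have "f p - 1 = h p + v * (local_factor k p - (1 + k\<^sup>2 / real p))"
        using True by (simp add: f_def h_def v_def a_def algebra_simps)
      moreover have "\<bar>v * (local_factor k p - (1 + k\<^sup>2 / real p))\<bar> \<le> 1 * (C / real p ^ 2)"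
        unfolding abs_mult using C(2,3)[OF True] v by (intro mult_mono) auto
      ultimately show ?thesis by (simp add: divide_inverse)
    next
      case False
      thus ?thesis using C(1) by (simp add: f_def)
    qed
  qed
  hence conv: "convergent_prod f"
    by (intro abs_convergent_prod_imp_convergent_prod summable_imp_abs_convergent_prod)
  have a_eq: "a_const k = prodinf f" by (simp add: a_const_def f_def[abs_def])
  have "(\<Prod>i\<le>N. f i) = (\<Prod>p\<in>primes_upto N. (1 - 1 / real p) powr (k\<^sup>2) * local_factor k p)" for N
    by (rule prod.mono_neutral_cong_right) (auto simp: f_def)
  thus "(\<lambda>N. \<Prod>p\<in>primes_upto N. (1 - 1 / real p) powr (k\<^sup>2) * local_factor k p) \<longlonglongrightarrow> a_const k"
    using convergent_prod_LIMSEQ[OF conv] by (simp add: a_eq)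
  have "f p \<noteq> 0" for p
    using local_factor_ge_1[OF k, of p] prime_gt_1_nat[of p] by (auto simp: f_def)
  thus "a_const k \<noteq> 0" unfolding a_eq using conv by (intro prodinf_nonzero)
qed

text \<open>Multiplication by \<open>exp (k^2 * M N)\<close> removes the convergence factors from
  the partial product of \<open>a_const\<close>, and \<open>M N\<close> is
  \<open>ln (ln N) + euler_mascheroni + o(1)\<close>.\<close>

lemma local_factor_prod_asymp_nat:
  assumes k: "k \<ge> 0"
  shows "(\<lambda>N. (\<Prod>p\<in>primes_upto N. local_factor k p) /
           (a_const k * (exp euler_mascheroni * ln (real N)) powr (k\<^sup>2))) \<longlonglongrightarrow> 1"
proof -
  let ?P = primes_upto
  define M where "M N = (\<Sum>p\<in>?P N. - ln (1 - 1 / real p))" for N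
  define G where "G N = (\<Prod>p\<in>?P N. (1 - 1 / real p) powr (k\<^sup>2) * local_factor k p)" for N
  have "G \<longlonglongrightarrow> a_const k" unfolding G_def by (rule a_const_convergent[OF k])
  hence "(\<lambda>N. G N / a_const k * exp (k\<^sup>2 * (M N - ln (ln (real N)) - euler_mascheroni))) \<longlonglongrightarrow>
      a_const k / a_const k * exp (k\<^sup>2 * (euler_mascheroni - euler_mascheroni))"
    unfolding M_def by (intro tendsto_intros mertens_third a_const_convergent(2)[OF k])
  hence lim: "(\<lambda>N. G N / a_const k * exp (k\<^sup>2 * (M N - ln (ln (real N)) - euler_mascheroni))) \<longlonglongrightarrow> 1"
    using a_const_convergent(2)[OF k] by simp
  have "eventually (\<lambda>N. G N / a_const k * exp (k\<^sup>2 * (M N - ln (ln (real N)) - euler_mascheroni)) =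
    (\<Prod>p\<in>?P N. local_factor k p) / (a_const k * (exp euler_mascheroni * ln (real N)) powr (k\<^sup>2))) sequentially"
    using eventually_ge_at_top[of 3]
  proof eventually_elim
    case (elim N)
    have "(\<Prod>p\<in>?P N. local_factor k p) = G N * exp (k\<^sup>2 * M N)"
    proof -
      have "exp (k\<^sup>2 * M N) = (\<Prod>p\<in>?P N. exp (k\<^sup>2 * (- ln (1 - 1 / real p))))"
        unfolding M_def sum_distrib_left by (rule exp_sum) simp
      hence "G N * exp (k\<^sup>2 * M N) =
          (\<Prod>p\<in>?P N. (1 - 1 / real p) powr (k\<^sup>2) * local_factor k p * exp (k\<^sup>2 * (- ln (1 - 1 / real p))))"
        by (simp add: G_def prod.distrib)
      also have "\<dots> = (\<Prod>p\<in>?P N. local_factor k p)"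
      proof (intro prod.cong refl)
        fix p assume "p \<in> ?P N"
        hence "real p > 1" using prime_gt_1_nat by auto
        thus "(1 - 1 / real p) powr (k\<^sup>2) * local_factor k p * exp (k\<^sup>2 * (- ln (1 - 1 / real p))) = local_factor k p"
          by (simp add: powr_def exp_minus)
      qed
      finally show ?thesis ..
    qed
    moreover have "(exp euler_mascheroni * ln (real N)) powr (k\<^sup>2) = exp (k\<^sup>2 * (euler_mascheroni + ln (ln (real N))))"
    proof -
      have "ln (real N) > 0" using elim by simp
      thus ?thesis by (simp add: powr_def ln_mult)
    qed
    ultimately show ?case
      using a_const_convergent(2)[OF k] by (simp add: exp_diff exp_add algebra_simps)
  qed
  with lim show ?thesis by (rule Lim_transform_eventually)
qed

lemma filterlim_nat_floor: "filterlim (\<lambda>x::real. nat \<lfloor>x\<rfloor>) at_top at_top"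
  by real_asymp

lemma local_factor_prod_asymp:
  assumes k: "k \<ge> 0"
  shows "((\<lambda>x. (\<Prod>p\<in>primes_upto (nat \<lfloor>x\<rfloor>). local_factor k p) /
           (a_const k * (exp euler_mascheroni * ln x) powr (k\<^sup>2))) \<longlongrightarrow> 1) at_top"
proof -
  let ?P = "\<lambda>x::real. \<Prod>p\<in>primes_upto (nat \<lfloor>x\<rfloor>). local_factor k p"
  have "((\<lambda>x::real. ln (real (nat \<lfloor>x\<rfloor>)) / ln x) \<longlongrightarrow> 1) at_top" by real_asymp
  hence "((\<lambda>x. ?P x / (a_const k * (exp euler_mascheroni * ln (real (nat \<lfloor>x\<rfloor>))) powr (k\<^sup>2)) *
      (ln (real (nat \<lfloor>x\<rfloor>)) / ln x) powr (k\<^sup>2)) \<longlongrightarrow> 1 * 1 powr (k\<^sup>2)) at_top"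
    by (intro tendsto_mult filterlim_compose[OF local_factor_prod_asymp_nat[OF k] filterlim_nat_floor]
          tendsto_powr tendsto_const) auto
  hence lim: "((\<lambda>x. ?P x / (a_const k * (exp euler_mascheroni * ln (real (nat \<lfloor>x\<rfloor>))) powr (k\<^sup>2)) *
      (ln (real (nat \<lfloor>x\<rfloor>)) / ln x) powr (k\<^sup>2)) \<longlongrightarrow> 1) at_top" by simp
  have "eventually (\<lambda>x. ?P x / (a_const k * (exp euler_mascheroni * ln (real (nat \<lfloor>x\<rfloor>))) powr (k\<^sup>2)) *
      (ln (real (nat \<lfloor>x\<rfloor>)) / ln x) powr (k\<^sup>2) =
      ?P x / (a_const k * (exp euler_mascheroni * ln x) powr (k\<^sup>2))) at_top"
    using eventually_ge_at_top[of 3]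
  proof eventually_elim
    case (elim x)
    have "nat \<lfloor>x\<rfloor> \<ge> 3" using elim by (simp add: le_nat_iff le_floor_iff)
    hence "ln (real (nat \<lfloor>x\<rfloor>)) > 0" "ln x > 0" using elim by auto
    thus ?case by (simp add: powr_mult powr_divide)
  qed
  with lim show ?thesis by (rule Lim_transform_eventually)
qed

section \<open>Large prime divisors of the modulus\<close>

definition prime_log_sum :: "real \<Rightarrow> real" where
  "prime_log_sum x = (\<Sum>p\<in>primes_upto (nat \<lfloor>x\<rfloor>). - ln (1 - 1 / real p))"

lemma prime_log_sum_tendsto:
  "((\<lambda>x. prime_log_sum x - ln (ln x)) \<longlongrightarrow> euler_mascheroni) at_top"
proof -
  have "((\<lambda>x::real. ln (ln (real (nat \<lfloor>x\<rfloor>))) - ln (ln x)) \<longlongrightarrow> 0) at_top" by real_asymp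
  from tendsto_add[OF filterlim_compose[OF mertens_third filterlim_nat_floor] this]
  show ?thesis by (simp add: prime_log_sum_def)
qed

lemma prime_log_sum_powr_diff:
  assumes c: "c > 1"
  shows "((\<lambda>x. prime_log_sum (x powr c) - prime_log_sum x) \<longlongrightarrow> ln c) at_top"
proof -
  have "filterlim (\<lambda>x::real. x powr c) at_top at_top" using c by real_asymp
  from tendsto_diff[OF filterlim_compose[OF prime_log_sum_tendsto this] prime_log_sum_tendsto]
  have lim: "((\<lambda>x. (prime_log_sum (x powr c) - ln (ln (x powr c))) - (prime_log_sum x - ln (ln x)) + ln c) \<longlongrightarrow> ln c) at_top"
    by (auto intro: tendsto_eq_intros)
  have "eventually (\<lambda>x. (prime_log_sum (x powr c) - ln (ln (x powr c))) - (prime_log_sum x - ln (ln x)) + ln c =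
     prime_log_sum (x powr c) - prime_log_sum x) at_top"
    using eventually_ge_at_top[of 3]
  proof eventually_elim
    case (elim x)
    have "ln x > 0" using elim by simp
    hence "ln (ln (x powr c)) = ln c + ln (ln x)" using c elim by (simp add: ln_powr ln_mult)
    thus ?case by simp
  qed
  with lim show ?thesis by (rule Lim_transform_eventually)
qed

text \<open>Up to \<open>y\<close>, drop the condition \<open>p dvd q\<close> and use
  \<open>1 / p \<le> - ln (1 - 1 / p)\<close>; beyond \<open>y\<close>, each prime divisor
  contributes at most \<open>1 / y\<close>.\<close>

lemma sum_large_prime_divisors_le:
  assumes q: "q > 0" and x: "x \<ge> 0" "x \<le> y" "y > 0"
  shows "(\<Sum>p | prime p \<and> p dvd q \<and> \<not> real p \<le> x. 1 / real p) \<le>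
    (prime_log_sum y - prime_log_sum x) + real (card (prime_factors q)) / y"
proof -
  let ?A = "{p. prime p \<and> p dvd q \<and> \<not> real p \<le> x \<and> real p \<le> y}"
  let ?B = "{p. prime p \<and> p dvd q \<and> \<not> real p \<le> x \<and> \<not> real p \<le> y}"
  have fin: "finite ?A" "finite ?B"
    using q by (auto intro: finite_subset[OF _ finite_set_mset[of "prime_factorization q"]] simp: prime_factors_dvd)
  have "{p. prime p \<and> p dvd q \<and> \<not> real p \<le> x} = ?A \<union> ?B" by auto
  hence "(\<Sum>p | prime p \<and> p dvd q \<and> \<not> real p \<le> x. 1 / real p) = (\<Sum>p\<in>?A. 1 / real p) + (\<Sum>p\<in>?B. 1 / real p)"
    using fin by (simp only:) (rule sum.union_disjoint, auto)
  also have "(\<Sum>p\<in>?A. 1 / real p) \<le> prime_log_sum y - prime_log_sum x"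
  proof -
    let ?Y = "{p::nat. prime p \<and> p \<le> nat \<lfloor>y\<rfloor>}" and ?X = "{p::nat. prime p \<and> p \<le> nat \<lfloor>x\<rfloor>}"
    have le: "1 / real p \<le> - ln (1 - 1 / real p)" "0 \<le> - ln (1 - 1 / real p)" if "prime p" for p
    proof -
      have "real p > 1" using prime_gt_1_nat[OF that] by simp
      thus "1 / real p \<le> - ln (1 - 1 / real p)" using ln_le_minus_one[of "1 - 1 / real p"] by simp
      moreover have "1 / real p \<ge> 0" by simp
      ultimately show "0 \<le> - ln (1 - 1 / real p)" by linarith
    qed
    have sub: "?X \<subseteq> ?Y" using x by (auto intro: order_trans simp: nat_mono floor_mono)
    have "(\<Sum>p\<in>?A. 1 / real p) \<le> (\<Sum>p\<in>?A. - ln (1 - 1 / real p))"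
      using le by (intro sum_mono) auto
    also have "\<dots> \<le> (\<Sum>p\<in>?Y - ?X. - ln (1 - 1 / real p))"
    proof (rule sum_mono2)
      show "finite (?Y - ?X)" by (rule finite_Diff) (rule finite_primes_le)
      show "?A \<subseteq> ?Y - ?X" using x by (auto simp: le_nat_iff le_floor_iff)
    qed (use le in auto)
    also have "\<dots> = prime_log_sum y - prime_log_sum x"
      unfolding prime_log_sum_def using sub by (subst sum_diff) auto
    finally show ?thesis .
  qed
  also have "(\<Sum>p\<in>?B. 1 / real p) \<le> real (card (prime_factors q)) / y"
  proof -
    have "(\<Sum>p\<in>?B. 1 / real p) \<le> (\<Sum>p\<in>?B. 1 / y)"
      using x by (intro sum_mono divide_left_mono) auto
    also have "\<dots> = real (card ?B) / y" by simp
    also have "\<dots> \<le> real (card (prime_factors q)) / y"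
    proof -
      have "card ?B \<le> card (prime_factors q)"
        using q by (intro card_mono) (auto simp: prime_factors_dvd)
      thus ?thesis using x by (intro divide_right_mono) auto
    qed
    finally show ?thesis .
  qed
  finally show ?thesis by simp
qed

lemma large_prime_divisors_tendsto_0:
  fixes F :: "'i filter" and X :: "'i \<Rightarrow> real" and q :: "'i \<Rightarrow> nat"
  assumes X: "filterlim X at_top F" and q: "filterlim q at_top F"
    and w: "\<forall>\<epsilon>>0. (\<lambda>i. real (card (prime_factors (q i)))) \<in> O[F](\<lambda>i. X i powr (1 + \<epsilon>))"
  shows "((\<lambda>i. \<Sum>p | prime p \<and> p dvd q i \<and> \<not> real p \<le> X i. 1 / real p) \<longlongrightarrow> 0) F"
proof (rule tendstoI)
  fix e :: real assume e: "e > 0"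
  \<comment> \<open>With \<open>y = X powr (1 + 2 * \<epsilon>)\<close>, the primes in
    \<open>(X, y]\<close> cost less than \<open>3 * \<epsilon>\<close> because
    \<open>ln (1 + 2 * \<epsilon>) \<le> 2 * \<epsilon>\<close>, and those beyond \<open>y\<close>
    less than \<open>\<epsilon>\<close>.\<close>
  define \<epsilon> where "\<epsilon> = e / 4"
  have \<epsilon>: "\<epsilon> > 0" using e by (simp add: \<epsilon>_def)
  obtain K where K: "K > 0"
    "eventually (\<lambda>i. norm (real (card (prime_factors (q i)))) \<le> K * norm (X i powr (1 + \<epsilon>))) F"
    using w \<epsilon> by (auto elim!: landau_o.bigE)
  have "ln (1 + 2 * \<epsilon>) < 3 * \<epsilon>" using ln_add_one_self_le_self[of "2 * \<epsilon>"] \<epsilon> by simp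
  with prime_log_sum_powr_diff[of "1 + 2 * \<epsilon>"] \<epsilon>
  have "eventually (\<lambda>x. prime_log_sum (x powr (1 + 2 * \<epsilon>)) - prime_log_sum x < 3 * \<epsilon>) at_top"
    by (intro order_tendstoD(2)) auto
  hence ev1: "eventually (\<lambda>i. prime_log_sum (X i powr (1 + 2 * \<epsilon>)) - prime_log_sum (X i) < 3 * \<epsilon>) F"
    using X by (rule eventually_compose_filterlim)
  have "((\<lambda>x. K * x powr (1 + \<epsilon>) / x powr (1 + 2 * \<epsilon>)) \<longlongrightarrow> 0) at_top"
    using \<epsilon> by real_asymp
  hence "eventually (\<lambda>x. K * x powr (1 + \<epsilon>) / x powr (1 + 2 * \<epsilon>) < \<epsilon>) at_top"
    using \<epsilon> by (intro order_tendstoD(2)) auto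
  hence ev2: "eventually (\<lambda>i. K * X i powr (1 + \<epsilon>) / X i powr (1 + 2 * \<epsilon>) < \<epsilon>) F"
    using X by (rule eventually_compose_filterlim)
  have ev3: "eventually (\<lambda>i. X i \<ge> 2) F" using X by (simp add: filterlim_at_top)
  have ev4: "eventually (\<lambda>i. q i \<ge> 1) F" using q by (simp add: filterlim_at_top)
  show "eventually (\<lambda>i. dist (\<Sum>p | prime p \<and> p dvd q i \<and> \<not> real p \<le> X i. 1 / real p) 0 < e) F"
    using ev1 ev2 ev3 ev4 K(2)
  proof eventually_elim
    case (elim i)
    define y where "y = X i powr (1 + 2 * \<epsilon>)"
    have y: "X i \<le> y" "y > 0"
      using elim(3) \<epsilon> powr_mono[of 1 "1 + 2 * \<epsilon>" "X i"] by (auto simp: y_def)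
    have "(\<Sum>p | prime p \<and> p dvd q i \<and> \<not> real p \<le> X i. 1 / real p) \<le>
        (prime_log_sum y - prime_log_sum (X i)) + real (card (prime_factors (q i))) / y"
      using elim y by (intro sum_large_prime_divisors_le) auto
    also have "real (card (prime_factors (q i))) / y \<le> K * X i powr (1 + \<epsilon>) / y"
      using elim(5) y by (intro divide_right_mono) auto
    finally have "(\<Sum>p | prime p \<and> p dvd q i \<and> \<not> real p \<le> X i. 1 / real p) < 4 * \<epsilon>"
      using elim(1,2) by (simp add: y_def)
    moreover have "(\<Sum>p | prime p \<and> p dvd q i \<and> \<not> real p \<le> X i. 1 / real p) \<ge> 0"
      by (intro sum_nonneg) auto
    ultimately show ?case by (simp add: \<epsilon>_def dist_real_def)
  qed
qed

text \<open>For \<open>L = ln q\<close> the two factors are at most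
  \<open>exp (- \<eta> * (L / 2 - ln 4))\<close> and \<open>exp (B * L powr \<theta>)\<close>; the
  first prevails because \<open>\<theta> < 1\<close>.\<close>

lemma off_diagonal_tendsto_0:
  fixes F :: "'i filter" and X :: "'i \<Rightarrow> real" and q :: "'i \<Rightarrow> nat"
  assumes \<delta>: "\<delta> > 0" and k: "k \<ge> 0" and pos: "eventually (\<lambda>i. phi_star (q i) > 0) F"
    and X: "filterlim X at_top F" and q: "filterlim q at_top F"
    and bigo: "X \<in> O[F](\<lambda>i. ln (real (q i)) powr (2 - \<delta>))"
  obtains \<eta> where "0 < \<eta>" "\<eta> < 1/2"
    "((\<lambda>i. real (phi_star (q i)) powr (-\<eta>) * exp (4 * k * real (nat \<lfloor>X i\<rfloor>) powr (1/2 + \<eta>))) \<longlongrightarrow> 0) F"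
proof -
  \<comment> \<open>Capping \<open>\<delta>\<close> at 1 keeps \<open>2 - d\<close> positive; then
    \<open>\<eta> = d / 8\<close> gives \<open>\<theta> = 1 - d / 4 - d^2 / 8\<close>, strictly
    between 0 and 1.\<close>
  define d where "d = min \<delta> 1"
  have d: "0 < d" "d \<le> 1" "d \<le> \<delta>" using \<delta> by (auto simp: d_def)
  define \<eta> where "\<eta> = d / 8"
  have \<eta>: "0 < \<eta>" "\<eta> < 1/2" using d by (auto simp: \<eta>_def)
  define \<theta> where "\<theta> = (2 - d) * (1/2 + \<eta>)"
  have "\<theta> = 1 - d / 4 - d * d / 8" by (simp add: \<theta>_def \<eta>_def field_simps)
  hence \<theta>: "\<theta> < 1" using d mult_pos_pos[OF d(1) d(1)] by linarith
  have \<theta>0: "\<theta> > 0" unfolding \<theta>_def using d \<eta> by (intro mult_pos_pos) auto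
  obtain C where C: "C > 0" "eventually (\<lambda>i. norm (X i) \<le> C * norm (ln (real (q i)) powr (2 - \<delta>))) F"
    using bigo by (auto elim!: landau_o.bigE)
  \<comment> \<open>The summand 1 keeps \<open>B\<close> positive when \<open>k = 0\<close>.\<close>
  define B where "B = 4 * k * C powr (1/2 + \<eta>) + 1"
  have B: "B > 0" using k by (simp add: B_def add_nonneg_pos)
  have G: "((\<lambda>L. exp (B * L powr \<theta> - \<eta> * (L / 2 - ln 4))) \<longlongrightarrow> 0) at_top"
    using \<theta> \<theta>0 \<eta> B by real_asymp
  have "filterlim (\<lambda>i. ln (real (q i))) at_top F"
    by (intro filterlim_compose[OF ln_at_top] filterlim_compose[OF filterlim_real_sequentially q])
  hence lim: "((\<lambda>i. exp (B * ln (real (q i)) powr \<theta> - \<eta> * (ln (real (q i)) / 2 - ln 4))) \<longlongrightarrow> 0) F"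
    by (rule filterlim_compose[OF G])
  have ev1: "eventually (\<lambda>i. X i \<ge> 2) F" using X by (simp add: filterlim_at_top)
  have ev2: "eventually (\<lambda>i. q i \<ge> 3) F" using q by (simp add: filterlim_at_top)
  show ?thesis
  proof (rule that[OF \<eta>], rule tendsto_sandwich[OF _ _ tendsto_const lim])
    show "eventually (\<lambda>i. 0 \<le> real (phi_star (q i)) powr (-\<eta>) * exp (4 * k * real (nat \<lfloor>X i\<rfloor>) powr (1/2 + \<eta>))) F"
      by simp
    show "eventually (\<lambda>i. real (phi_star (q i)) powr (-\<eta>) * exp (4 * k * real (nat \<lfloor>X i\<rfloor>) powr (1/2 + \<eta>)) \<le>
       exp (B * ln (real (q i)) powr \<theta> - \<eta> * (ln (real (q i)) / 2 - ln 4))) F"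
      using ev1 ev2 C(2) pos
    proof eventually_elim
      case (elim i)
      define L where "L = ln (real (q i))"
      have L: "L \<ge> 1"
      proof -
        have "ln (exp 1) \<le> ln (real (q i))"
          using elim(2) exp_le by (subst ln_le_cancel_iff) auto
        thus ?thesis by (simp add: L_def)
      qed
      have "X i \<le> C * L powr (2 - \<delta>)" using elim(1,3) by (simp add: L_def)
      also have "\<dots> \<le> C * L powr (2 - d)" using L d C(1) by (intro mult_left_mono powr_mono) auto
      finally have XL: "X i \<le> C * L powr (2 - d)" .
      have "real (nat \<lfloor>X i\<rfloor>) \<le> X i" using elim(1) by simp
      hence "real (nat \<lfloor>X i\<rfloor>) powr (1/2 + \<eta>) \<le> (C * L powr (2 - d)) powr (1/2 + \<eta>)"
        using XL \<eta> by (intro powr_mono2) auto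
      also have "\<dots> = C powr (1/2 + \<eta>) * L powr \<theta>"
        using C(1) L by (simp add: powr_mult powr_powr \<theta>_def)
      finally have "4 * k * real (nat \<lfloor>X i\<rfloor>) powr (1/2 + \<eta>) \<le> 4 * k * (C powr (1/2 + \<eta>) * L powr \<theta>)"
        using k by (intro mult_left_mono) auto
      also have "\<dots> \<le> B * L powr \<theta>" by (simp add: B_def algebra_simps)
      finally have e: "exp (4 * k * real (nat \<lfloor>X i\<rfloor>) powr (1/2 + \<eta>)) \<le> exp (B * L powr \<theta>)" by simp
      define \<phi> where "\<phi> = real (phi_star (q i))"
      have \<phi>0: "\<phi> > 0" using elim(4) by (simp add: \<phi>_def)
      have "real (q i) \<le> 16 * \<phi>\<^sup>2"
        unfolding \<phi>_def using elim by (intro phi_star_lower_bound) auto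
      hence "ln (real (q i)) \<le> ln (16 * \<phi>\<^sup>2)" using elim(2) \<phi>0 by (subst ln_le_cancel_iff) auto
      also have "16 * \<phi>\<^sup>2 = (4 * \<phi>)\<^sup>2" by (simp add: power_mult_distrib)
      also have "ln \<dots> = 2 * ln (4 * \<phi>)" using \<phi>0 by (subst ln_realpow) auto
      also have "ln (4 * \<phi>) = ln 4 + ln \<phi>" using \<phi>0 by (intro ln_mult_pos) auto
      finally have "L / 2 - ln 4 \<le> ln \<phi>" by (simp add: L_def)
      hence "\<eta> * (L / 2 - ln 4) \<le> \<eta> * ln \<phi>" using \<eta> by (intro mult_left_mono) auto
      hence "\<phi> powr (-\<eta>) \<le> exp (- (\<eta> * (L / 2 - ln 4)))" using \<phi>0 by (simp add: powr_def)
      hence "\<phi> powr (-\<eta>) * exp (4 * k * real (nat \<lfloor>X i\<rfloor>) powr (1/2 + \<eta>)) \<le>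
             exp (- (\<eta> * (L / 2 - ln 4))) * exp (B * L powr \<theta>)"
        using e by (intro mult_mono) auto
      also have "\<dots> = exp (B * L powr \<theta> - \<eta> * (L / 2 - ln 4))" by (simp flip: exp_add)
      finally show ?case unfolding \<phi>_def L_def .
    qed
  qed
qed

theorem theorem2:
  fixes F :: "'i filter" and X :: "'i \<Rightarrow> real" and q :: "'i \<Rightarrow> nat" and \<delta> k :: real
  assumes "\<delta> > 0" and "k \<ge> 0"
    and "\<forall>\<^sub>F i in F. phi_star (q i) > 0"
    and "filterlim X at_top F" and "filterlim q at_top F"
    and "X \<in> O[F](\<lambda>i. ln (real (q i)) powr (2 - \<delta>))"
  shows "(\<lambda>i. primitive_moment k (X i) (q i)) \<sim>[F]
           (\<lambda>i. a_const k *
                (\<Prod>p | prime p \<and> real p \<le> X i \<and> p dvd q i. inverse (local_factor k p)) *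
                (exp euler_mascheroni * ln (X i)) powr (k\<^sup>2))
       \<and> ((\<forall>\<epsilon>>0. (\<lambda>i. real (card (prime_factors (q i)))) \<in> O[F](\<lambda>i. X i powr (1 + \<epsilon>))) \<longrightarrow>
          (\<lambda>i. primitive_moment k (X i) (q i)) \<sim>[F]
            (\<lambda>i. a_const k *
                 (\<Prod>p | prime p \<and> p dvd q i. inverse (local_factor k p)) *
                 (exp euler_mascheroni * ln (X i)) powr (k\<^sup>2)))"
proof (intro conjI impI)
  note k = \<open>k \<ge> 0\<close> and X = \<open>filterlim X at_top F\<close> and q = \<open>filterlim q at_top F\<close>
  let ?L = "local_factor k" and ?m = "\<lambda>i. primitive_moment k (X i) (q i)"
  define N where "N i = nat \<lfloor>X i\<rfloor>" for i
  define E where "E i = a_const k * (exp euler_mascheroni * ln (X i)) powr (k\<^sup>2)" for i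
  define D where "D i = (\<Prod>p | prime p \<and> p \<le> N i \<and> \<not> p dvd q i. trunc_factor k (N i) p)" for i
  define R where "R i = (\<Prod>p | prime p \<and> p \<le> N i \<and> \<not> p dvd q i. ?L p)" for i
  define T where "T i = (\<Prod>p\<in>primes_upto (N i). ?L p)" for i
  define g where "g i = a_const k *
                (\<Prod>p | prime p \<and> real p \<le> X i \<and> p dvd q i. inverse (?L p)) *
                (exp euler_mascheroni * ln (X i)) powr (k\<^sup>2)" for i
  define h where "h i = a_const k * (\<Prod>p | prime p \<and> p dvd q i. inverse (?L p)) *
                 (exp euler_mascheroni * ln (X i)) powr (k\<^sup>2)" for i
  have Lpos: "?L p > 0" if "prime p" for p using local_factor_ge_1[OF k that] by simp
  have ev_X: "eventually (\<lambda>i. X i \<ge> 2) F" using X by (simp add: filterlim_at_top)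
  have ev_q: "eventually (\<lambda>i. q i \<ge> 1) F" using q by (simp add: filterlim_at_top)
  have D1: "D i \<ge> 1" for i
    unfolding D_def using trunc_factor_ge_1[OF k] by (intro prod_ge_1) auto
  have R0: "R i > 0" for i unfolding R_def using Lpos by (intro prod_pos) auto
  obtain \<eta> where \<eta>: "0 < \<eta>" "\<eta> < 1/2"
    "((\<lambda>i. real (phi_star (q i)) powr (-\<eta>) * exp (4 * k * real (nat \<lfloor>X i\<rfloor>) powr (1/2 + \<eta>))) \<longlongrightarrow> 0) F"
    by (rule off_diagonal_tendsto_0[OF assms]) (rule that)
  \<comment> \<open>As \<open>D i \<ge> 1\<close>, an absolute error tending to 0 is also a relative
    one.\<close>
  have "((\<lambda>i. (?m i - D i) / D i) \<longlongrightarrow> 0) F"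
  proof (rule Lim_null_comparison[OF _ \<eta>(3)])
    show "eventually (\<lambda>i. norm ((?m i - D i) / D i) \<le>
      real (phi_star (q i)) powr (-\<eta>) * exp (4 * k * real (nat \<lfloor>X i\<rfloor>) powr (1/2 + \<eta>))) F"
      using ev_X ev_q assms(3)
    proof eventually_elim
      case (elim i)
      have "norm ((?m i - D i) / D i) \<le> \<bar>?m i - D i\<bar>"
        using D1[of i] by (simp add: abs_divide divide_le_eq mult_le_cancel_left1)
      also have "\<dots> \<le> real (phi_star (q i)) powr (-\<eta>) * exp (4 * k * real (nat \<lfloor>X i\<rfloor>) powr (1/2 + \<eta>))"
        unfolding D_def N_def using elim \<eta> by (intro primitive_moment_approx k) auto
      finally show ?case .
    qed
  qed
  hence lim1: "((\<lambda>i. 1 + (?m i - D i) / D i) \<longlongrightarrow> 1) F" by (auto intro: tendsto_eq_intros)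
  obtain K where K: "\<And>N P. P \<subseteq> primes_upto N \<Longrightarrow>
      1 - K * real N powr (-1/4) \<le> (\<Prod>p\<in>P. trunc_factor k N p) / (\<Prod>p\<in>P. ?L p) \<and>
      (\<Prod>p\<in>P. trunc_factor k N p) / (\<Prod>p\<in>P. ?L p) \<le> 1"
    by (rule trunc_factor_prod_ratio[OF k]) (rule that)
  have lim2: "((\<lambda>i. D i / R i) \<longlongrightarrow> 1) F"
  proof (rule tendsto_sandwich[OF _ _ _ tendsto_const])
    have "1 - K * real (N i) powr (-1/4) \<le> D i / R i \<and> D i / R i \<le> 1" for i
      unfolding D_def R_def by (rule K) auto
    thus "eventually (\<lambda>i. 1 - K * real (N i) powr (-1/4) \<le> D i / R i) F" "eventually (\<lambda>i. D i / R i \<le> 1) F"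
      by auto
    have "(\<lambda>n. 1 - K * real n powr (-1/4)) \<longlonglongrightarrow> 1" by real_asymp
    moreover have "filterlim N at_top F"
      unfolding N_def by (rule filterlim_compose[OF filterlim_nat_floor X])
    ultimately show "((\<lambda>i. 1 - K * real (N i) powr (-1/4)) \<longlongrightarrow> 1) F" by (rule filterlim_compose)
  qed
  have lim3: "((\<lambda>i. T i / E i) \<longlongrightarrow> 1) F"
    unfolding T_def E_def N_def by (rule filterlim_compose[OF local_factor_prod_asymp[OF k] X])
  \<comment> \<open>The product telescopes to the moment divided by \<open>g\<close>: with
    \<open>Z\<close> the product over the primes up to \<open>X\<close> that divide
    \<open>q\<close>, one has \<open>T = R * Z\<close> and \<open>g = E / Z\<close>.\<close>
  have lim: "((\<lambda>i. (1 + (?m i - D i) / D i) * (D i / R i) * (T i / E i)) \<longlongrightarrow> 1) F"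
    using tendsto_mult[OF tendsto_mult[OF lim1 lim2] lim3] by simp
  have "eventually (\<lambda>i. (1 + (?m i - D i) / D i) * (D i / R i) * (T i / E i) = ?m i / g i) F"
    using ev_X
  proof eventually_elim
    case (elim i)
    define Z where "Z = (\<Prod>p | prime p \<and> p \<le> N i \<and> p dvd q i. ?L p)"
    have Z0: "Z > 0" unfolding Z_def using Lpos by (intro prod_pos) auto
    have fin: "finite {p. prime p \<and> p \<le> N i \<and> p dvd q i}" "finite {p. prime p \<and> p \<le> N i \<and> \<not> p dvd q i}"
      by (rule finite_subset[OF _ finite_primes_le[of "N i"]]; auto)+
    have "{p. prime p \<and> p \<le> N i} = {p. prime p \<and> p \<le> N i \<and> \<not> p dvd q i} \<union> {p. prime p \<and> p \<le> N i \<and> p dvd q i}"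
      by auto
    hence T: "T i = R i * Z"
      unfolding T_def R_def Z_def using fin by (simp only:) (rule prod.union_disjoint, auto)
    have "{p. prime p \<and> real p \<le> X i \<and> p dvd q i} = {p. prime p \<and> p \<le> N i \<and> p dvd q i}"
      using elim by (auto simp: N_def le_nat_iff le_floor_iff)
    hence g: "g i = E i / Z"
      by (simp add: g_def E_def Z_def prod_inversef[unfolded o_def] divide_inverse mult_ac)
    show ?case unfolding g T using D1[of i] R0[of i] Z0 by (simp add: field_simps)
  qed
  with lim have "((\<lambda>i. ?m i / g i) \<longlongrightarrow> 1) F" by (rule Lim_transform_eventually)
  hence part1: "?m \<sim>[F] g" by (rule asymp_equivI')
  thus "?m \<sim>[F] (\<lambda>i. a_const k *
                (\<Prod>p | prime p \<and> real p \<le> X i \<and> p dvd q i. inverse (?L p)) *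
                (exp euler_mascheroni * ln (X i)) powr (k\<^sup>2))"
    by (simp only: g_def[abs_def])
  assume w: "\<forall>\<epsilon>>0. (\<lambda>i. real (card (prime_factors (q i)))) \<in> O[F](\<lambda>i. X i powr (1 + \<epsilon>))"
  obtain C where C: "C \<ge> 0" "\<And>p. prime p \<Longrightarrow> ?L p \<le> exp (C / real p)"
    by (rule local_factor_le_exp[OF k]) (rule that)
  define S where "S i = (\<Sum>p | prime p \<and> p dvd q i \<and> \<not> real p \<le> X i. 1 / real p)" for i
  define V where "V i = (\<Prod>p | prime p \<and> p dvd q i \<and> \<not> real p \<le> X i. ?L p)" for i
  have S: "(S \<longlongrightarrow> 0) F" unfolding S_def by (rule large_prime_divisors_tendsto_0[OF X q w])
  have V: "(V \<longlongrightarrow> 1) F"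
  proof (rule tendsto_sandwich[OF _ _ tendsto_const])
    show "eventually (\<lambda>i. 1 \<le> V i) F"
      unfolding V_def using local_factor_ge_1[OF k] by (intro always_eventually allI prod_ge_1) auto
    show "eventually (\<lambda>i. V i \<le> exp (C * S i)) F"
      using ev_q
    proof eventually_elim
      case (elim i)
      have fin: "finite {p. prime p \<and> p dvd q i \<and> \<not> real p \<le> X i}"
        using elim by (intro finite_subset[OF _ finite_set_mset[of "prime_factorization (q i)"]]) (auto simp: prime_factors_dvd)
      have "V i \<le> (\<Prod>p | prime p \<and> p dvd q i \<and> \<not> real p \<le> X i. exp (C / real p))"
        unfolding V_def using C(2) Lpos by (intro prod_mono) (auto simp: less_imp_le)
      also have "\<dots> = exp (C * S i)"
        unfolding S_def sum_distrib_left by (simp add: exp_sum[OF fin])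
      finally show ?case .
    qed
    have "((\<lambda>i. exp (C * S i)) \<longlongrightarrow> exp (C * 0)) F" by (intro tendsto_intros S)
    thus "((\<lambda>i. exp (C * S i)) \<longlongrightarrow> 1) F" by simp
  qed
  \<comment> \<open>The two main terms differ exactly by the prime divisors of \<open>q\<close>
    beyond \<open>X\<close>; \<open>X i \<ge> 2\<close> makes the logarithm nonzero, so that
    \<open>g\<close> and \<open>h\<close> do not vanish.\<close>
  have "eventually (\<lambda>i. V i = g i / h i) F"
    using ev_q ev_X
  proof eventually_elim
    case (elim i)
    let ?A = "{p. prime p \<and> real p \<le> X i \<and> p dvd q i}" and ?B = "{p. prime p \<and> p dvd q i \<and> \<not> real p \<le> X i}"
    have fin: "finite {p. prime p \<and> p dvd q i}"
      using elim by (intro finite_subset[OF _ finite_set_mset[of "prime_factorization (q i)"]]) (auto simp: prime_factors_dvd)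
    have finAB: "finite ?A" "finite ?B" by (rule finite_subset[OF _ fin]; auto)+
    have "{p. prime p \<and> p dvd q i} = ?A \<union> ?B" by auto
    hence "(\<Prod>p | prime p \<and> p dvd q i. inverse (?L p)) = (\<Prod>p\<in>?A. inverse (?L p)) * (\<Prod>p\<in>?B. inverse (?L p))"
      using finAB by (simp only:) (rule prod.union_disjoint, auto)
    moreover have "(\<Prod>p\<in>?B. inverse (?L p)) = inverse (V i)" by (simp add: V_def prod_inversef[unfolded o_def])
    ultimately have h: "h i = g i * inverse (V i)" by (simp add: h_def g_def mult_ac)
    have "?L p \<noteq> 0" if "prime p" for p using Lpos[OF that] by simp
    hence "g i \<noteq> 0" using a_const_convergent(2)[OF k] elim by (auto simp: g_def)
    moreover have "V i > 0" unfolding V_def using Lpos by (intro prod_pos) auto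
    ultimately show ?case by (simp add: h field_simps)
  qed
  with V have "((\<lambda>i. g i / h i) \<longlongrightarrow> 1) F" by (rule Lim_transform_eventually)
  hence "g \<sim>[F] h" by (rule asymp_equivI')
  with part1 have "?m \<sim>[F] h" by (rule asymp_equiv_trans)
  thus "?m \<sim>[F] (\<lambda>i. a_const k * (\<Prod>p | prime p \<and> p dvd q i. inverse (?L p)) *
                 (exp euler_mascheroni * ln (X i)) powr (k\<^sup>2))"
    by (simp only: h_def[abs_def])
qed

end
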